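(* Let $F: \mathbb{R}^m \to \mathbb{R}^n$ be a bounded (possibly discontinuous) semialgebraic function. Then there exist $\mathcal{N} \in ISDnet(m,n,1)$ and $c_{\max} \ge 0$ such that $\mathrm{SANN}^{lim}(\mathcal{N}, x, c_{\max}) = F(x)$ for all $x\in\mathbb{R}^m$.
   Context: For $D \subseteq \mathbb{R}^N$, $ISD(D)$ is the smallest set of functions $D \to \mathbb{R}$ containing all restrictions of real polynomials and closed under pointwise $\min$ and $\max$; vector/matrix-valued functions are ISD if all entries are. $ISDnet(m,n,k) := ISD(\mathbb{R}^m\times\mathbb{R}^{n+k}\times\mathbb{R},\ \mathbb{R}^{(n+k)\times(n+k)}\times\mathbb{R}^{n+k})$; for $\mathcal N$ in it write $\mathcal N(x,z,s) = (M(x,z,s), b(x,z,s))$. For $c\ge 0$, $\mathrm{clamp\text{-}sol}_c(M,b) := \mathrm{clamp}(M^{-1}b,-c,c)$ if $M$ is invertible and $0$ otherwise, with clamp applied componentwise ($a_i\mapsto\min(\max(a_i,-c),c)$). $\mathrm{SANN}^{lim}(\mathcal N,x,c_{\max})$ is the vector of the first $n$ components of $z(1)$, where $z:[0,1]\to\mathbb{R}^{n+k}$ is the (exact) solution of $\dot z(s) = \mathrm{clamp\text{-}sol}_{c_{\max}}(M(x,z(s),s), b(x,z(s),s))$, $z(0)=0$. A semialgebraic function is one whose graph is a semialgebraic set. *)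

theory Defs
  imports "HOL-Analysis.Analysis"
begin

(* Points of R^N are represented as real lists of length N. *)

(* Real polynomial functions R^N -> R (as functions on lists; only lists of length N matter) *)
inductive poly_fun :: "nat \<Rightarrow> (real list \<Rightarrow> real) \<Rightarrow> bool" for N where
  pf_const: "poly_fun N (\<lambda>xs. c)"
| pf_proj: "i < N \<Longrightarrow> poly_fun N (\<lambda>xs. xs ! i)"
| pf_add: "poly_fun N p \<Longrightarrow> poly_fun N q \<Longrightarrow> poly_fun N (\<lambda>xs. p xs + q xs)"
| pf_mult: "poly_fun N p \<Longrightarrow> poly_fun N q \<Longrightarrow> poly_fun N (\<lambda>xs. p xs * q xs)"

inductive isd_gen :: "nat \<Rightarrow> (real list \<Rightarrow> real) \<Rightarrow> bool" for N where
  isd_poly: "poly_fun N p \<Longrightarrow> isd_gen N p"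
| isd_min: "isd_gen N f \<Longrightarrow> isd_gen N g \<Longrightarrow> isd_gen N (\<lambda>xs. min (f xs) (g xs))"
| isd_max: "isd_gen N f \<Longrightarrow> isd_gen N g \<Longrightarrow> isd_gen N (\<lambda>xs. max (f xs) (g xs))"

definition ISD :: "nat \<Rightarrow> (real list \<Rightarrow> real) \<Rightarrow> bool" where
  "ISD N f \<longleftrightarrow> (\<exists>g. isd_gen N g \<and> (\<forall>xs. length xs = N \<longrightarrow> f xs = g xs))"

(* ISDnet(m,n,k): matrix entries Mf i j and vector entries bf i (i,j < n+k) are ISD functions
   of the concatenated input x @ z @ [s] \<in> R^m \<times> R^(n+k) \<times> R *)
definition ISDnet :: "nat \<Rightarrow> nat \<Rightarrow> nat \<Rightarrow>
    (nat \<Rightarrow> nat \<Rightarrow> real list \<Rightarrow> real) \<Rightarrow> (nat \<Rightarrow> real list \<Rightarrow> real) \<Rightarrow> bool" where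
  "ISDnet m n k Mf bf \<longleftrightarrow>
     (\<forall>i < n + k. \<forall>j < n + k. ISD (m + (n + k) + 1) (Mf i j)) \<and>
     (\<forall>i < n + k. ISD (m + (n + k) + 1) (bf i))"

inductive semialg_set :: "nat \<Rightarrow> real list set \<Rightarrow> bool" for N where
  sa_basic: "poly_fun N p \<Longrightarrow> semialg_set N {xs. length xs = N \<and> p xs > 0}"
| sa_compl: "semialg_set N S \<Longrightarrow> semialg_set N ({xs. length xs = N} - S)"
| sa_union: "semialg_set N S \<Longrightarrow> semialg_set N T \<Longrightarrow> semialg_set N (S \<union> T)"
| sa_inter: "semialg_set N S \<Longrightarrow> semialg_set N T \<Longrightarrow> semialg_set N (S \<inter> T)"

definition semialg_fun :: "nat \<Rightarrow> nat \<Rightarrow> (real list \<Rightarrow> real list) \<Rightarrow> bool" where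
  "semialg_fun m n F \<longleftrightarrow>
     (\<forall>x. length x = m \<longrightarrow> length (F x) = n) \<and>
     semialg_set (m + n) {x @ F x | x. length x = m}"

definition bounded_fun :: "nat \<Rightarrow> nat \<Rightarrow> (real list \<Rightarrow> real list) \<Rightarrow> bool" where
  "bounded_fun m n F \<longleftrightarrow> (\<exists>B. \<forall>x. length x = m \<longrightarrow> (\<forall>i < n. \<bar>F x ! i\<bar> \<le> B))"

definition mat_invertible :: "nat \<Rightarrow> (nat \<Rightarrow> nat \<Rightarrow> real) \<Rightarrow> bool" where
  "mat_invertible d M \<longleftrightarrow> (\<exists>A. \<forall>i < d. \<forall>j < d.
      (\<Sum>l<d. M i l * A l j) = (if i = j then 1 else 0) \<and>
      (\<Sum>l<d. A i l * M l j) = (if i = j then 1 else 0))"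

definition mat_inv :: "nat \<Rightarrow> (nat \<Rightarrow> nat \<Rightarrow> real) \<Rightarrow> (nat \<Rightarrow> nat \<Rightarrow> real)" where
  "mat_inv d M = (THE A. (\<forall>i j. (i \<ge> d \<or> j \<ge> d) \<longrightarrow> A i j = 0) \<and> (\<forall>i < d. \<forall>j < d.
      (\<Sum>l<d. M i l * A l j) = (if i = j then 1 else 0) \<and>
      (\<Sum>l<d. A i l * M l j) = (if i = j then 1 else 0)))"

definition clamp :: "real \<Rightarrow> real \<Rightarrow> real" where
  "clamp c a = min (max a (- c)) c"

definition clamp_sol :: "real \<Rightarrow> nat \<Rightarrow> (nat \<Rightarrow> nat \<Rightarrow> real) \<Rightarrow> (nat \<Rightarrow> real) \<Rightarrow> real list" where
  "clamp_sol c d M b =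
     (if mat_invertible d M
      then map (\<lambda>i. clamp c (\<Sum>j<d. mat_inv d M i j * b j)) [0..<d]
      else replicate d 0)"

definition SANN_solution :: "nat \<Rightarrow> nat \<Rightarrow> nat \<Rightarrow>
    (nat \<Rightarrow> nat \<Rightarrow> real list \<Rightarrow> real) \<Rightarrow> (nat \<Rightarrow> real list \<Rightarrow> real) \<Rightarrow>
    real list \<Rightarrow> real \<Rightarrow> (real \<Rightarrow> real list) \<Rightarrow> bool" where
  "SANN_solution m n k Mf bf x c z \<longleftrightarrow>
     (\<forall>s \<in> {0..1}. length (z s) = n + k) \<and>
     z 0 = replicate (n + k) 0 \<and>
     (\<forall>s \<in> {0..1}. \<forall>i < n + k.
        ((\<lambda>t. z t ! i) has_real_derivative
           (clamp_sol c (n + k) (\<lambda>a b. Mf a b (x @ z s @ [s])) (\<lambda>a. bf a (x @ z s @ [s])) ! i))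
        (at s within {0..1}))"

definition SANN_lim_eq :: "nat \<Rightarrow> nat \<Rightarrow> nat \<Rightarrow>
    (nat \<Rightarrow> nat \<Rightarrow> real list \<Rightarrow> real) \<Rightarrow> (nat \<Rightarrow> real list \<Rightarrow> real) \<Rightarrow>
    real list \<Rightarrow> real \<Rightarrow> real list \<Rightarrow> bool" where
  "SANN_lim_eq m n k Mf bf x c v \<longleftrightarrow>
     (\<exists>z. SANN_solution m n k Mf bf x c z) \<and>
     (\<forall>z. SANN_solution m n k Mf bf x c z \<longrightarrow> take n (z 1) = v)"

end

theory Submission
  imports Defs "HOL-Computational_Algebra.Polynomial" "HOL-Library.Multiset"
begin

text \<open>
  The matrix is a scalar multiple of the identity, so the velocity is \<open>b\<^sub>i / d\<close> (and \<open>0\<close> where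
  \<open>d = 0\<close>), and the time interval is cut into phases in each of which a single component moves.

  A quotient \<open>max g 0 / max g 0\<close> is the indicator of \<open>g > 0\<close>. Hence the extra component can compute
  an integer code of the signs at \<open>x\<close> of finitely many polynomials. By Tarski--Seidenberg these can
  be chosen such that the code determines the signs at \<open>y = F x ! i\<close> of a finite family of polynomials
  in \<open>(x, y)\<close> which is closed under \<open>y\<close>-derivatives and contains a nonzero one vanishing at \<open>F x ! i\<close>.
  By Thom's lemma the total violation \<open>q\<close> of these sign conditions is an ISD function of
  \<open>y\<close> and the code that vanishes only at \<open>y = F x ! i\<close>.

  It remains to move \<open>y\<close> upwards from \<open>A = - B\<close> so that it stops at the zero \<open>f\<close> of \<open>q\<close>,
  differentiably, with bounded speed, and within a time that does not depend on \<open>x\<close>. This is done by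
  \<open>y' = q y / (q y + w\<^sup>K)\<close> with the slack \<open>w = max 0 (y - A + 1 - t)\<close>. As \<open>w' = y' - 1\<close>, the slack is used
  up while \<open>q y\<close> is small compared with it, and \<open>y\<close> moves otherwise. Both run out simultaneously, at
  time \<open>t = f - A + 1\<close>. If \<open>K\<close> exceeds the order of vanishing of \<open>q\<close> at \<open>f\<close>, then \<open>y\<close> arrives
  with speed \<open>0\<close>.
\<close>

text \<open>Two obstacles shape the construction. ISD functions are continuous, so a jump of
  \<open>F\<close> can enter only through a quotient. A quotient with vanishing denominator in turn
  makes the velocity field discontinuous, so general existence and uniqueness theorems do not apply,
  while the claim concerns every solution. Existence therefore comes from an explicit trajectory,
  and uniqueness of the end point from the fact that a solution is differentiable even where the
  field jumps.

  The slack is forced as well. With \<open>y' = q y\<close> the point \<open>f\<close> is never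
  reached. With \<open>y' = q y / q y\<close> it is reached at full speed, and a differentiable
  solution cannot stop there. Along the trajectory the slack satisfies dw/dy = - w^K / q y, which
  can be solved by separation of variables; \<open>K\<close> is \<open>Suc a\<close>, where
  \<open>a\<close> bounds the degrees of all polynomials involved.

  Quantifier elimination is used in a formula-free form: it is enough to know that the signs of
  finitely many polynomials in the parameters decide a condition, without writing down how.\<close>

section \<open>Sign patterns of polynomials on a line\<close>

text \<open>The maps \<open>i\<close> and \<open>i'\<close> number the cells of two subdivisions of the line on which all signs are
  constant; the common range says that the cells correspond in order.\<close>

definition line_equiv :: "(real poly \<times> real poly) set \<Rightarrow> bool" where
  "line_equiv B \<longleftrightarrow> (\<exists>(i :: real \<Rightarrow> int) i'. mono i \<and> mono i' \<and> range i = range i' \<and>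
     (\<forall>(q, q')\<in>B. \<forall>y y'. i y = i' y' \<longrightarrow> sgn (poly q y) = sgn (poly q' y')))"

text \<open>The fibres of such an \<open>i\<close> are the single points of \<open>Z\<close> and the
  components of the complement of \<open>Z\<close>. Taking the closed interval is what isolates each
  point of \<open>Z\<close> in a fibre of its own.\<close>

definition root_index :: "real set \<Rightarrow> (real \<Rightarrow> int) \<Rightarrow> bool" where
  "root_index Z i \<longleftrightarrow> mono i \<and> (\<forall>y1 y2. y1 < y2 \<longrightarrow> (i y1 = i y2 \<longleftrightarrow> Z \<inter> {y1..y2} = {}))"

text \<open>Forgets all subdivision points outside \<open>Z\<close>. Points of \<open>Z\<close>
  receive odd numbers and the gaps between them even ones. The new number is a function of
  \<open>i y\<close> alone, so two lines with equal cell ranges keep equal ranges after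
  coarsening.\<close>

lemma root_index_coarsen:
  fixes i :: "real \<Rightarrow> int"
  assumes mi: "mono i" and fin: "finite Z"
    and sat: "\<And>y y2. y \<in> Z \<Longrightarrow> i y2 = i y \<Longrightarrow> y2 \<in> Z"
  shows "root_index Z (\<lambda>y. 2 * int (card {l \<in> i ` Z. l < i y}) + (if i y \<in> i ` Z then 1 else 0))"
proof -
  define C where "C = i ` Z"
  define N where "N k = card {l \<in> C. l < k}" for k
  define \<kappa> where "\<kappa> k = 2 * int (N k) + (if k \<in> C then 1 else 0)" for k
  have finC: "finite C" using fin by (simp add: C_def)
  have Nmono: "N k \<le> N k'" if "k \<le> k'" for k k'
    unfolding N_def using that finC by (intro card_mono) auto
  have Nstep: "N k < N k'" if "k < k'" "k \<in> C" for k k'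
    unfolding N_def using that finC by (intro psubset_card_mono) auto
  have step: "\<kappa> k < \<kappa> k'" if "k < k'" "k \<in> C \<or> k' \<in> C" for k k'
    using Nstep[of k k'] Nmono[of k k'] that by (auto simp: \<kappa>_def)
  have \<kappa>mono: "\<kappa> k \<le> \<kappa> k'" if "k \<le> k'" for k k'
    using step[of k k'] Nmono[of k k'] that by (cases "k = k'") (auto simp: \<kappa>_def)
  \<comment> \<open>By monotonicity fibres of \<open>i\<close> are order-convex, and by
    \<open>sat\<close> a fibre meeting \<open>Z\<close> lies in \<open>Z\<close>; as
    \<open>Z\<close> is finite, it is one point.\<close>
  have single: "y2 = y" if "y \<in> Z" "i y2 = i y" for y y2
  proof (rule ccontr)
    assume "y2 \<noteq> y"
    then have inf: "infinite {min y y2..max y y2}" by (auto simp: infinite_Icc_iff)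
    have "{min y y2..max y y2} \<subseteq> Z"
    proof
      fix t assume "t \<in> {min y y2..max y y2}"
      then have "i (min y y2) \<le> i t" "i t \<le> i (max y y2)" using mi by (auto simp: mono_def)
      then have "i t = i y" using that(2) by (auto simp: min_def max_def split: if_splits)
      then show "t \<in> Z" using sat that(1) by blast
    qed
    then show False using inf fin finite_subset by blast
  qed
  have "\<kappa> (i y1) = \<kappa> (i y2) \<longleftrightarrow> Z \<inter> {y1..y2} = {}" if "y1 < y2" for y1 y2
  proof
    assume eq: "\<kappa> (i y1) = \<kappa> (i y2)"
    show "Z \<inter> {y1..y2} = {}"
    proof (rule ccontr)
      assume "Z \<inter> {y1..y2} \<noteq> {}"
      then obtain r where r: "r \<in> Z" "y1 \<le> r" "r \<le> y2" by auto
      have le: "i y1 \<le> i r" "i r \<le> i y2" using r mi by (auto simp: mono_def)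
      have rC: "i r \<in> C" using r by (auto simp: C_def)
      show False
      proof (cases "r < y2")
        case True
        then have "i r < i y2" using le single[of r y2] r by fastforce
        then show False using step[of "i r" "i y2"] \<kappa>mono[OF le(1)] rC eq by auto
      next
        case False
        then have "r = y2" using r by auto
        then have "i y1 < i r" using le single[of r y1] r that by fastforce
        then show False using step[of "i y1" "i r"] rC eq \<open>r = y2\<close> by auto
      qed
    qed
  next
    assume e: "Z \<inter> {y1..y2} = {}"
    have le: "i y1 \<le> i y2" using that mi by (auto simp: mono_def)
    have "l \<notin> C" if l: "i y1 \<le> l" "l \<le> i y2" for l
    proof
      assume "l \<in> C"
      then obtain r where r: "r \<in> Z" "l = i r" by (auto simp: C_def)
      consider "r < y1" | "r > y2" using e r by force
      then show False
      proof cases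
        case 1
        then have "i r = i y1" using mi r l by (auto simp: mono_def intro!: antisym)
        then show False using single[of r y1] r 1 by auto
      next
        case 2
        then have "i r = i y2" using mi r l by (auto simp: mono_def intro!: antisym)
        then show False using single[of r y2] r 2 by auto
      qed
    qed
    note nC = this
    have "{l \<in> C. l < i y1} = {l \<in> C. l < i y2}"
      by (intro Collect_cong) (use nC le in \<open>metis linorder_not_le order_less_le_trans less_imp_le\<close>)
    moreover have "i y1 \<notin> C" "i y2 \<notin> C" using le nC by blast+
    ultimately show "\<kappa> (i y1) = \<kappa> (i y2)" by (simp add: \<kappa>_def N_def)
  qed
  moreover have "mono (\<lambda>y. \<kappa> (i y))" using \<kappa>mono mi by (auto simp: mono_def)
  ultimately show ?thesis unfolding root_index_def \<kappa>_def N_def C_def by blast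
qed

lemma poly_sgn_eq:
  fixes q :: "real poly"
  assumes "\<And>t. a \<le> t \<Longrightarrow> t \<le> b \<Longrightarrow> poly q t \<noteq> 0" "a \<le> b"
  shows "sgn (poly q a) = sgn (poly q b)"
proof (rule ccontr)
  assume ne: "sgn (poly q a) \<noteq> sgn (poly q b)"
  then have "a < b" using assms(2) by (cases "a = b") auto
  moreover have "poly q a \<noteq> 0" "poly q b \<noteq> 0" using assms by auto
  then have "poly q a * poly q b < 0" using ne by (auto simp: sgn_if mult_less_0_iff split: if_splits)
  ultimately obtain t where "a < t" "t < b" "poly q t = 0" using poly_IVT by blast
  then show False using assms(1)[of t] by auto
qed

text \<open>False for general functions, as - exp (- t) shows. For a polynomial the derivative is
  eventually at least its leading coefficient, which is positive, so growth is at least linear. This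
  settles cells that are unbounded to the right.\<close>

lemma poly_pos_of_pderiv_pos:
  fixes q :: "real poly"
  assumes "\<And>t. y \<le> t \<Longrightarrow> 0 < poly (pderiv q) t"
  shows "\<exists>t\<ge>y. 0 < poly q t"
proof -
  let ?d = "pderiv q"
  have "?d \<noteq> 0" using assms[of y] by auto
  have "lead_coeff ?d > 0"
  proof (rule ccontr)
    assume "\<not> ?thesis"
    then have "lead_coeff (- ?d) > 0" using \<open>?d \<noteq> 0\<close> by (simp add: less_le not_less)
    from poly_pinfty_gt_lc[OF this] obtain n where "\<And>t. t \<ge> n \<Longrightarrow> poly (- ?d) t \<ge> lead_coeff (- ?d)" by blast
    from this[of "max n y"] assms[of "max n y"] \<open>lead_coeff (- ?d) > 0\<close> show False by auto
  qed
  from poly_pinfty_gt_lc[OF this] obtain n where n: "\<And>t. t \<ge> n \<Longrightarrow> poly ?d t \<ge> lead_coeff ?d" by blast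
  define a where "a = max n y"
  define c where "c = lead_coeff ?d"
  \<comment> \<open>Far enough out for slope at least \<open>c\<close> to outweigh the value at
    \<open>a\<close>.\<close>
  define t where "t = a + (\<bar>poly q a\<bar> + 1) / c"
  have c: "c > 0" using \<open>lead_coeff ?d > 0\<close> by (simp add: c_def)
  have "a < t" using c by (simp add: t_def add_nonneg_pos)
  then obtain x where x: "a < x" "x < t" "poly q t - poly q a = (t - a) * poly ?d x" using poly_MVT by blast
  have "(t - a) * c \<le> (t - a) * poly ?d x" using n[of x] x \<open>a < t\<close> by (intro mult_left_mono) (auto simp: a_def c_def)
  moreover have "(t - a) * c = \<bar>poly q a\<bar> + 1" using c by (simp add: t_def)
  ultimately have "poly q t > 0" using x(3) by linarith
  then show ?thesis using \<open>a < t\<close> by (intro exI[of _ t]) (auto simp: a_def)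
qed

text \<open>The situation in which \<open>p\<close> and \<open>p'\<close> are to be added to
  matching subdivisions. By \<open>dZ\<close> the polynomial \<open>p\<close> is strictly monotone
  on each component of the complement of \<open>Z\<close>, by \<open>dm\<close> in the same
  direction as \<open>p'\<close>, and by \<open>pm\<close> the signs at the end points agree. These
  data determine which signs occur on each component.\<close>

locale line_match =
  fixes i i' :: "real \<Rightarrow> int" and Z Z' :: "real set" and p p' :: "real poly"
  assumes ri: "root_index Z i" and ri': "root_index Z' i'"
    and fin: "finite Z" and fin': "finite Z'"
    and ran: "range i = range i'"
    and Zm: "\<And>y y'. i y = i' y' \<Longrightarrow> y \<in> Z \<longleftrightarrow> y' \<in> Z'"
    and dm: "\<And>y y'. i y = i' y' \<Longrightarrow> sgn (poly (pderiv p) y) = sgn (poly (pderiv p') y')"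
    and dZ: "\<And>y. poly (pderiv p) y = 0 \<Longrightarrow> y \<in> Z" and dZ': "\<And>y. poly (pderiv p') y = 0 \<Longrightarrow> y \<in> Z'"
    and pm: "\<And>y y'. i y = i' y' \<Longrightarrow> y \<in> Z \<Longrightarrow> sgn (poly p y) = sgn (poly p' y')"

section \<open>Symmetries of a matching\<close>

lemma line_match_sym:
  assumes "line_match i i' Z Z' p p'" shows "line_match i' i Z' Z p' p"
proof -
  interpret line_match i i' Z Z' p p' by fact
  show ?thesis
  proof
    show "y \<in> Z' \<longleftrightarrow> y' \<in> Z" if "i' y = i y'" for y y' using Zm[of y' y] that by simp
    show "sgn (poly (pderiv p') y) = sgn (poly (pderiv p) y')" if "i' y = i y'" for y y'
      using dm[of y' y] that by simp
    show "sgn (poly p' y) = sgn (poly p y')" if "i' y = i y'" "y \<in> Z'" for y y'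
      using pm[of y' y] Zm[of y' y] that by simp
  qed (fact ri ri' fin fin' ran[symmetric] dZ dZ')+
qed

lemma line_match_uminus:
  assumes "line_match i i' Z Z' p p'" shows "line_match i i' Z Z' (- p) (- p')"
proof -
  interpret line_match i i' Z Z' p p' by fact
  show ?thesis
  proof
    show "sgn (poly (pderiv (- p)) y) = sgn (poly (pderiv (- p')) y')" if "i y = i' y'" for y y'
      using dm[OF that] by (simp add: pderiv_minus sgn_minus)
    show "sgn (poly (- p) y) = sgn (poly (- p') y')" if "i y = i' y'" "y \<in> Z" for y y'
      using pm[OF that] by (simp add: sgn_minus)
    show "y \<in> Z" if "poly (pderiv (- p)) y = 0" for y using dZ that by (simp add: pderiv_minus)
    show "y \<in> Z'" if "poly (pderiv (- p')) y = 0" for y using dZ' that by (simp add: pderiv_minus)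
  qed (fact ri ri' fin fin' ran Zm)+
qed

lemma root_index_reflect:
  assumes "root_index Z i" shows "root_index (uminus ` Z) (\<lambda>y. - i (- y))"
proof -
  have "(uminus ` Z \<inter> {y1..y2} = {}) \<longleftrightarrow> Z \<inter> {- y2..- y1} = {}" for y1 y2
    by force
  moreover have "i (- y1) = i (- y2) \<longleftrightarrow> Z \<inter> {- y2..- y1} = {}" if "y1 < y2" for y1 y2
    using assms that unfolding root_index_def by (metis neg_less_iff_less)
  ultimately show ?thesis using assms unfolding root_index_def by (simp add: mono_def)
qed

lemma pderiv_reflect: "poly (pderiv (p \<circ>\<^sub>p [:0, -1:])) (y::real) = - poly (pderiv p) (- y)"
  by (simp add: pderiv_pcompose pderiv_pCons poly_pcompose)

text \<open>Reflection turns a decreasing \<open>p\<close> into an increasing one; together with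
  \<open>line_match_uminus\<close> it reduces the transfer of signs to positive values of an
  increasing polynomial. The index is negated too, to stay monotone.\<close>

lemma line_match_reflect:
  assumes "line_match i i' Z Z' p p'"
  shows "line_match (\<lambda>y. - i (- y)) (\<lambda>y. - i' (- y)) (uminus ` Z) (uminus ` Z')
    (p \<circ>\<^sub>p [:0, -1:]) (p' \<circ>\<^sub>p [:0, -1:])"
proof -
  interpret line_match i i' Z Z' p p' by fact
  have mem: "y \<in> uminus ` X \<longleftrightarrow> - y \<in> X" for y :: real and X by force
  have "range (\<lambda>y. - i (- y)) = range (\<lambda>y. - i' (- y))"
  proof -
    have "range (\<lambda>y. - f (- y)) = uminus ` range f" for f :: "real \<Rightarrow> int"
      by (auto simp: image_iff) (metis minus_minus)
    then show ?thesis using ran by simp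
  qed
  note ran' = this
  show ?thesis
  proof
    show "y \<in> uminus ` Z \<longleftrightarrow> y' \<in> uminus ` Z'" if "- i (- y) = - i' (- y')" for y y'
      using Zm[of "- y" "- y'"] that by (simp add: mem)
    show "sgn (poly (pderiv (p \<circ>\<^sub>p [:0, -1:])) y) = sgn (poly (pderiv (p' \<circ>\<^sub>p [:0, -1:])) y')"
      if "- i (- y) = - i' (- y')" for y y'
      using dm[of "- y" "- y'"] that by (simp add: pderiv_reflect sgn_minus)
    show "sgn (poly (p \<circ>\<^sub>p [:0, -1:]) y) = sgn (poly (p' \<circ>\<^sub>p [:0, -1:]) y')"
      if "- i (- y) = - i' (- y')" "y \<in> uminus ` Z" for y y'
      using pm[of "- y" "- y'"] that by (simp add: mem poly_pcompose)
    show "y \<in> uminus ` Z" if "poly (pderiv (p \<circ>\<^sub>p [:0, -1:])) y = 0" for y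
      using dZ[of "- y"] that by (simp add: mem pderiv_reflect)
    show "y \<in> uminus ` Z'" if "poly (pderiv (p' \<circ>\<^sub>p [:0, -1:])) y = 0" for y
      using dZ'[of "- y"] that by (simp add: mem pderiv_reflect)
  qed (use ri ri' fin fin' ran' in \<open>simp_all add: root_index_reflect\<close>)
qed

lemma root_index_less:
  assumes "root_index Z i" "i s < i t" shows "s < t"
proof (rule ccontr)
  assume "\<not> s < t"
  then have "i t \<le> i s" using assms(1) by (auto simp: root_index_def mono_def)
  then show False using assms(2) by simp
qed

lemma root_index_lessI:
  assumes "root_index Z i" "s < t" "s \<in> Z \<or> t \<in> Z" shows "i s < i t"
proof -
  have "i s \<le> i t" using assms by (auto simp: root_index_def mono_def)
  moreover have "i s \<noteq> i t" using assms by (auto simp: root_index_def)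
  ultimately show ?thesis by simp
qed

lemma root_index_eqI:
  assumes "root_index Z i" "\<And>z. z \<in> Z \<Longrightarrow> min s t \<le> z \<Longrightarrow> z \<le> max s t \<Longrightarrow> False"
  shows "i s = i t"
proof (cases s t rule: linorder_cases)
  case less
  then have "Z \<inter> {s..t} = {}" using assms(2) by (auto simp: disjoint_iff)
  then show ?thesis using assms(1) less unfolding root_index_def by blast
next
  case greater
  then have "Z \<inter> {t..s} = {}" using assms(2) by (auto simp: disjoint_iff)
  then show ?thesis using assms(1) greater unfolding root_index_def by metis
qed simp

lemma root_index_eqD:
  assumes "root_index Z i" "i s = i t" "s \<noteq> t" "z \<in> Z" "min s t \<le> z" "z \<le> max s t"
  shows False
proof (cases "s < t")
  case True
  then show ?thesis using assms unfolding root_index_def by (auto simp: disjoint_iff)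
next
  case False
  then have "t < s" using assms by auto
  then have "Z \<inter> {t..s} = {}" using assms unfolding root_index_def by metis
  then show ?thesis using \<open>t < s\<close> assms by (auto simp: disjoint_iff)
qed

context line_match
begin

text \<open>As \<open>p'\<close> increases on the cell of \<open>y'\<close>, positive values are to
  be sought at its right end. If the cell is unbounded, \<open>poly_pos_of_pderiv_pos\<close>
  provides one. Otherwise its right end \<open>r'\<close> corresponds to the right end
  \<open>r\<close> of the cell of \<open>y\<close>; there \<open>p\<close> is positive because it
  increases from \<open>t\<close> to \<open>r\<close>, so \<open>p'\<close> is positive at
  \<open>r'\<close> and, by continuity, slightly to the left of it.\<close>

lemma ex_pos_right:
  assumes eq: "i y = i' y'" "i t = i y" and yZ: "y \<notin> Z" and d: "0 < poly (pderiv p) y" and pos: "0 < poly p t"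
  shows "\<exists>t'. i' t' = i' y' \<and> 0 < poly p' t'"
proof -
  have yZ': "y' \<notin> Z'" using Zm eq yZ by blast
  have cd': "0 < poly (pderiv p') u" if "i' u = i' y'" for u
    using dm[of y u] that eq d by (auto simp: sgn_if split: if_splits)
  have cd: "0 < poly (pderiv p) u" if "i u = i y" for u
    using dm[of u y'] cd'[of y'] that eq by (auto simp: sgn_if split: if_splits)
  define U where "U = {z \<in> Z'. y' < z}"
  show ?thesis
  proof (cases "U = {}")
    case True
    have same: "i' u = i' y'" if "y' \<le> u" for u
    proof (rule root_index_eqI[OF ri'])
      fix z assume "z \<in> Z'" "min u y' \<le> z"
      then have "y' \<le> z" "z \<noteq> y'" using that yZ' by auto
      then show False using True \<open>z \<in> Z'\<close> by (auto simp: U_def)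
    qed
    have "\<exists>u\<ge>y'. 0 < poly p' u" by (rule poly_pos_of_pderiv_pos) (rule cd'[OF same])
    then show ?thesis using same by blast
  next
    case False
    have finU: "finite U" using fin' by (simp add: U_def)
    define r' where "r' = Min U"
    have r'U: "r' \<in> U" using finU False by (simp add: r'_def)
    then have r': "r' \<in> Z'" "y' < r'" by (auto simp: U_def)
    have gap': "z \<notin> Z'" if "y' \<le> z" "z < r'" for z
    proof
      assume "z \<in> Z'"
      then have "z \<in> U" using that yZ' by (cases "z = y'") (auto simp: U_def)
      then show False using Min_le[OF finU] that by (force simp: r'_def)
    qed
    \<comment> \<open>A point of \<open>Z\<close> between \<open>y\<close> and this partner of
      \<open>r'\<close> would have a partner between \<open>y'\<close> and \<open>r'\<close>, so
      \<open>r\<close> is the right end of the cell of \<open>y\<close>.\<close>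
    obtain r where r: "i r = i' r'" using ran by (metis rangeE rangeI)
    have rZ: "r \<in> Z" using Zm r r' by blast
    have ilt: "i y < i r" using root_index_lessI[OF ri' r'(2)] r' r eq by simp
    then have yr: "y < r" and tr: "t < r" using root_index_less[OF ri] eq by auto
    have gap: "z \<notin> Z" if "y \<le> z" "z < r" for z
    proof
      assume "z \<in> Z"
      then have "y < z" using yZ that by (cases "z = y") auto
      obtain z' where z': "i z = i' z'" using ran by (metis rangeE rangeI)
      have "i' y' < i' z'" "i' z' < i' r'"
        using root_index_lessI[OF ri \<open>y < z\<close>] root_index_lessI[OF ri that(2)] \<open>z \<in> Z\<close> eq r z' by auto
      then have "y' < z'" "z' < r'" using root_index_less[OF ri'] by auto
      then show False using gap'[of z'] Zm[OF z'] \<open>z \<in> Z\<close> by auto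
    qed
    obtain x where x: "t < x" "x < r" "poly p r - poly p t = (r - t) * poly (pderiv p) x"
      using poly_MVT[OF tr] by blast
    have "i x = i t"
    proof (rule root_index_eqI[OF ri])
      fix z assume z: "z \<in> Z" "min x t \<le> z" "z \<le> max x t"
      then have "z < r" "t \<le> z" using x by auto
      then have "z < y" using gap[of z] z(1) by (meson not_le)
      then show False using root_index_eqD[OF ri eq(2) _ z(1)] \<open>t \<le> z\<close> by auto
    qed
    then have "0 < poly (pderiv p) x" using cd eq by simp
    then have "0 < poly p r" using x pos tr by (smt (verit) mult_pos_pos)
    then have pr': "0 < poly p' r'" using pm[OF r rZ] by (auto simp: sgn_if split: if_splits)
    have "((poly p') \<longlongrightarrow> poly p' r') (at_left r')"
      using poly_isCont[of r' p'] unfolding isCont_def by (rule filterlim_mono[OF _ order_refl at_le]) simp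
    then have "eventually (\<lambda>u. 0 < poly p' u) (at_left r')" using pr' by (rule order_tendstoD)
    moreover have "eventually (\<lambda>u. u \<in> {y'<..<r'}) (at_left r')" by (rule eventually_at_leftI[of y']) (use r' in auto)
    ultimately have "eventually (\<lambda>u. 0 < poly p' u \<and> u \<in> {y'<..<r'}) (at_left r')" by (rule eventually_conj)
    then obtain u where u: "0 < poly p' u" "y' < u" "u < r'" by (auto dest!: eventually_happens)
    have "i' u = i' y'"
    proof (rule root_index_eqI[OF ri'])
      fix z assume "z \<in> Z'" "min u y' \<le> z" "z \<le> max u y'"
      then show False using u gap'[of z] by auto
    qed
    then show ?thesis using u by blast
  qed
qed


end

context line_match
begin

lemma ex_pos:
  assumes eq: "i y = i' y'" and yZ: "y \<notin> Z" and pos: "0 < poly p y"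
  shows "\<exists>t'. i' t' = i' y' \<and> 0 < poly p' t'"
proof (cases "0 < poly (pderiv p) y")
  case True
  then show ?thesis using ex_pos_right[OF eq refl yZ _ pos] by blast
next
  case False
  then have neg: "poly (pderiv p) y < 0" using dZ yZ by force
  interpret R: line_match "\<lambda>y. - i (- y)" "\<lambda>y. - i' (- y)" "uminus ` Z" "uminus ` Z'"
    "p \<circ>\<^sub>p [:0, -1:]" "p' \<circ>\<^sub>p [:0, -1:]"
    by (rule line_match_reflect) (rule line_match_axioms)
  have "\<exists>t'. - i' (- t') = - i' (- (- y')) \<and> 0 < poly (p' \<circ>\<^sub>p [:0, -1:]) t'"
    by (rule R.ex_pos_right[of "- y" _ "- y"]) (use eq yZ neg pos in \<open>auto simp: pderiv_reflect poly_pcompose\<close>)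
  then obtain t' where "i' (- t') = i' y'" "0 < poly p' (- t')" by (auto simp: poly_pcompose)
  then show ?thesis by blast
qed

lemma ex_neg:
  assumes eq: "i y = i' y'" and yZ: "y \<notin> Z" and pos: "poly p y < 0"
  shows "\<exists>t'. i' t' = i' y' \<and> poly p' t' < 0"
proof -
  interpret M: line_match i i' Z Z' "- p" "- p'"
    by (rule line_match_uminus) (rule line_match_axioms)
  show ?thesis using M.ex_pos[OF eq yZ] pos by simp
qed

text \<open>Off \<open>Z\<close> the derivative does not vanish, so a root of \<open>p\<close> there
  is simple and \<open>p\<close> changes sign inside the cell.\<close>

lemma ex_near:
  assumes yZ: "y \<notin> Z" and z: "poly p y = 0"
  shows "\<exists>s t. i s = i y \<and> i t = i y \<and> s \<notin> Z \<and> t \<notin> Z \<and> 0 < poly p s \<and> poly p t < 0"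
proof -
  have "open (- Z)" using fin finite_imp_closed by blast
  then obtain e where e: "e > 0" "\<And>t. dist t y < e \<Longrightarrow> t \<notin> Z"
    using yZ unfolding open_dist by (metis ComplD ComplI)
  have same: "i t = i y" if "\<bar>t - y\<bar> < e" for t
  proof (rule root_index_eqI[OF ri])
    fix z assume "z \<in> Z" "min t y \<le> z" "z \<le> max t y"
    then show False using that e(2)[of z] by (auto simp: dist_real_def)
  qed
  have der: "DERIV (poly p) y :> poly (pderiv p) y" by simp
  have nz: "poly (pderiv p) y \<noteq> 0" using dZ yZ by blast
  have *: "\<exists>d>0. \<forall>k>0. k < d \<longrightarrow> poly p (y - k) * poly p (y + k) < 0"
  proof (cases "poly (pderiv p) y > 0")
    case True
    from DERIV_pos_inc_right[OF der True] DERIV_pos_inc_left[OF der True] obtain d1 d2 where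
      "d1 > 0" "d2 > 0" "\<forall>k>0. k < d1 \<longrightarrow> poly p y < poly p (y + k)" "\<forall>k>0. k < d2 \<longrightarrow> poly p (y - k) < poly p y"
      by auto
    then show ?thesis using z by (intro exI[of _ "min d1 d2"]) (auto simp: mult_less_0_iff)
  next
    case False
    then have neg: "poly (pderiv p) y < 0" using nz by simp
    from DERIV_neg_dec_right[OF der neg] DERIV_neg_dec_left[OF der neg] obtain d1 d2 where
      "d1 > 0" "d2 > 0" "\<forall>k>0. k < d1 \<longrightarrow> poly p y > poly p (y + k)" "\<forall>k>0. k < d2 \<longrightarrow> poly p (y - k) > poly p y"
      by auto
    then show ?thesis using z by (intro exI[of _ "min d1 d2"]) (auto simp: mult_less_0_iff)
  qed
  then obtain d where d: "d > 0" "\<And>k. 0 < k \<Longrightarrow> k < d \<Longrightarrow> poly p (y - k) * poly p (y + k) < 0" by blast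
  define k where "k = min d e / 2"
  have k: "0 < k" "k < d" "k < e" using d e by (auto simp: k_def)
  then have "i (y - k) = i y" "i (y + k) = i y" "y - k \<notin> Z" "y + k \<notin> Z"
    by (auto intro!: same e(2) simp: dist_real_def)
  then show ?thesis using d(2)[OF k(1,2)] unfolding mult_less_0_iff by blast
qed

text \<open>On \<open>Z\<close> the signs agree by assumption. Off \<open>Z\<close>, positive and
  negative values transfer directly; a zero is transferred through the two signs next to it,
  followed by the intermediate value theorem on the other line.\<close>

lemma sign_transfer:
  assumes eq: "i y = i' y'"
  shows "\<exists>t'. i' t' = i' y' \<and> sgn (poly p' t') = sgn (poly p y)"
proof (cases "y \<in> Z")
  case True
  then show ?thesis using pm[OF eq] by metis
next
  case yZ: False
  consider "0 < poly p y" | "poly p y < 0" | "poly p y = 0" by linarith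
  then show ?thesis
  proof cases
    case 1
    then show ?thesis using ex_pos[OF eq yZ] by (metis sgn_pos)
  next
    case 2
    then show ?thesis using ex_neg[OF eq yZ] by (metis sgn_neg)
  next
    case 3
    obtain s t where st: "i s = i y" "i t = i y" "s \<notin> Z" "t \<notin> Z" "0 < poly p s" "poly p t < 0"
      using ex_near[OF yZ 3] by blast
    obtain s' where s': "i' s' = i' y'" "0 < poly p' s'" using ex_pos[of s y'] st eq by auto
    obtain t' where t': "i' t' = i' y'" "poly p' t' < 0" using ex_neg[of t y'] st eq by auto
    have "\<exists>u. min s' t' < u \<and> u < max s' t' \<and> poly p' u = 0"
    proof (cases s' t' rule: linorder_cases)
      case less
      then show ?thesis using poly_IVT_neg[OF less s'(2) t'(2)] by auto
    next
      case greater
      then show ?thesis using poly_IVT_pos[OF greater t'(2) s'(2)] by auto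
    qed (use s' t' in auto)
    then obtain u where u: "min s' t' < u" "u < max s' t'" "poly p' u = 0" by blast
    have "mono i'" using ri' by (simp add: root_index_def)
    then have "i' (min s' t') \<le> i' u" "i' u \<le> i' (max s' t')" using u by (auto simp: mono_def)
    moreover have "i' (min s' t') = i' y'" "i' (max s' t') = i' y'" using s' t' by (auto simp: min_def max_def)
    ultimately have "i' u = i' y'" by simp
    then show ?thesis using u 3 by auto
  qed
qed

end

text \<open>On a cell where \<open>p\<close> is monotone, the sign of its derivative turns the sign of \<open>p\<close> into an
  increasing function.\<close>

definition refine_index :: "(real \<Rightarrow> int) \<Rightarrow> real poly \<Rightarrow> real \<Rightarrow> int" where
  "refine_index i p y = 3 * i y + \<lfloor>sgn (poly (pderiv p) y) * sgn (poly p y)\<rfloor>"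

lemma sgn_mult_cases: "sgn (a::real) * sgn b \<in> {-1, 0, 1}"
  by (auto simp: sgn_if)

lemma floor_minus_one_real: "\<lfloor>- 1 :: real\<rfloor> = - 1"
  by (simp add: floor_eq_iff)

text \<open>The factor 3 leaves room for three subcells per cell, so the refined index still
  determines \<open>i\<close> and respects its order.\<close>

lemma refine_index_bounds: "\<bar>refine_index i p y - 3 * i y\<bar> \<le> 1"
  using sgn_mult_cases[of "poly (pderiv p) y" "poly p y"] by (auto simp: refine_index_def floor_minus_one_real)

lemma mono_refine_index:
  assumes ri: "root_index Z i" and dZ: "\<And>y. poly (pderiv p) y = 0 \<Longrightarrow> y \<in> Z"
  shows "mono (refine_index i p)"
proof (rule monoI)
  fix s t :: real assume "s \<le> t"
  show "refine_index i p s \<le> refine_index i p t"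
  proof (cases "i s = i t")
    case False
    moreover have "i s \<le> i t" using ri \<open>s \<le> t\<close> unfolding root_index_def mono_def by blast
    ultimately have "i s + 1 \<le> i t" by simp
    then show ?thesis using refine_index_bounds[of i p s] refine_index_bounds[of i p t] by linarith
  next
    case eq: True
    show ?thesis
    proof (cases "s = t")
      case False
      then have st: "s < t" using \<open>s \<le> t\<close> by simp
      have nz: "poly (pderiv p) u \<noteq> 0" if "s \<le> u" "u \<le> t" for u
        using root_index_eqD[OF ri eq False, of u] dZ that by auto
      obtain x where x: "s < x" "x < t" "poly p t - poly p s = (t - s) * poly (pderiv p) x"
        using poly_MVT[OF st] by blast
      have "sgn (poly (pderiv p) s) = sgn (poly (pderiv p) t)"
        by (rule poly_sgn_eq) (use nz st in auto)
      moreover have "sgn (poly (pderiv p) s) = sgn (poly (pderiv p) x)"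
        by (rule poly_sgn_eq) (use nz x in auto)
      moreover have "sgn (poly (pderiv p) x) * sgn (poly p s) \<le> sgn (poly (pderiv p) x) * sgn (poly p t)"
      proof (cases "poly (pderiv p) x > 0")
        case True
        then have "poly p s < poly p t" using x st by (smt (verit) mult_pos_pos)
        then show ?thesis using True by (auto simp: sgn_if)
      next
        case False
        then have "poly (pderiv p) x < 0" using nz[of x] x by auto
        moreover from this have "(t - s) * poly (pderiv p) x < 0" using st by (simp add: mult_pos_neg)
        then have "poly p t < poly p s" using x by linarith
        ultimately show ?thesis by (auto simp: sgn_if)
      qed
      ultimately show ?thesis using eq by (simp add: refine_index_def floor_mono)
    qed simp
  qed
qed

lemma refine_index_eqD:
  assumes "refine_index i p y = refine_index i' p' y'"
  shows "i y = i' y'" "sgn (poly (pderiv p) y) * sgn (poly p y) = sgn (poly (pderiv p') y') * sgn (poly p' y')"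
proof -
  show *: "i y = i' y'"
    using refine_index_bounds[of i p y] refine_index_bounds[of i' p' y'] assms by linarith
  show "sgn (poly (pderiv p) y) * sgn (poly p y) = sgn (poly (pderiv p') y') * sgn (poly p' y')"
    using assms * sgn_mult_cases[of "poly (pderiv p) y" "poly p y"]
      sgn_mult_cases[of "poly (pderiv p') y'" "poly p' y'"] by (auto simp: refine_index_def floor_minus_one_real)
qed

lemma (in line_match) range_refine_subset: "range (refine_index i p) \<subseteq> range (refine_index i' p')"
proof clarify
  fix y
  obtain y' where y': "i y = i' y'" using ran by (metis rangeE rangeI)
  obtain t' where t': "i' t' = i' y'" "sgn (poly p' t') = sgn (poly p y)" using sign_transfer[OF y'] by blast
  have "sgn (poly (pderiv p) y) = sgn (poly (pderiv p') t')" using dm[of y t'] y' t' by simp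
  then have "refine_index i p y = refine_index i' p' t'" using y' t' by (simp add: refine_index_def)
  then show "refine_index i p y \<in> range (refine_index i' p')" by simp
qed

lemma (in line_match) line_equiv_refine:
  assumes A: "\<And>q q' y y'. (q, q') \<in> A \<Longrightarrow> i y = i' y' \<Longrightarrow> sgn (poly q y) = sgn (poly q' y')"
  shows "line_equiv (insert (p, p') A)"
proof -
  interpret S: line_match i' i Z' Z p' p by (rule line_match_sym) (rule line_match_axioms)
  have "sgn (poly q y) = sgn (poly q' y')"
    if "(q, q') \<in> insert (p, p') A" and e: "refine_index i p y = refine_index i' p' y'" for q q' y y'
  proof -
    note eq = refine_index_eqD[OF e]
    have "sgn (poly p y) = sgn (poly p' y')"
    \<comment> \<open>Where the derivative vanishes the product of signs says nothing about
      \<open>p\<close>, but such a point lies in \<open>Z\<close>, where \<open>pm\<close> applies.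
      Elsewhere the sign of the derivative can be cancelled.\<close>
    proof (cases "poly (pderiv p) y = 0")
      case True
      then show ?thesis using dZ pm eq by blast
    next
      case False
      then show ?thesis using eq(2) dm[OF eq(1)] by (metis mult_left_cancel sgn_zero_iff)
    qed
    then show ?thesis using that A eq by auto
  qed
  note sg = this
  show ?thesis unfolding line_equiv_def
  proof (intro exI conjI)
    show "range (refine_index i p) = range (refine_index i' p')"
      using range_refine_subset S.range_refine_subset by (rule subset_antisym)
    show "\<forall>(q, q')\<in>insert (p, p') A. \<forall>y y'. refine_index i p y = refine_index i' p' y' \<longrightarrow>
        sgn (poly q y) = sgn (poly q' y')"
      by (intro ballI, clarify) (erule (1) sg)
    show "mono (refine_index i p)" using ri by (rule mono_refine_index) (rule dZ)
    show "mono (refine_index i' p')" using ri' by (rule mono_refine_index) (rule dZ')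
  qed
qed

text \<open>The inductive step of Hoermander's proof of quantifier elimination: the roots of the
  polynomials in \<open>A\<close> cut the line into intervals on which \<open>p\<close> is monotone, and
  the sign of \<open>p\<close> at such a root is the sign of a remainder.\<close>

lemma line_equiv_insert:
  assumes B: "line_equiv B" and AB: "A \<subseteq> B" and finA: "finite A"
    and nz: "\<And>q q'. (q, q') \<in> A \<Longrightarrow> q \<noteq> 0 \<and> q' \<noteq> 0"
    and dA: "(pderiv p, pderiv p') \<in> A"
    and rem: "\<And>q q'. (q, q') \<in> A \<Longrightarrow> \<exists>r r'. (r, r') \<in> B \<and>
      (\<forall>y. poly q y = 0 \<longrightarrow> sgn (poly p y) = sgn (poly r y)) \<and>
      (\<forall>y. poly q' y = 0 \<longrightarrow> sgn (poly p' y) = sgn (poly r' y))"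
  shows "line_equiv (insert (p, p') A)"
proof -
  obtain i i' :: "real \<Rightarrow> int" where m: "mono i" "mono i'" "range i = range i'"
    and sg: "\<And>q q' y y'. (q, q') \<in> B \<Longrightarrow> i y = i' y' \<Longrightarrow> sgn (poly q y) = sgn (poly q' y')"
    using B unfolding line_equiv_def by blast
  define Z where "Z = (\<Union>(q, q')\<in>A. {y. poly q y = 0})"
  define Z' where "Z' = (\<Union>(q, q')\<in>A. {y. poly q' y = 0})"
  have fin: "finite Z" "finite Z'" using finA nz by (auto simp: Z_def Z'_def intro!: poly_roots_finite)
  have Zm: "y \<in> Z \<longleftrightarrow> y' \<in> Z'" if "i y = i' y'" for y y'
  proof -
    have "poly q y = 0 \<longleftrightarrow> poly q' y' = 0" if "(q, q') \<in> A" for q q'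
      using sg[of q q' y y'] that \<open>i y = i' y'\<close> AB by (metis sgn_zero_iff subsetD)
    then show ?thesis by (auto simp: Z_def Z'_def)
  qed
  have ex: "\<exists>y'. i y = i' y'" for y using m(3) by (metis rangeE rangeI)
  have ex': "\<exists>y. i y = i' y'" for y' using m(3) by (metis rangeE rangeI)
  have img: "i ` Z = i' ` Z'"
  proof (intro subset_antisym subsetI)
    fix k assume "k \<in> i ` Z"
    then obtain y where y: "y \<in> Z" "k = i y" by blast
    with ex[of y] Zm show "k \<in> i' ` Z'" by force
  next
    fix k assume "k \<in> i' ` Z'"
    then obtain y' where y': "y' \<in> Z'" "k = i' y'" by blast
    with ex'[of y'] Zm show "k \<in> i ` Z" by force
  qed
  \<comment> \<open>Since \<open>i\<close> Z = i' \<open>Z'\<close>, the same renumbering of cells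
    coarsens both subdivisions.\<close>
  define \<kappa> where "\<kappa> k = 2 * int (card {l \<in> i ` Z. l < k}) + (if k \<in> i ` Z then 1 else 0)" for k
  have ri: "root_index Z (\<lambda>y. \<kappa> (i y))"
    unfolding \<kappa>_def
  proof (rule root_index_coarsen[OF m(1) fin(1)])
    show "t \<in> Z" if "y \<in> Z" "i t = i y" for y t using Zm that ex[of y] by metis
  qed
  have ri': "root_index Z' (\<lambda>y. \<kappa> (i' y))"
    unfolding \<kappa>_def img
  proof (rule root_index_coarsen[OF m(2) fin(2)])
    show "t \<in> Z'" if "y \<in> Z'" "i' t = i' y" for y t using Zm that ex'[of y] by metis
  qed
  \<comment> \<open>Equal coarse numbers do not give equal fine ones. But \<open>y\<close> can be
    replaced by a point \<open>t\<close> whose fine cell does match that of \<open>y'\<close>, and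
    no root of a member of \<open>A\<close> separates \<open>y\<close> from
    \<open>t\<close>.\<close>
  have near: "\<exists>t. i t = i' y' \<and> (y = t \<or> (\<forall>z\<in>Z. min y t \<le> z \<longrightarrow> z \<le> max y t \<longrightarrow> False))"
    if "\<kappa> (i y) = \<kappa> (i' y')" for y y'
  proof -
    obtain t where "i t = i' y'" using ex' by blast
    then show ?thesis using root_index_eqD[OF ri, of y t] that by metis
  qed
  have A: "sgn (poly q y) = sgn (poly q' y')" if q: "(q, q') \<in> A" and k: "\<kappa> (i y) = \<kappa> (i' y')" for q q' y y'
  proof -
    obtain t where t: "i t = i' y'" "y = t \<or> (\<forall>z\<in>Z. min y t \<le> z \<longrightarrow> z \<le> max y t \<longrightarrow> False)"
      using near[OF k] by blast
    have "sgn (poly q y) = sgn (poly q t)"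
    proof (cases "y = t")
      case False
      have "sgn (poly q (min y t)) = sgn (poly q (max y t))"
        by (rule poly_sgn_eq) (use t(2) False q in \<open>auto simp: Z_def\<close>)
      then show ?thesis by (auto simp: min_def max_def split: if_splits)
    qed simp
    then show ?thesis using sg[of q q' t y'] t q AB by auto
  qed
  have Zm': "y \<in> Z \<longleftrightarrow> y' \<in> Z'" if "\<kappa> (i y) = \<kappa> (i' y')" for y y'
  proof -
    have "poly q y = 0 \<longleftrightarrow> poly q' y' = 0" if "(q, q') \<in> A" for q q'
      using A[OF that \<open>\<kappa> (i y) = \<kappa> (i' y')\<close>] by (metis sgn_zero_iff)
    then show ?thesis by (auto simp: Z_def Z'_def)
  qed
  interpret line_match "\<lambda>y. \<kappa> (i y)" "\<lambda>y. \<kappa> (i' y)" Z Z' p p'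
  proof
    show "range (\<lambda>y. \<kappa> (i y)) = range (\<lambda>y. \<kappa> (i' y))"
      using arg_cong[OF m(3), of "image \<kappa>"] by (simp only: image_image)
    show "sgn (poly (pderiv p) y) = sgn (poly (pderiv p') y')" if "\<kappa> (i y) = \<kappa> (i' y')" for y y'
      using A[OF dA that] .
    show "y \<in> Z" if "poly (pderiv p) y = 0" for y using that dA by (auto simp: Z_def)
    show "y \<in> Z'" if "poly (pderiv p') y = 0" for y using that dA by (auto simp: Z'_def)
    \<comment> \<open>At a point of \<open>Z\<close> the replacement \<open>t\<close> is
      \<open>y\<close> itself, so the fine indices agree there. This gives access to the remainders,
      which lie in \<open>B\<close> and need not lie in \<open>A\<close>.\<close>
    show "sgn (poly p y) = sgn (poly p' y')" if k: "\<kappa> (i y) = \<kappa> (i' y')" and yZ: "y \<in> Z" for y y'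
    proof -
      have i: "i y = i' y'" using near[OF k] yZ by fastforce
      obtain q q' where q: "(q, q') \<in> A" "poly q y = 0" using yZ by (auto simp: Z_def)
      then have "poly q' y' = 0" using sg[of q q' y y'] i AB by (metis sgn_zero_iff subsetD)
      obtain r r' where r: "(r, r') \<in> B" "sgn (poly p y) = sgn (poly r y)" "sgn (poly p' y') = sgn (poly r' y')"
        using rem[OF q(1)] q(2) \<open>poly q' y' = 0\<close> by blast
      then show ?thesis using sg[OF r(1) i] by simp
    qed
  qed (fact ri ri' fin Zm')+
  show ?thesis by (rule line_equiv_refine) (rule A)
qed

section \<open>Sign patterns depending on parameters\<close>

lemma poly_fun_uminus: "poly_fun N f \<Longrightarrow> poly_fun N (\<lambda>x. - f x)"
  using pf_mult[OF pf_const[of N "- 1"], of f] by simp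

lemma poly_fun_diff: "poly_fun N f \<Longrightarrow> poly_fun N g \<Longrightarrow> poly_fun N (\<lambda>x. f x - g x)"
  using pf_add[OF _ poly_fun_uminus, of N f g] by simp

lemma poly_fun_sum: "(\<And>i. i \<in> I \<Longrightarrow> poly_fun N (f i)) \<Longrightarrow> poly_fun N (\<lambda>x. \<Sum>i\<in>I. f i x)"
  by (induction I rule: infinite_finite_induct) (auto intro: pf_const pf_add)

lemma poly_fun_power: "poly_fun N f \<Longrightarrow> poly_fun N (\<lambda>x. f x ^ k)"
  by (induction k) (auto intro: pf_const pf_mult)

lemma poly_fun_mono:
  assumes "poly_fun N f" "N \<le> N'" shows "poly_fun N' f"
  using assms by (induction rule: poly_fun.induct) (auto intro: poly_fun.intros)

lemma poly_fun_append:
  assumes "poly_fun N f" "length x = N" shows "f (x @ y) = f x"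
  using assms by (induction rule: poly_fun.induct) (auto simp: nth_append)

lemma poly_fun_select:
  assumes "poly_fun N f" "\<And>i. i < N \<Longrightarrow> e i < N'"
  shows "poly_fun N' (\<lambda>w. f (map (\<lambda>i. w ! e i) [0..<N]))"
  using assms by (induction rule: poly_fun.induct) (auto intro: poly_fun.intros)

text \<open>A list of polynomial functions is read as the coefficient list of a polynomial in one
  further variable.\<close>

definition spec :: "(real list \<Rightarrow> real) list \<Rightarrow> real list \<Rightarrow> real poly" where
  "spec cs x = Poly (map (\<lambda>c. c x) cs)"

lemma coeff_spec: "coeff (spec cs x) i = (if i < length cs then (cs ! i) x else 0)"
  by (simp add: spec_def nth_default_def)

definition deriv_coeffs :: "(real list \<Rightarrow> real) list \<Rightarrow> (real list \<Rightarrow> real) list" where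
  "deriv_coeffs cs = map (\<lambda>i x. real (Suc i) * (cs ! Suc i) x) [0..<length cs - 1]"

text \<open>A single step of pseudo-division, cancelling the top coefficient of \<open>p\<close>;
  shortening by one is all that the induction asks for. The multiplier is the square of the leading
  coefficient of \<open>q\<close>, so that signs at roots of \<open>q\<close> are preserved and not
  merely zeros.\<close>

definition reduce_coeffs ::
  "(real list \<Rightarrow> real) list \<Rightarrow> (real list \<Rightarrow> real) list \<Rightarrow> (real list \<Rightarrow> real) list" where
  "reduce_coeffs p q = map (\<lambda>i x. (last q x)\<^sup>2 * (p ! i) x -
     last q x * last p x * (if length p - length q \<le> i then (q ! (i - (length p - length q))) x else 0))
     [0..<length p - 1]"

lemma length_deriv_coeffs [simp]: "length (deriv_coeffs cs) = length cs - 1"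
  by (simp add: deriv_coeffs_def)

lemma length_reduce_coeffs [simp]: "length (reduce_coeffs p q) = length p - 1"
  by (simp add: reduce_coeffs_def)

lemma spec_deriv_coeffs: "spec (deriv_coeffs cs) x = pderiv (spec cs x)"
  by (rule poly_eqI) (auto simp: coeff_spec coeff_pderiv deriv_coeffs_def)

lemma spec_reduce_coeffs:
  assumes "q \<noteq> []" "length q \<le> length p"
  shows "spec (reduce_coeffs p q) x = smult ((last q x)\<^sup>2) (spec p x) -
    monom (last q x * last p x) (length p - length q) * spec q x"
proof (rule poly_eqI)
  fix i
  have p: "p \<noteq> []" using assms by auto
  consider "i < length p - 1" | "i = length p - 1" | "i \<ge> length p" by linarith
  then show "coeff (spec (reduce_coeffs p q) x) i = coeff (smult ((last q x)\<^sup>2) (spec p x) -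
    monom (last q x * last p x) (length p - length q) * spec q x) i"
  proof cases
    case 1
    then show ?thesis using assms by (auto simp: coeff_spec coeff_monom_mult reduce_coeffs_def)
  next
    \<comment> \<open>The top coefficient, which has no entry in the shortened list,
      cancels.\<close>
    case 2
    have "length p - 1 - (length p - length q) = length q - 1"
      "length p - length q \<le> length p - 1" using assms p by (cases q; auto)+
    then show ?thesis using assms p 2
      by (auto simp: coeff_spec coeff_monom_mult reduce_coeffs_def last_conv_nth power2_eq_square)
  next
    case 3
    then show ?thesis using assms by (auto simp: coeff_spec coeff_monom_mult reduce_coeffs_def)
  qed
qed

lemma sgn_reduce_coeffs:
  assumes "q \<noteq> []" "length q \<le> length p" "last q x \<noteq> 0" "poly (spec q x) y = 0"
  shows "sgn (poly (spec p x) y) = sgn (poly (spec (reduce_coeffs p q) x) y)"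
proof -
  have "poly (spec (reduce_coeffs p q) x) y = (last q x)\<^sup>2 * poly (spec p x) y"
    using assms by (simp add: spec_reduce_coeffs)
  moreover have "sgn ((last q x)\<^sup>2) = 1" using assms(3) by (intro sgn_pos) simp
  ultimately show ?thesis by (simp only: sgn_mult mult_1_left)
qed

lemma poly_fun_deriv_coeffs:
  assumes "set cs \<subseteq> Collect (poly_fun N)" shows "set (deriv_coeffs cs) \<subseteq> Collect (poly_fun N)"
proof
  fix f assume "f \<in> set (deriv_coeffs cs)"
  then obtain i where i: "Suc i < length cs" "f = (\<lambda>x. real (Suc i) * (cs ! Suc i) x)"
    unfolding deriv_coeffs_def by (auto simp del: of_nat_Suc simp: less_diff_conv)
  then have "poly_fun N (cs ! Suc i)" using assms nth_mem by blast
  then show "f \<in> Collect (poly_fun N)" unfolding i mem_Collect_eq by (rule pf_mult[OF pf_const])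
qed

lemma poly_fun_reduce_coeffs:
  assumes p: "set p \<subseteq> Collect (poly_fun N)" and q: "set q \<subseteq> Collect (poly_fun N)"
    and ne: "q \<noteq> []" and le: "length q \<le> length p"
  shows "set (reduce_coeffs p q) \<subseteq> Collect (poly_fun N)"
proof -
  have "p \<noteq> []" using ne le by auto
  have nth: "poly_fun N (p ! i)" if "i < length p" for i using p that nth_mem by blast
  have nthq: "poly_fun N (q ! i)" if "i < length q" for i using q that nth_mem by blast
  have lasts: "poly_fun N (last p)" "poly_fun N (last q)" using p q ne \<open>p \<noteq> []\<close> last_in_set by blast+
  show ?thesis
  proof
    fix f assume "f \<in> set (reduce_coeffs p q)"
    then obtain i where i: "i < length p - 1" and f: "f = (\<lambda>x. (last q x)\<^sup>2 * (p ! i) x -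
     last q x * last p x * (if length p - length q \<le> i then (q ! (i - (length p - length q))) x else 0))"
      by (auto simp: reduce_coeffs_def)
    have "poly_fun N (\<lambda>x. if length p - length q \<le> i then (q ! (i - (length p - length q))) x else 0)"
    proof (cases "length p - length q \<le> i")
      case True
      then have "i - (length p - length q) < length q" using i le by arith
      then show ?thesis using True nthq by simp
    qed (simp add: pf_const)
    then show "f \<in> Collect (poly_fun N)"
      unfolding f using lasts nth[of i] i by (auto intro!: poly_fun_diff pf_mult poly_fun_power)
  qed
qed

text \<open>The pair of zero polynomials costs nothing, as its sign is 0 everywhere; it arises from
  an empty coefficient list.\<close>

lemma line_equiv_mono:
  assumes "line_equiv B" "A \<subseteq> insert (0, 0) B" shows "line_equiv A"
proof -
  obtain i i' :: "real \<Rightarrow> int" where i: "mono i" "mono i'" "range i = range i'"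
    and sg: "\<And>q q' y y'. (q, q') \<in> B \<Longrightarrow> i y = i' y' \<Longrightarrow> sgn (poly q y) = sgn (poly q' y')"
    using assms(1) unfolding line_equiv_def by blast
  have sg': "sgn (poly q y) = sgn (poly q' y')" if "(q, q') \<in> A" "i y = i' y'" for q q' y y'
  proof (cases "(q, q') = (0, 0)")
    case False
    then have "(q, q') \<in> B" using that assms(2) by blast
    then show ?thesis using that(2) by (rule sg)
  qed simp
  show ?thesis unfolding line_equiv_def
  proof (intro exI conjI)
    show "\<forall>(q, q')\<in>A. \<forall>y y'. i y = i' y' \<longrightarrow> sgn (poly q y) = sgn (poly q' y')"
      by (intro ballI, clarify) (erule (1) sg')
  qed (fact i)+
qed

section \<open>Elimination by induction on the lengths of coefficient lists\<close>

lemma spec_butlast: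
  assumes "cs \<noteq> []" "last cs x = 0" shows "spec (butlast cs) x = spec cs x"
proof (rule poly_eqI)
  fix i
  show "coeff (spec (butlast cs) x) i = coeff (spec cs x) i"
    using assms by (cases "i = length cs - 1") (auto simp: coeff_spec nth_butlast last_conv_nth)
qed

lemma spec_nonzero: "cs \<noteq> [] \<Longrightarrow> last cs x \<noteq> 0 \<Longrightarrow> spec cs x \<noteq> 0"
  using coeff_spec[of cs x "length cs - 1"] by (auto simp: last_conv_nth)

text \<open>The form of the multiset order used below: entries violating \<open>R\<close> leave, and
  each new entry lies below one that left.\<close>

lemma mult_less_lengths:
  assumes "\<exists>p\<in>#M. \<not> R p" and "\<And>k. k \<in># K \<Longrightarrow> \<exists>p\<in>#M. \<not> R p \<and> k < (h p :: nat)"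
  shows "(image_mset h (filter_mset R M) + K, image_mset h M) \<in> mult less_than"
proof -
  have "(image_mset h (filter_mset R M) + K,
      image_mset h (filter_mset R M) + image_mset h (filter_mset (\<lambda>p. \<not> R p) M)) \<in> mult less_than"
    by (rule one_step_implies_mult) (use assms in \<open>auto simp: filter_mset_eq_conv\<close>)
  moreover have "image_mset h (filter_mset R M) + image_mset h (filter_mset (\<lambda>p. \<not> R p) M) = image_mset h M"
    by (metis image_mset_union multiset_partition)
  ultimately show ?thesis by simp
qed

text \<open>Quantifier elimination without formulas: finitely many signs at the parameter fix the
  whole sign table of the family along the line, including the order of the cells.\<close>

definition line_determined :: "nat \<Rightarrow> (real list \<Rightarrow> real) list list \<Rightarrow> (real list \<Rightarrow> real) set \<Rightarrow> bool" where
  "line_determined N P G \<longleftrightarrow> finite G \<and> G \<subseteq> Collect (poly_fun N) \<and>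
     (\<forall>x x'. (\<forall>g\<in>G. sgn (g x) = sgn (g x')) \<longrightarrow> line_equiv ((\<lambda>cs. (spec cs x, spec cs x')) ` set P))"

lemma line_determined_constants:
  assumes "\<And>cs. cs \<in> set P \<Longrightarrow> set cs \<subseteq> Collect (poly_fun N)" "\<And>cs. cs \<in> set P \<Longrightarrow> length cs \<le> 1"
  shows "line_determined N P (\<Union>(set ` set P))"
  unfolding line_determined_def
proof (intro conjI allI impI)
  show "\<Union> (set ` set P) \<subseteq> Collect (poly_fun N)" using assms(1) by blast
  fix x x' assume sg: "\<forall>g\<in>\<Union> (set ` set P). sgn (g x) = sgn (g x')"
  have "sgn (poly (spec cs x) y) = sgn (poly (spec cs x') y')" if "cs \<in> set P" for cs y y'
  proof (cases cs)
    case (Cons c ds)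
    then have "ds = []" using assms(2)[OF that] by simp
    then show ?thesis using Cons sg that by (force simp: spec_def)
  qed (simp add: spec_def)
  then show "line_equiv ((\<lambda>cs. (spec cs x, spec cs x')) ` set P)"
    unfolding line_equiv_def by (intro exI[of _ "\<lambda>_. 0"]) (auto simp: mono_def)
qed simp

text \<open>\<open>G\<close> contains the leading coefficients. If some of them vanish at
  \<open>x\<close>, the same ones vanish at \<open>x'\<close>, and dropping them leads to a family
  covered by the assumption on \<open>V\<close>; all choices of \<open>V\<close> are prepared in
  advance because \<open>G\<close> must not depend on \<open>x\<close>. If none vanishes,
  \<open>p\<close> can be pseudo-divided by every list in \<open>ds\<close>, none being longer than
  \<open>p\<close>, and \<open>line_equiv_insert\<close> restores \<open>p\<close>.\<close>

lemma line_determined_step: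
  assumes P: "\<And>cs. cs \<in> set P \<Longrightarrow> set cs \<subseteq> Collect (poly_fun N)"
    and p: "p \<in> set P" "2 \<le> length p" and mx: "\<And>cs. cs \<in> set P \<Longrightarrow> length cs \<le> length p"
    and V: "\<And>V. V \<subseteq> {cs \<in> set P. cs \<noteq> []} \<Longrightarrow> V \<noteq> {} \<Longrightarrow>
      \<exists>G. line_determined N (map (\<lambda>cs. if cs \<in> V then butlast cs else cs) P) G"
    and D: "ds = deriv_coeffs p # filter (\<lambda>cs. cs \<noteq> [] \<and> cs \<noteq> p) P"
    and G0: "line_determined N (ds @ map (reduce_coeffs p) ds) G0"
  shows "\<exists>G. line_determined N P G"
proof -
  define T where "T = {cs \<in> set P. cs \<noteq> []}"
  have finT: "finite T" by (simp add: T_def)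
  have "\<forall>V\<in>Pow T - {{}}. \<exists>G. line_determined N (map (\<lambda>cs. if cs \<in> V then butlast cs else cs) P) G"
    using V by (auto simp: T_def)
  from bchoice[OF this] obtain H where H': "\<forall>V\<in>Pow T - {{}}.
      line_determined N (map (\<lambda>cs. if cs \<in> V then butlast cs else cs) P) (H V)" ..
  have H: "line_determined N (map (\<lambda>cs. if cs \<in> V then butlast cs else cs) P) (H V)"
    if "V \<subseteq> T" "V \<noteq> {}" for V using H' that by simp
  define G where "G = last ` T \<union> G0 \<union> (\<Union>V\<in>Pow T - {{}}. H V)"
  have "finite G" using finT H G0 by (auto simp: G_def line_determined_def)
  moreover have "G \<subseteq> Collect (poly_fun N)"
  proof -
    have "last ` T \<subseteq> Collect (poly_fun N)" using P last_in_set unfolding T_def by blast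
    moreover have "H V \<subseteq> Collect (poly_fun N)" if "V \<in> Pow T - {{}}" for V
      using H[of V] that by (auto simp: line_determined_def)
    ultimately show ?thesis using G0 unfolding G_def line_determined_def by blast
  qed
  moreover have "line_equiv ((\<lambda>cs. (spec cs x, spec cs x')) ` set P)"
    if "\<forall>g\<in>G. sgn (g x) = sgn (g x')" for x x'
  proof -
    have sg: "sgn (g x) = sgn (g x')" if "g \<in> G" for g using that \<open>\<forall>g\<in>G. _\<close> by blast
    define V where "V = {cs \<in> T. last cs x = 0}"
    have lasts: "last cs x = 0 \<longleftrightarrow> last cs x' = 0" if "cs \<in> T" for cs
      using sg[of "last cs"] that by (metis G_def UnI1 image_eqI sgn_zero_iff)
    show ?thesis
    proof (cases "V = {}")
      case False
      let ?tr = "\<lambda>cs. if cs \<in> V then butlast cs else cs"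
      have VT: "V \<subseteq> T" by (auto simp: V_def)
      have tr: "spec (?tr cs) x = spec cs x" "spec (?tr cs) x' = spec cs x'" for cs
        using lasts by (auto simp: V_def T_def spec_butlast)
      have "(\<lambda>cs. (spec cs x, spec cs x')) ` set (map ?tr P) = (\<lambda>cs. (spec cs x, spec cs x')) ` set P"
        unfolding set_map image_image tr ..
      moreover have "H V \<subseteq> G" using VT False by (auto simp: G_def)
      then have "line_equiv ((\<lambda>cs. (spec cs x, spec cs x')) ` set (map ?tr P))"
        using H[OF VT False] sg unfolding line_determined_def by blast
      ultimately show ?thesis by simp
    next
      case True
      then have nz: "last cs x \<noteq> 0" "last cs x' \<noteq> 0" if "cs \<in> T" for cs
        using that lasts by (auto simp: V_def)
      let ?pair = "\<lambda>cs. (spec cs x, spec cs x')"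
      have pT: "p \<in> T" using p by (auto simp: T_def)
      \<comment> \<open>Hence the leading coefficient of the derivative is nonzero together with
        that of \<open>p\<close>.\<close>
      have dn: "last (deriv_coeffs p) u = real (length p - 1) * last p u" for u
      proof -
        obtain k where k: "length p = Suc (Suc k)" using p(2) by (metis add_2_eq_Suc le_Suc_ex)
        then have ne: "deriv_coeffs p \<noteq> []" "p \<noteq> []" by (auto simp flip: length_0_conv)
        show ?thesis using k by (simp add: last_conv_nth[OF ne(1)] last_conv_nth[OF ne(2)] deriv_coeffs_def)
      qed
      have ds: "cs \<noteq> []" "last cs x \<noteq> 0" "last cs x' \<noteq> 0" "length cs \<le> length p" if "cs \<in> set ds" for cs
      proof -
        have "cs \<noteq> [] \<and> last cs x \<noteq> 0 \<and> last cs x' \<noteq> 0 \<and> length cs \<le> length p"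
        proof (cases "cs = deriv_coeffs p")
          case True
          have "length (deriv_coeffs p) \<noteq> 0" using p(2) by simp
          then have "deriv_coeffs p \<noteq> []" by (metis list.size(3))
          then show ?thesis unfolding True using nz[OF pT] p(2) by (simp add: dn)
        next
          case False
          then have "cs \<in> T" using that by (auto simp: D T_def)
          then show ?thesis using nz mx by (auto simp: T_def)
        qed
        then show "cs \<noteq> []" "last cs x \<noteq> 0" "last cs x' \<noteq> 0" "length cs \<le> length p" by auto
      qed
      have "line_equiv (insert (?pair p) (?pair ` set ds))"
      proof (rule line_equiv_insert)
        show "line_equiv (?pair ` set (ds @ map (reduce_coeffs p) ds))"
          using G0 sg unfolding line_determined_def G_def by blast
        show "(pderiv (spec p x), pderiv (spec p x')) \<in> ?pair ` set ds"
          by (auto simp: D spec_deriv_coeffs)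
        show "q \<noteq> 0 \<and> q' \<noteq> 0" if "(q, q') \<in> ?pair ` set ds" for q q'
          using that ds spec_nonzero by auto
        show "\<exists>r r'. (r, r') \<in> ?pair ` set (ds @ map (reduce_coeffs p) ds) \<and>
           (\<forall>y. poly q y = 0 \<longrightarrow> sgn (poly (spec p x) y) = sgn (poly r y)) \<and>
           (\<forall>y. poly q' y = 0 \<longrightarrow> sgn (poly (spec p x') y) = sgn (poly r' y))"
          if "(q, q') \<in> ?pair ` set ds" for q q'
        proof -
          obtain cs where cs: "cs \<in> set ds" "q = spec cs x" "q' = spec cs x'" using \<open>(q, q') \<in> _\<close> by auto
          show ?thesis
            using cs ds[OF cs(1)]
            by (intro exI[of _ "spec (reduce_coeffs p cs) x"] exI[of _ "spec (reduce_coeffs p cs) x'"])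
              (auto intro: sgn_reduce_coeffs)
        qed
      qed auto
      then show ?thesis
      proof (rule line_equiv_mono)
        \<comment> \<open>The members of \<open>P\<close> missing from \<open>ds\<close> are
          \<open>p\<close> and the empty list, and the latter contributes the zero pair.\<close>
        show "?pair ` set P \<subseteq> insert (0, 0) (insert (?pair p) (?pair ` set ds))"
        proof
          fix w assume "w \<in> ?pair ` set P"
          then obtain cs where "cs \<in> set P" "w = ?pair cs" by blast
          then show "w \<in> insert (0, 0) (insert (?pair p) (?pair ` set ds))"
            by (cases "cs = []"; cases "cs = p") (auto simp: D, auto simp: spec_def)
        qed
      qed
    qed
  qed
  ultimately have "line_determined N P G"
    unfolding line_determined_def by blast
  then show ?thesis ..
qed

text \<open>A longest list \<open>p\<close> is replaced by its derivative and its pseudo-remainders: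
  more lists, but all of them shorter than \<open>p\<close>. Hence the induction on the multiset of
  lengths; truncating vanishing leading coefficients decreases it too.\<close>

theorem ex_line_determined:
  assumes "\<And>cs. cs \<in> set P \<Longrightarrow> set cs \<subseteq> Collect (poly_fun N)"
  shows "\<exists>G. line_determined N P G"
  using assms
proof (induction "image_mset length (mset P)" arbitrary: P rule: wf_induct_rule[OF wf_mult[OF wf_less_than], consumes 0, case_names less])
  case (less P)
  show ?case
  proof (cases "\<forall>cs\<in>set P. length cs \<le> 1")
    case True
    then show ?thesis using line_determined_constants less.prems by blast
  next
    case False
    define L where "L = Max (length ` set P)"
    have "set P \<noteq> {}" using False by auto
    then have "L \<in> length ` set P" unfolding L_def by (intro Max_in) auto
    then obtain p where p: "p \<in> set P" "length p = L" by auto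
    have mx: "length cs \<le> length p" if "cs \<in> set P" for cs
      using that p by (auto simp: L_def)
    have p2: "2 \<le> length p" using False mx by fastforce
    define qs where "qs = filter (\<lambda>cs. cs \<noteq> [] \<and> cs \<noteq> p) P"
    define ds where "ds = deriv_coeffs p # qs"
    have pfds: "set cs \<subseteq> Collect (poly_fun N)" if "cs \<in> set ds" for cs
      using that less.prems poly_fun_deriv_coeffs[OF less.prems[OF p(1)]] by (fastforce simp: ds_def qs_def)
    have lds: "cs \<noteq> [] \<and> length cs \<le> length p" if "cs \<in> set ds" for cs
    proof (cases "cs = deriv_coeffs p")
      case True
      have "length (deriv_coeffs p) \<noteq> 0" using p2 by simp
      then have "deriv_coeffs p \<noteq> []" by (metis list.size(3))
      then show ?thesis unfolding True by simp
    qed (use that mx in \<open>auto simp: ds_def qs_def\<close>)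
    have "(image_mset length (mset (ds @ map (reduce_coeffs p) ds)), image_mset length (mset P)) \<in> mult less_than"
    proof -
      have "image_mset length (mset (ds @ map (reduce_coeffs p) ds)) =
        image_mset length (filter_mset (\<lambda>cs. cs \<noteq> [] \<and> cs \<noteq> p) (mset P)) +
        image_mset length (mset (deriv_coeffs p # map (reduce_coeffs p) ds))"
        by (simp add: ds_def qs_def)
      moreover have "(image_mset length (filter_mset (\<lambda>cs. cs \<noteq> [] \<and> cs \<noteq> p) (mset P)) +
        image_mset length (mset (deriv_coeffs p # map (reduce_coeffs p) ds)), image_mset length (mset P)) \<in> mult less_than"
        by (rule mult_less_lengths) (use p p2 in \<open>auto intro!: bexI[of _ p]\<close>)
      ultimately show ?thesis by simp
    qed
    then have "\<exists>G. line_determined N (ds @ map (reduce_coeffs p) ds) G"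
    proof (rule less.hyps)
      fix cs assume "cs \<in> set (ds @ map (reduce_coeffs p) ds)"
      then consider "cs \<in> set ds" | q where "q \<in> set ds" "cs = reduce_coeffs p q" by auto
      then show "set cs \<subseteq> Collect (poly_fun N)"
      proof cases
        case 1
        then show ?thesis by (rule pfds)
      next
        case 2
        then show ?thesis using pfds[of q] lds[of q] poly_fun_reduce_coeffs[OF less.prems[OF p(1)], of q] by simp
      qed
    qed
    then obtain G0 where G0: "line_determined N (ds @ map (reduce_coeffs p) ds) G0" by blast
    show ?thesis
    proof (rule line_determined_step[OF less.prems p(1) p2 mx _ _ G0])
      fix V assume V: "V \<subseteq> {cs \<in> set P. cs \<noteq> []}" "V \<noteq> {}"
      let ?tr = "\<lambda>cs. if cs \<in> V then butlast cs else cs"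
      obtain v where v: "v \<in> V" "v \<in> set P" "v \<noteq> []" using V by blast
      have "(image_mset length (mset (map ?tr P)), image_mset length (mset P)) \<in> mult less_than"
      proof -
        have "image_mset length (mset (map ?tr P)) = image_mset length (filter_mset (\<lambda>cs. cs \<notin> V) (mset P))
          + image_mset (\<lambda>cs. length cs - 1) (filter_mset (\<lambda>cs. cs \<in> V) (mset P))"
          by (induction P) auto
        moreover have "(image_mset length (filter_mset (\<lambda>cs. cs \<notin> V) (mset P))
          + image_mset (\<lambda>cs. length cs - 1) (filter_mset (\<lambda>cs. cs \<in> V) (mset P)), image_mset length (mset P)) \<in> mult less_than"
        proof (rule mult_less_lengths)
          show "\<exists>p\<in>#mset P. \<not> p \<notin> V" using v by auto
          fix k assume "k \<in># image_mset (\<lambda>cs. length cs - 1) (filter_mset (\<lambda>cs. cs \<in> V) (mset P))"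
          then obtain cs where "cs \<in> V" "cs \<in> set P" "k = length cs - 1" by auto
          moreover then have "cs \<noteq> []" using V by blast
          ultimately show "\<exists>p\<in>#mset P. \<not> p \<notin> V \<and> k < length p" by (intro bexI[of _ cs]) auto
        qed
        ultimately show ?thesis by simp
      qed
      then show "\<exists>G. line_determined N (map ?tr P) G"
      proof (rule less.hyps)
        fix cs assume "cs \<in> set (map ?tr P)"
        then show "set cs \<subseteq> Collect (poly_fun N)"
          using less.prems in_set_butlastD by (fastforce split: if_splits)
      qed
    qed (auto simp: ds_def qs_def)
  qed
qed

section \<open>ISD functions form a ring\<close>

lemma isd_add_poly: "isd_gen N f \<Longrightarrow> poly_fun N p \<Longrightarrow> isd_gen N (\<lambda>x. p x + f x)"
proof (induction rule: isd_gen.induct)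
  case (isd_poly q)
  then show ?case by (intro isd_gen.isd_poly pf_add)
next
  case (isd_min f g)
  then show ?case using isd_gen.isd_min[of N "\<lambda>x. p x + f x" "\<lambda>x. p x + g x"] by (simp add: min_add_distrib_right)
next
  case (isd_max f g)
  then show ?case using isd_gen.isd_max[of N "\<lambda>x. p x + f x" "\<lambda>x. p x + g x"] by (simp add: max_add_distrib_right)
qed

lemma isd_add: "isd_gen N f \<Longrightarrow> isd_gen N g \<Longrightarrow> isd_gen N (\<lambda>x. f x + g x)"
proof (induction rule: isd_gen.induct)
  case (isd_poly p)
  then show ?case by (simp add: isd_add_poly)
next
  case (isd_min f h)
  then show ?case using isd_gen.isd_min[of N "\<lambda>x. f x + g x" "\<lambda>x. h x + g x"] by (simp add: min_add_distrib_left)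
next
  case (isd_max f h)
  then show ?case using isd_gen.isd_max[of N "\<lambda>x. f x + g x" "\<lambda>x. h x + g x"] by (simp add: max_add_distrib_left)
qed

lemma isd_uminus: "isd_gen N f \<Longrightarrow> isd_gen N (\<lambda>x. - f x)"
proof (induction rule: isd_gen.induct)
  case (isd_poly p)
  then show ?case by (intro isd_gen.isd_poly poly_fun_uminus)
next
  case (isd_min f g)
  then show ?case using isd_gen.isd_max[of N "\<lambda>x. - f x" "\<lambda>x. - g x"] by (simp add: minus_min_eq_max)
next
  case (isd_max f g)
  then show ?case using isd_gen.isd_min[of N "\<lambda>x. - f x" "\<lambda>x. - g x"] by (simp add: minus_max_eq_min)
qed

lemma isd_const: "isd_gen N (\<lambda>x. c)"
  by (intro isd_poly pf_const)

lemma isd_diff: "isd_gen N f \<Longrightarrow> isd_gen N g \<Longrightarrow> isd_gen N (\<lambda>x. f x - g x)"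
  using isd_add[OF _ isd_uminus, of N f g] by simp

text \<open>The factor \<open>1 + f\<^sup>2\<close> dominates \<open>f\<close> and preserves the sign of \<open>p\<close>, so the minimum picks
  out the quadrant where both factors are positive.\<close>

lemma pos_part_mult_pos_part:
  fixes f p :: real
  shows "max f 0 * max p 0 = min (max (f * p) 0) (max (p * (1 + f\<^sup>2)) 0)"
proof -
  have "0 \<le> (f - 1 / 2)\<^sup>2" by simp
  then have ge: "f \<le> 1 + f\<^sup>2" by (simp add: power2_eq_square algebra_simps)
  have pos: "0 < 1 + f\<^sup>2" by (simp add: add_pos_nonneg)
  show ?thesis
  proof (cases "p > 0")
    case True
    then have "f * p \<le> p * (1 + f\<^sup>2)" "0 \<le> p * (1 + f\<^sup>2)" using ge pos by (simp_all add: mult.commute)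
    then show ?thesis using True by (cases "f > 0") (auto simp: min_def max_def zero_le_mult_iff mult_le_0_iff)
  next
    case False
    then have "p * (1 + f\<^sup>2) \<le> 0" using pos by (simp add: mult_le_0_iff)
    then show ?thesis using False by (simp add: max_def)
  qed
qed

text \<open>Multiplication distributes over \<open>min\<close> and \<open>max\<close> only for a
  nonnegative factor. Products are therefore treated in stages, splitting one factor at a time into
  positive and negative parts, and starting from two positive parts of polynomials.\<close>

lemma isd_mult_pos_poly:
  assumes "isd_gen N f" "poly_fun N p" shows "isd_gen N (\<lambda>x. f x * max (p x) 0)"
  using assms
proof (induction rule: isd_gen.induct)
  case (isd_poly q)
  have pp: "isd_gen N (\<lambda>x. max (r x) 0 * max (p x) 0)" if "poly_fun N r" for r
    unfolding pos_part_mult_pos_part using that isd_poly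
    by (intro isd_min isd_max isd_const isd_gen.isd_poly pf_mult pf_add pf_const poly_fun_power)
  have "(\<lambda>x. q x * max (p x) 0) = (\<lambda>x. max (q x) 0 * max (p x) 0 - max (- q x) 0 * max (p x) 0)"
    by (auto simp: max_def)
  moreover have "isd_gen N (\<lambda>x. max (q x) 0 * max (p x) 0 - max (- q x) 0 * max (p x) 0)"
    using isd_poly by (intro isd_diff pp poly_fun_uminus)
  ultimately show ?case by simp
next
  case (isd_min f g)
  then show ?case using isd_gen.isd_min[of N "\<lambda>x. f x * max (p x) 0" "\<lambda>x. g x * max (p x) 0"]
    by (simp add: min_mult_distrib_right)
next
  case (isd_max f g)
  then show ?case using isd_gen.isd_max[of N "\<lambda>x. f x * max (p x) 0" "\<lambda>x. g x * max (p x) 0"]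
    by (simp add: max_mult_distrib_right)
qed

lemma isd_mult_poly:
  assumes "isd_gen N f" "poly_fun N p" shows "isd_gen N (\<lambda>x. f x * p x)"
proof -
  have "(\<lambda>x. f x * p x) = (\<lambda>x. f x * max (p x) 0 - f x * max (- p x) 0)" by (auto simp: max_def)
  then show ?thesis using isd_diff[OF isd_mult_pos_poly isd_mult_pos_poly, of N f p f "\<lambda>x. - p x"]
      assms poly_fun_uminus by simp
qed

lemma isd_mult_nonneg:
  assumes "isd_gen N g" "isd_gen N f" "\<And>x. 0 \<le> f x" shows "isd_gen N (\<lambda>x. f x * g x)"
  using assms
proof (induction rule: isd_gen.induct)
  case (isd_poly p)
  then show ?case by (simp add: isd_mult_poly)
next
  case (isd_min g h)
  then show ?case using isd_gen.isd_min[of N "\<lambda>x. f x * g x" "\<lambda>x. f x * h x"]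
    by (simp add: min_mult_distrib_left)
next
  case (isd_max g h)
  then show ?case using isd_gen.isd_max[of N "\<lambda>x. f x * g x" "\<lambda>x. f x * h x"]
    by (simp add: max_mult_distrib_left)
qed

lemma isd_mult:
  assumes "isd_gen N f" "isd_gen N g" shows "isd_gen N (\<lambda>x. f x * g x)"
proof -
  have "isd_gen N (\<lambda>x. max (f x) 0 * g x)" "isd_gen N (\<lambda>x. max (- f x) 0 * g x)"
    using assms by (auto intro!: isd_mult_nonneg isd_max isd_uminus isd_const)
  moreover have "(\<lambda>x. f x * g x) = (\<lambda>x. max (f x) 0 * g x - max (- f x) 0 * g x)" by (auto simp: max_def)
  ultimately show ?thesis using isd_diff by simp
qed

lemma isd_sum: "(\<And>i. i \<in> I \<Longrightarrow> isd_gen N (f i)) \<Longrightarrow> isd_gen N (\<lambda>x. \<Sum>i\<in>I. f i x)"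
  by (induction I rule: infinite_finite_induct) (auto intro: isd_const isd_add)

lemma isd_power: "isd_gen N f \<Longrightarrow> isd_gen N (\<lambda>x. f x ^ k)"
  by (induction k) (auto intro: isd_const isd_mult)

section \<open>The Tarski--Seidenberg theorem\<close>

text \<open>A formula-free substitute for being semialgebraic; only lists of length \<open>N\<close>
  matter. Keeping no formula makes Boolean operations and projection short.\<close>

definition sign_determined :: "nat \<Rightarrow> real list set \<Rightarrow> bool" where
  "sign_determined N S \<longleftrightarrow> (\<exists>G. finite G \<and> G \<subseteq> Collect (poly_fun N) \<and>
     (\<forall>u v. length u = N \<longrightarrow> length v = N \<longrightarrow> (\<forall>g\<in>G. sgn (g u) = sgn (g v)) \<longrightarrow> (u \<in> S \<longleftrightarrow> v \<in> S)))"

lemma sign_determinedI: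
  assumes "finite G" "G \<subseteq> Collect (poly_fun N)"
    "\<And>u v. length u = N \<Longrightarrow> length v = N \<Longrightarrow> \<forall>g\<in>G. sgn (g u) = sgn (g v) \<Longrightarrow> u \<in> S \<longleftrightarrow> v \<in> S"
  shows "sign_determined N S"
  unfolding sign_determined_def by (intro exI[of _ G] conjI allI impI) (fact assms)+

lemma sign_determinedE:
  assumes "sign_determined N S"
  obtains G where "finite G" "G \<subseteq> Collect (poly_fun N)"
    "\<And>u v. length u = N \<Longrightarrow> length v = N \<Longrightarrow> \<forall>g\<in>G. sgn (g u) = sgn (g v) \<Longrightarrow> u \<in> S \<longleftrightarrow> v \<in> S"
proof -
  obtain G where G: "finite G" "G \<subseteq> Collect (poly_fun N)"
    and S: "\<forall>u v. length u = N \<longrightarrow> length v = N \<longrightarrow> (\<forall>g\<in>G. sgn (g u) = sgn (g v)) \<longrightarrow> (u \<in> S \<longleftrightarrow> v \<in> S)"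
    using assms unfolding sign_determined_def by (elim exE conjE)
  show thesis by (rule that[OF G]) (rule S[THEN spec, THEN spec, THEN mp, THEN mp, THEN mp])
qed

lemma sign_determined_sgn: "poly_fun N p \<Longrightarrow> sign_determined N {x. Q (sgn (p x))}"
  by (rule sign_determinedI[of "{p}"]) (auto simp only: finite.intros singletonD mem_Collect_eq singleton_iff)

text \<open>One rule for all Boolean operations. With \<open>S = T\<close> it also covers
  complements and the passage to a set that agrees with \<open>S\<close> on lists of length
  \<open>N\<close>.\<close>

lemma sign_determined_combine:
  assumes "sign_determined N S" "sign_determined N T"
    and "\<And>u v. length u = N \<Longrightarrow> length v = N \<Longrightarrow> (u \<in> S \<longleftrightarrow> v \<in> S) \<Longrightarrow> (u \<in> T \<longleftrightarrow> v \<in> T) \<Longrightarrow> (u \<in> X \<longleftrightarrow> v \<in> X)"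
  shows "sign_determined N X"
proof -
  obtain G where G: "finite G" "G \<subseteq> Collect (poly_fun N)"
    "\<And>u v. length u = N \<Longrightarrow> length v = N \<Longrightarrow> \<forall>g\<in>G. sgn (g u) = sgn (g v) \<Longrightarrow> u \<in> S \<longleftrightarrow> v \<in> S"
    by (rule sign_determinedE[OF assms(1)]) (rule that)
  obtain H where H: "finite H" "H \<subseteq> Collect (poly_fun N)"
    "\<And>u v. length u = N \<Longrightarrow> length v = N \<Longrightarrow> \<forall>g\<in>H. sgn (g u) = sgn (g v) \<Longrightarrow> u \<in> T \<longleftrightarrow> v \<in> T"
    by (rule sign_determinedE[OF assms(2)]) (rule that)
  show ?thesis
  proof (rule sign_determinedI[of "G \<union> H"])
    fix u v :: "real list" assume l: "length u = N" "length v = N" and "\<forall>g\<in>G \<union> H. sgn (g u) = sgn (g v)"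
    then have "\<forall>g\<in>G. sgn (g u) = sgn (g v)" "\<forall>g\<in>H. sgn (g u) = sgn (g v)" by blast+
    then show "u \<in> X \<longleftrightarrow> v \<in> X" using G(3)[OF l] H(3)[OF l] assms(3)[OF l] by blast
  qed (use G H in auto)
qed

lemma semialg_set_imp_sign_determined: "semialg_set N S \<Longrightarrow> sign_determined N S"
proof (induction rule: semialg_set.induct)
  case (sa_basic p)
  show ?case by (rule sign_determined_combine[OF sign_determined_sgn[OF sa_basic, of "\<lambda>s. s = 1"] sign_determined_sgn[OF sa_basic, of "\<lambda>s. s = 1"]])
    (auto simp: sgn_1_pos)
next
  case (sa_compl S)
  show ?case by (rule sign_determined_combine[OF sa_compl.IH sa_compl.IH]) auto
next
  case (sa_union S T)
  show ?case by (rule sign_determined_combine[OF sa_union.IH]) auto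
next
  case (sa_inter S T)
  show ?case by (rule sign_determined_combine[OF sa_inter.IH]) auto
qed

lemma spec_map_upt:
  assumes "\<And>i. coeff q i = (if i < n then f i x else 0)"
  shows "spec (map f [0..<n]) x = q"
  by (rule poly_eqI) (simp add: coeff_spec assms)

lemma poly_fun_coeff_spec:
  assumes "set cs \<subseteq> Collect (poly_fun N)" shows "poly_fun N (\<lambda>x. coeff (spec cs x) i)"
proof (cases "i < length cs")
  case True
  then have "poly_fun N (cs ! i)" using assms nth_mem by blast
  then show ?thesis using True by (simp add: coeff_spec)
qed (simp add: coeff_spec pf_const)

lemma poly_fun_expand_last:
  assumes "poly_fun (Suc N) p"
  shows "\<exists>cs. set cs \<subseteq> Collect (poly_fun N) \<and> (\<forall>x y. length x = N \<longrightarrow> p (x @ [y]) = poly (spec cs x) y)"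
  using assms
proof (induction rule: poly_fun.induct)
  case (pf_const c)
  then show ?case by (intro exI[of _ "[\<lambda>_. c]"]) (auto simp: spec_def intro: poly_fun.pf_const)
next
  case (pf_proj i)
  show ?case
  proof (cases "i < N")
    case True
    then show ?thesis
      by (intro exI[of _ "[\<lambda>x. x ! i]"]) (auto simp: spec_def nth_append intro: poly_fun.pf_proj)
  next
    case False
    then have "i = N" using pf_proj by simp
    then show ?thesis
      by (intro exI[of _ "[\<lambda>x. 0, \<lambda>x. 1]"]) (auto simp: spec_def nth_append intro: poly_fun.pf_const)
  qed
next
  case (pf_add p q)
  then obtain a b where a: "set a \<subseteq> Collect (poly_fun N)" "\<And>x y. length x = N \<Longrightarrow> p (x @ [y]) = poly (spec a x) y"
    and b: "set b \<subseteq> Collect (poly_fun N)" "\<And>x y. length x = N \<Longrightarrow> q (x @ [y]) = poly (spec b x) y" by blast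
  let ?f = "\<lambda>i x. coeff (spec a x) i + coeff (spec b x) i"
  have "spec (map ?f [0..<max (length a) (length b)]) x = spec a x + spec b x" for x
    by (rule spec_map_upt) (auto simp: coeff_spec)
  moreover have "poly_fun N (?f i)" for i
    using a b by (intro poly_fun.pf_add poly_fun_coeff_spec)
  ultimately show ?case using a b
    by (intro exI[of _ "map ?f [0..<max (length a) (length b)]"]) auto
next
  case (pf_mult p q)
  then obtain a b where a: "set a \<subseteq> Collect (poly_fun N)" "\<And>x y. length x = N \<Longrightarrow> p (x @ [y]) = poly (spec a x) y"
    and b: "set b \<subseteq> Collect (poly_fun N)" "\<And>x y. length x = N \<Longrightarrow> q (x @ [y]) = poly (spec b x) y" by blast
  let ?f = "\<lambda>i x. \<Sum>k\<le>i. coeff (spec a x) k * coeff (spec b x) (i - k)"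
  have "spec (map ?f [0..<length a + length b]) x = spec a x * spec b x" for x
    by (rule spec_map_upt) (auto simp: coeff_mult coeff_spec intro!: sum.neutral)
  moreover have "poly_fun N (?f i)" for i
    using a b by (intro poly_fun_sum poly_fun.pf_mult poly_fun_coeff_spec)
  ultimately show ?case using a b
    by (intro exI[of _ "map ?f [0..<length a + length b]"]) auto
qed

text \<open>Over parameters with equal signs the two cell indices have the same range, so a witness
  \<open>y\<close> over \<open>u\<close> has a partner \<open>y'\<close> over \<open>v\<close> at
  which all test polynomials have the same signs.\<close>

lemma sign_determined_project_last:
  assumes "sign_determined (Suc N) S" shows "sign_determined N {x. \<exists>y. x @ [y] \<in> S}"
proof -
  obtain G where G: "finite G" "G \<subseteq> Collect (poly_fun (Suc N))"
    and S: "\<And>u v. length u = Suc N \<Longrightarrow> length v = Suc N \<Longrightarrow> \<forall>g\<in>G. sgn (g u) = sgn (g v) \<Longrightarrow> (u \<in> S \<longleftrightarrow> v \<in> S)"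
    by (rule sign_determinedE[OF assms]) (rule that)
  have "\<forall>g\<in>G. \<exists>cs. set cs \<subseteq> Collect (poly_fun N) \<and> (\<forall>x y. length x = N \<longrightarrow> g (x @ [y]) = poly (spec cs x) y)"
    using poly_fun_expand_last G(2) by blast
  from bchoice[OF this] obtain C where C': "\<forall>g\<in>G. set (C g) \<subseteq> Collect (poly_fun N) \<and>
    (\<forall>x y. length x = N \<longrightarrow> g (x @ [y]) = poly (spec (C g) x) y)" ..
  have C: "set (C g) \<subseteq> Collect (poly_fun N)" "length x = N \<Longrightarrow> g (x @ [y]) = poly (spec (C g) x) y"
    if "g \<in> G" for g x y using C' that by auto
  obtain P where P: "set P = C ` G" using finite_list G(1) by (metis finite_imageI)
  obtain H where H: "line_determined N P H" using ex_line_determined[of P N] C(1) unfolding P by blast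
  have sub: "\<exists>y. v @ [y] \<in> S" if len: "length u = N" "length v = N" and sg: "\<forall>g\<in>H. sgn (g u) = sgn (g v)"
    and y: "u @ [y] \<in> S" for u v y
  proof -
    have "line_equiv ((\<lambda>cs. (spec cs u, spec cs v)) ` set P)" using H sg unfolding line_determined_def by blast
    then obtain i i' :: "real \<Rightarrow> int" where i: "range i = range i'"
      and eq: "\<And>q q' y y'. (q, q') \<in> (\<lambda>cs. (spec cs u, spec cs v)) ` set P \<Longrightarrow> i y = i' y' \<Longrightarrow> sgn (poly q y) = sgn (poly q' y')"
      unfolding line_equiv_def by blast
    obtain y' where y': "i y = i' y'" using i by (metis rangeE rangeI)
    have "\<forall>g\<in>G. sgn (g (u @ [y])) = sgn (g (v @ [y']))"
    proof
      fix g assume g: "g \<in> G"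
      then have "(spec (C g) u, spec (C g) v) \<in> (\<lambda>cs. (spec cs u, spec cs v)) ` set P" unfolding P by blast
      from eq[OF this y'] show "sgn (g (u @ [y])) = sgn (g (v @ [y']))" using C(2)[OF g] len by simp
    qed
    then show ?thesis using S[of "u @ [y]" "v @ [y']"] len y by auto
  qed
  show ?thesis
  proof (rule sign_determinedI)
    show "finite H" "H \<subseteq> Collect (poly_fun N)" using H by (auto simp: line_determined_def)
    fix u v :: "real list" assume len: "length u = N" "length v = N" and sg: "\<forall>g\<in>H. sgn (g u) = sgn (g v)"
    have sg': "\<forall>g\<in>H. sgn (g v) = sgn (g u)" using sg by simp
    show "u \<in> {x. \<exists>y. x @ [y] \<in> S} \<longleftrightarrow> v \<in> {x. \<exists>y. x @ [y] \<in> S}"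
      using sub[OF len sg] sub[OF len(2,1) sg'] by blast
  qed
qed

lemma sign_determined_project:
  assumes "sign_determined (N + k) S" shows "sign_determined N {x. \<exists>y. length y = k \<and> x @ y \<in> S}"
  using assms
proof (induction k arbitrary: N)
  case 0
  then show ?case by simp
next
  case (Suc k)
  have "sign_determined (Suc N) {x. \<exists>y. length y = k \<and> x @ y \<in> S}" using Suc.IH[of "Suc N"] Suc.prems by simp
  from sign_determined_project_last[OF this]
  have "sign_determined N {x. \<exists>y1 y. length y = k \<and> (x @ [y1]) @ y \<in> S}" by simp
  moreover have "(\<exists>y1 y. length y = k \<and> (x @ [y1]) @ y \<in> S) \<longleftrightarrow> (\<exists>y. length y = Suc k \<and> x @ y \<in> S)" for x
    by (auto simp: length_Suc_conv)
  ultimately show ?case by simp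
qed

lemma sign_determined_select:
  assumes "sign_determined N S" "\<And>i. i < N \<Longrightarrow> e i < N'"
  shows "sign_determined N' {w. map (\<lambda>i. w ! e i) [0..<N] \<in> S}"
proof -
  obtain G where G: "finite G" "G \<subseteq> Collect (poly_fun N)"
    and S: "\<And>u v. length u = N \<Longrightarrow> length v = N \<Longrightarrow> \<forall>g\<in>G. sgn (g u) = sgn (g v) \<Longrightarrow> (u \<in> S \<longleftrightarrow> v \<in> S)"
    by (rule sign_determinedE[OF assms(1)]) (rule that)
  show ?thesis
  proof (rule sign_determinedI)
    show "finite ((\<lambda>g w. g (map (\<lambda>i. w ! e i) [0..<N])) ` G)" using G by simp
    show "(\<lambda>g w. g (map (\<lambda>i. w ! e i) [0..<N])) ` G \<subseteq> Collect (poly_fun N')"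
    proof (rule image_subsetI)
      fix g assume "g \<in> G"
      then have "poly_fun N g" using G(2) by blast
      then show "(\<lambda>w. g (map (\<lambda>i. w ! e i) [0..<N])) \<in> Collect (poly_fun N')"
        unfolding mem_Collect_eq by (rule poly_fun_select) (rule assms(2))
    qed
    fix u v :: "real list"
    assume "\<forall>g\<in>(\<lambda>g w. g (map (\<lambda>i. w ! e i) [0..<N])) ` G. sgn (g u) = sgn (g v)"
    then show "u \<in> {w. map (\<lambda>i. w ! e i) [0..<N] \<in> S} \<longleftrightarrow> v \<in> {w. map (\<lambda>i. w ! e i) [0..<N] \<in> S}"
      unfolding mem_Collect_eq by (intro S) simp_all
  qed
qed

section \<open>Isolating the values of a semialgebraic function\<close>

text \<open>The relaxed sign condition: \<open>b\<close> lies in the closure of the reals with the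
  sign of \<open>a\<close>. Thom's lemma holds in this form, and closed conditions are those whose
  violation can be measured by a continuous function that vanishes exactly when they hold.\<close>

definition sign_compat :: "real \<Rightarrow> real \<Rightarrow> bool" where
  "sign_compat a b \<longleftrightarrow> (0 < a \<longrightarrow> 0 \<le> b) \<and> (a < 0 \<longrightarrow> b \<le> 0) \<and> (a = 0 \<longrightarrow> b = 0)"

text \<open>Thom's lemma.\<close>

lemma sign_compat_between:
  fixes \<F> :: "real poly set"
  assumes cl: "\<And>p. p \<in> \<F> \<Longrightarrow> pderiv p \<in> \<F>"
    and comp: "\<And>p. p \<in> \<F> \<Longrightarrow> sign_compat (poly p c) (poly p y)"
    and p: "p \<in> \<F>" and t: "min c y \<le> t" "t \<le> max c y"
  shows "sign_compat (poly p c) (poly p t)"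
  using p t
proof (induction "degree p" arbitrary: p t rule: less_induct)
  case less
  show ?case
  proof (cases "degree p = 0")
    case True
    then obtain a where "p = [:a:]" by (metis degree_eq_zeroE)
    then show ?thesis by (simp add: sign_compat_def)
  next
    case False
    then have "degree (pderiv p) < degree p" by (simp add: degree_pderiv)
    then have d: "sign_compat (poly (pderiv p) c) (poly (pderiv p) u)" if "min c y \<le> u" "u \<le> max c y" for u
      using less.hyps cl less.prems(1) that by blast
    have mvt: "\<exists>u. a \<le> u \<and> u \<le> b \<and> poly p b - poly p a = (b - a) * poly (pderiv p) u" if "a \<le> b" for a b
      using poly_MVT[of a b p] that by (cases "a = b") (auto intro: less_imp_le)
    \<comment> \<open>By induction the derivative has weakly constant sign between \<open>c\<close>
      and \<open>y\<close>, so \<open>p\<close> is monotone there and its value at \<open>t\<close>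
      lies between those at \<open>c\<close> and \<open>y\<close>.\<close>
    have "(poly p (min c y) \<le> poly p t \<and> poly p t \<le> poly p (max c y)) \<or>
      (poly p (max c y) \<le> poly p t \<and> poly p t \<le> poly p (min c y))"
    proof (cases "0 \<le> poly (pderiv p) c")
      case True
      have "poly p a \<le> poly p b" if ab: "min c y \<le> a" "a \<le> b" "b \<le> max c y" for a b
      proof -
        obtain u where u: "a \<le> u" "u \<le> b" "poly p b - poly p a = (b - a) * poly (pderiv p) u"
          using mvt[OF ab(2)] by blast
        then have "0 \<le> poly (pderiv p) u" using d[of u] ab True by (auto simp: sign_compat_def)
        then have "0 \<le> poly p b - poly p a" unfolding u(3) using ab by simp
        then show ?thesis by simp
      qed
      then show ?thesis using less.prems by simp
    next
      case False
      have "poly p b \<le> poly p a" if ab: "min c y \<le> a" "a \<le> b" "b \<le> max c y" for a b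
      proof -
        obtain u where u: "a \<le> u" "u \<le> b" "poly p b - poly p a = (b - a) * poly (pderiv p) u"
          using mvt[OF ab(2)] by blast
        then have "poly (pderiv p) u \<le> 0" using d[of u] ab False by (auto simp: sign_compat_def)
        then have "poly p b - poly p a \<le> 0" unfolding u(3) using ab by (simp add: mult_nonneg_nonpos)
        then show ?thesis by simp
      qed
      then show ?thesis using less.prems by simp
    qed
    then have "(poly p c \<le> poly p t \<and> poly p t \<le> poly p y) \<or> (poly p y \<le> poly p t \<and> poly p t \<le> poly p c)"
      by (auto simp: min_def max_def split: if_splits)
    then show ?thesis using comp[OF less.prems(1)] unfolding sign_compat_def by linarith
  qed
qed

text \<open>Otherwise, by Thom's lemma, \<open>g\<close> would vanish on the whole interval between
  \<open>c\<close> and \<open>y\<close>.\<close>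

lemma sign_compat_unique:
  fixes \<F> :: "real poly set"
  assumes cl: "\<And>p. p \<in> \<F> \<Longrightarrow> pderiv p \<in> \<F>"
    and comp: "\<And>p. p \<in> \<F> \<Longrightarrow> sign_compat (poly p c) (poly p y)"
    and g: "g \<in> \<F>" "g \<noteq> 0" "poly g c = 0"
  shows "y = c"
proof (rule ccontr)
  assume "y \<noteq> c"
  then have "infinite {min c y..max c y}" by (auto simp: infinite_Icc_iff)
  moreover have "{min c y..max c y} \<subseteq> {t. poly g t = 0}"
  proof
    fix t assume "t \<in> {min c y..max c y}"
    then have "sign_compat (poly g c) (poly g t)"
      by (intro sign_compat_between[of \<F>, OF cl comp g(1)]) auto
    then show "t \<in> {t. poly g t = 0}" using g by (simp add: sign_compat_def)
  qed
  ultimately show False using poly_roots_finite[OF g(2)] finite_subset by blast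
qed

section \<open>Polynomials vanishing on the graph of a component\<close>

lemma spec_append:
  "set cs \<subseteq> Collect (poly_fun N) \<Longrightarrow> length x = N \<Longrightarrow> spec cs (x @ y) = spec cs x"
  unfolding spec_def by (auto intro!: arg_cong[of _ _ Poly] poly_fun_append)

lemma poly_fun_poly_spec:
  assumes "set cs \<subseteq> Collect (poly_fun N)" "poly_fun N e"
  shows "poly_fun N (\<lambda>w. poly (spec cs w) (e w))"
  using assms(1)
proof (induction cs)
  case Nil
  then show ?case by (simp add: spec_def pf_const)
next
  case (Cons c cs)
  then show ?case using assms(2) by (auto simp: spec_def intro!: pf_add pf_mult)
qed

lemma graph_append_iff:
  "length x = m \<Longrightarrow> x @ y \<in> {x @ F x | x. length x = m} \<longleftrightarrow> y = F x"
  by auto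

text \<open>The set is the projection of the graph of \<open>F\<close> cut by a sign condition in
  which coordinate \<open>m + i\<close> replaces \<open>F x ! i\<close>.\<close>

lemma sign_determined_sgn_component:
  assumes F: "semialg_fun m n F" and i: "i < n" and cs: "set cs \<subseteq> Collect (poly_fun m)"
  shows "sign_determined m {x. Q (sgn (poly (spec cs x) (F x ! i)))}"
proof -
  let ?S = "{x @ F x | x. length x = m}"
  have lF: "length (F x) = n" if "length x = m" for x using F that by (simp add: semialg_fun_def)
  have S: "sign_determined (m + n) ?S" using F semialg_set_imp_sign_determined by (auto simp: semialg_fun_def)
  have cs': "set cs \<subseteq> Collect (poly_fun (m + n))" using cs poly_fun_mono[of m _ "m + n"] by auto
  have "poly_fun (m + n) (\<lambda>w. poly (spec cs w) (w ! (m + i)))"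
    using cs' i by (intro poly_fun_poly_spec pf_proj) auto
  then have T: "sign_determined (m + n) {w. Q (sgn (poly (spec cs w) (w ! (m + i))))}" by (rule sign_determined_sgn)
  have "sign_determined (m + n) (?S \<inter> {w. Q (sgn (poly (spec cs w) (w ! (m + i))))})"
    by (rule sign_determined_combine[OF S T]) blast
  from sign_determined_project[OF this] have P: "sign_determined m {x. \<exists>y. length y = n \<and>
      x @ y \<in> ?S \<inter> {w. Q (sgn (poly (spec cs w) (w ! (m + i))))}}" .
  have mem: "x \<in> {x. \<exists>y. length y = n \<and> x @ y \<in> ?S \<inter> {w. Q (sgn (poly (spec cs w) (w ! (m + i))))}}
    \<longleftrightarrow> x \<in> {x. Q (sgn (poly (spec cs x) (F x ! i)))}" if "length x = m" for x
    using that lF[OF that] by (auto simp: spec_append[OF cs] nth_append)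
  show ?thesis by (rule sign_determined_combine[OF P P]) (use mem in simp)
qed

lemma sign_determined_component_graph:
  assumes F: "semialg_fun m n F" and i: "i < n"
  shows "\<exists>T. sign_determined (Suc m) T \<and> (\<forall>x t. length x = m \<longrightarrow> (x @ [t] \<in> T \<longleftrightarrow> t = F x ! i))"
proof -
  let ?S = "{x @ F x | x. length x = m}"
  have lF: "length (F x) = n" if "length x = m" for x using F that by (simp add: semialg_fun_def)
  have "sign_determined (m + n) ?S" using F semialg_set_imp_sign_determined by (auto simp: semialg_fun_def)
  \<comment> \<open>The coordinates are ordered as \<open>x\<close>, \<open>t\<close>,
    \<open>y\<close>, so that projection removes \<open>y\<close>; reading off \<open>x @ y\<close>
    skips position \<open>m\<close>.\<close>
  then have A: "sign_determined (Suc m + n) {w. map (\<lambda>k. w ! (if k < m then k else Suc k)) [0..<m + n] \<in> ?S}" (is "sign_determined _ ?A")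
    by (rule sign_determined_select) auto
  have B: "sign_determined (Suc m + n) {w. sgn (w ! m - w ! (Suc m + i)) = 0}" (is "sign_determined _ ?B")
    by (rule sign_determined_sgn) (use i in \<open>auto intro!: poly_fun_diff pf_proj\<close>)
  have AB: "sign_determined (Suc m + n) (?A \<inter> ?B)" by (rule sign_determined_combine[OF A B]) blast
  define T where "T = {x. \<exists>y. length y = n \<and> x @ y \<in> ?A \<inter> ?B}"
  have "sign_determined (Suc m) T" unfolding T_def by (rule sign_determined_project[OF AB])
  moreover have "x @ [t] \<in> T \<longleftrightarrow> t = F x ! i" if x: "length x = m" for x t
  proof -
    have sel: "map (\<lambda>k. ((x @ [t]) @ y) ! (if k < m then k else Suc k)) [0..<m + n] = x @ y" if "length y = n" for y
      using x that by (intro nth_equalityI) (auto simp: nth_append)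
    have "((x @ [t]) @ y) \<in> ?A \<inter> ?B \<longleftrightarrow> y = F x \<and> t = y ! i" if "length y = n" for y
      using sel[OF that] graph_append_iff[OF x, of y F] x by (simp add: nth_append sgn_zero_iff)
    then show ?thesis unfolding T_def using lF[OF x] by blast
  qed
  ultimately show ?thesis by blast
qed

text \<open>Expand in \<open>t\<close> the polynomials whose signs decide
  \<open>t = F x ! i\<close>. If no nonzero one of them vanished at \<open>F x ! i\<close>, all
  signs would be constant nearby, and a nearby \<open>t\<close> would also be the value of the
  function.\<close>

lemma ex_isolating_family:
  assumes F: "semialg_fun m n F" and i: "i < n"
  shows "\<exists>\<C>. finite \<C> \<and> (\<forall>cs\<in>\<C>. set cs \<subseteq> Collect (poly_fun m)) \<and> (\<forall>cs\<in>\<C>. deriv_coeffs cs \<in> \<C>) \<and>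
    (\<forall>x. length x = m \<longrightarrow> (\<exists>cs\<in>\<C>. spec cs x \<noteq> 0 \<and> poly (spec cs x) (F x ! i) = 0))"
proof -
  obtain T where T: "sign_determined (Suc m) T" "\<And>x t. length x = m \<Longrightarrow> x @ [t] \<in> T \<longleftrightarrow> t = F x ! i"
    using sign_determined_component_graph[OF F i] by blast
  obtain G where G: "finite G" "G \<subseteq> Collect (poly_fun (Suc m))"
    and det: "\<And>u v. length u = Suc m \<Longrightarrow> length v = Suc m \<Longrightarrow> \<forall>g\<in>G. sgn (g u) = sgn (g v) \<Longrightarrow> u \<in> T \<longleftrightarrow> v \<in> T"
    by (rule sign_determinedE[OF T(1)]) (rule that)
  have "\<forall>g\<in>G. \<exists>cs. set cs \<subseteq> Collect (poly_fun m) \<and> (\<forall>x y. length x = m \<longrightarrow> g (x @ [y]) = poly (spec cs x) y)"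
    using poly_fun_expand_last G(2) by blast
  from bchoice[OF this] obtain C where C': "\<forall>g\<in>G. set (C g) \<subseteq> Collect (poly_fun m) \<and>
    (\<forall>x y. length x = m \<longrightarrow> g (x @ [y]) = poly (spec (C g) x) y)" ..
  have C: "set (C g) \<subseteq> Collect (poly_fun m)" "length x = m \<Longrightarrow> g (x @ [y]) = poly (spec (C g) x) y"
    if "g \<in> G" for g x y using C' that by auto
  \<comment> \<open>After as many derivatives as the length of the list, \<open>[]\<close> is
    reached, which is its own derivative; this makes the closure finite.\<close>
  define \<C> where "\<C> = (\<Union>g\<in>G. (\<lambda>k. (deriv_coeffs ^^ k) (C g)) ` {..length (C g)})"
  have len: "length ((deriv_coeffs ^^ k) cs) = length cs - k" for k cs by (induction k) auto
  have pf: "set ((deriv_coeffs ^^ k) cs) \<subseteq> Collect (poly_fun m)" if "set cs \<subseteq> Collect (poly_fun m)" for k cs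
    using that by (induction k) (simp_all add: poly_fun_deriv_coeffs)
  have "finite \<C>" using G(1) by (simp add: \<C>_def)
  moreover have "\<forall>cs\<in>\<C>. set cs \<subseteq> Collect (poly_fun m)" using C(1) pf unfolding \<C>_def by blast
  moreover have "\<forall>cs\<in>\<C>. deriv_coeffs cs \<in> \<C>"
  proof
    fix cs assume "cs \<in> \<C>"
    then obtain g k where g: "g \<in> G" "k \<le> length (C g)" "cs = (deriv_coeffs ^^ k) (C g)" by (auto simp: \<C>_def)
    show "deriv_coeffs cs \<in> \<C>"
    proof (cases "k = length (C g)")
      case True
      then have "cs = []" using len[of k "C g"] g by simp
      then have "deriv_coeffs cs = cs" by (simp add: deriv_coeffs_def)
      then show ?thesis using \<open>cs \<in> \<C>\<close> by simp
    next
      case False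
      then have "deriv_coeffs cs = (deriv_coeffs ^^ Suc k) (C g)" "Suc k \<le> length (C g)" using g by auto
      then show ?thesis using g(1) unfolding \<C>_def by blast
    qed
  qed
  moreover have "\<exists>cs\<in>\<C>. spec cs x \<noteq> 0 \<and> poly (spec cs x) (F x ! i) = 0" if x: "length x = m" for x
  proof (rule ccontr)
    assume no: "\<not> ?thesis"
    have CC: "C g \<in> \<C>" if "g \<in> G" for g
      using that unfolding \<C>_def by (force intro!: image_eqI[of _ _ 0])
    let ?c = "F x ! i"
    have "eventually (\<lambda>y. sgn (poly (spec (C g) x) y) = sgn (poly (spec (C g) x) ?c)) (at ?c)" if "g \<in> G" for g
    proof (cases "spec (C g) x = 0")
      case False
      then have nz: "poly (spec (C g) x) ?c \<noteq> 0" using no CC[OF that] by blast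
      have lim: "((poly (spec (C g) x)) \<longlongrightarrow> poly (spec (C g) x) ?c) (at ?c)"
        using poly_isCont[of ?c "spec (C g) x"] unfolding isCont_def .
      show ?thesis
      proof (cases "0 < poly (spec (C g) x) ?c")
        case True
        show ?thesis by (rule eventually_mono[OF order_tendstoD(1)[OF lim True]]) (use True in simp)
      next
        case False
        then have "poly (spec (C g) x) ?c < 0" using nz by simp
        from eventually_mono[OF order_tendstoD(2)[OF lim this]] show ?thesis using \<open>poly (spec (C g) x) ?c < 0\<close> by simp
      qed
    qed simp
    then have "eventually (\<lambda>y. \<forall>g\<in>G. sgn (poly (spec (C g) x) y) = sgn (poly (spec (C g) x) ?c)) (at ?c)"
      using G(1) by (simp add: eventually_ball_finite)
    moreover have "eventually (\<lambda>y. y \<noteq> ?c) (at ?c)" by (simp add: eventually_at_filter)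
    ultimately have "eventually (\<lambda>y. (\<forall>g\<in>G. sgn (poly (spec (C g) x) y) = sgn (poly (spec (C g) x) ?c)) \<and> y \<noteq> ?c) (at ?c)"
      by (rule eventually_conj)
    from eventually_happens'[OF at_neq_bot this] obtain y
      where y: "\<forall>g\<in>G. sgn (poly (spec (C g) x) y) = sgn (poly (spec (C g) x) ?c)" "y \<noteq> ?c" by blast
    have "\<forall>g\<in>G. sgn (g (x @ [y])) = sgn (g (x @ [?c]))"
      using y(1) C(2)[OF _ x] by simp
    then have "x @ [y] \<in> T \<longleftrightarrow> x @ [?c] \<in> T" using x by (intro det) auto
    then show False using T(2)[OF x] y(2) by simp
  qed
  ultimately show ?thesis by blast
qed

section \<open>Reaching an unknown point in finite time\<close>

text \<open>By \<open>up\<close> the integral of \<open>1 / q\<close> diverges at \<open>f\<close>,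
  so that the slack runs out only there. By \<open>lo\<close> the order of vanishing is at most
  \<open>a\<close>, which gives arrival with speed 0. The bounds reach below \<open>A\<close> so
  that two-sided derivatives exist at the starting point.\<close>

locale sweep =
  fixes q :: "real \<Rightarrow> real" and A f L k :: real and a :: nat
  assumes qcont: "continuous_on UNIV q" and q0: "q f = 0" and qpos: "\<And>y. y \<noteq> f \<Longrightarrow> 0 < q y"
    and Af: "A < f" and L: "0 < L" and k: "0 < k" and a2: "2 \<le> a"
    and up: "\<And>y. A - 1 \<le> y \<Longrightarrow> y \<le> f \<Longrightarrow> q y \<le> L * (f - y)"
    and lo: "\<And>y. A - 1 \<le> y \<Longrightarrow> y \<le> f \<Longrightarrow> k * (f - y) ^ a \<le> q y"
begin

text \<open>The primitive of \<open>1 / q\<close> that vanishes at \<open>A\<close>; integrating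
  from \<open>A - 1\<close> makes it differentiable at \<open>A\<close> from both sides.\<close>

definition Q :: "real \<Rightarrow> real" where
  "Q y = integral {A - 1..y} (\<lambda>t. 1 / q t) - integral {A - 1..A} (\<lambda>t. 1 / q t)"

lemma Q_A: "Q A = 0"
  by (simp add: Q_def)

lemma Q_deriv:
  assumes "A - 1 < y" "y < f" shows "(Q has_real_derivative 1 / q y) (at y)"
proof -
  define b where "b = (y + f) / 2"
  have b: "y < b" "b < f" using assms by (auto simp: b_def)
  have "q t \<noteq> 0" if "t \<le> b" for t using qpos[of t] b that by force
  then have "continuous_on {A - 1..b} (\<lambda>t. 1 / q t)"
    by (intro continuous_intros continuous_on_subset[OF qcont]) auto
  from integral_has_real_derivative[OF this, of y] have
    "((\<lambda>x. integral {A - 1..x} (\<lambda>t. 1 / q t)) has_real_derivative 1 / q y) (at y within {A - 1..b})"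
    using assms b by auto
  then have "((\<lambda>x. integral {A - 1..x} (\<lambda>t. 1 / q t)) has_real_derivative 1 / q y) (at y)"
    using assms b by (simp add: at_within_Icc_at)
  from DERIV_diff[OF this DERIV_const] show ?thesis unfolding Q_def by simp
qed

text \<open>Integrates \<open>1 / q y \<ge> 1 / (L * (f - y))\<close>, a consequence of
  \<open>up\<close>.\<close>

lemma Q_ge:
  assumes "A \<le> y" "y < f" shows "(ln (f - A) - ln (f - y)) / L \<le> Q y"
proof -
  have "Q A + ln (f - A) / L \<le> Q y + ln (f - y) / L"
  proof (rule DERIV_nonneg_imp_nondecreasing[OF assms(1)])
    fix x assume x: "A \<le> x" "x \<le> y"
    then have xf: "x < f" using assms by simp
    have "((\<lambda>y. Q y + ln (f - y) / L) has_real_derivative 1 / q x + (- 1 / (f - x)) / L) (at x)"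
      using x xf L by (auto intro!: derivative_eq_intros Q_deriv)
    moreover have "1 / (L * (f - x)) \<le> 1 / q x"
      using up[of x] qpos[of x] x xf by (intro divide_left_mono mult_pos_pos) (auto simp: L)
    ultimately show "\<exists>D. ((\<lambda>y. Q y + ln (f - y) / L) has_real_derivative D) (at x) \<and> 0 \<le> D"
      by (intro exI conjI) (auto simp: mult.commute)
  qed
  then show ?thesis by (simp add: Q_A diff_divide_distrib)
qed

text \<open>Integrates the bound on \<open>1 / q\<close> from \<open>lo\<close>; as
  \<open>2 \<le> a\<close>, the primitive is a power and not a logarithm.\<close>

lemma Q_le:
  assumes "A \<le> y" "y < f" shows "Q y \<le> inverse ((f - y) ^ (a - 1)) / (k * real (a - 1))"
proof -
  let ?g = "\<lambda>y. inverse ((f - y) ^ (a - 1)) / (k * real (a - 1))"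
  obtain b where b: "a = Suc (Suc b)" using a2 by (metis add_2_eq_Suc le_Suc_ex)
  have "Q A - ?g A \<ge> Q y - ?g y"
  proof (rule DERIV_nonpos_imp_nonincreasing[OF assms(1)])
    fix x assume x: "A \<le> x" "x \<le> y"
    then have xf: "x < f" using assms by simp
    have "(?g has_real_derivative 1 / (k * (f - x) ^ a)) (at x)"
    proof -
      have "((\<lambda>y. (f - y) ^ Suc b) has_real_derivative - (real (Suc b) * (f - x) ^ b)) (at x)"
        by (rule derivative_eq_intros refl)+ simp
      from DERIV_inverse_fun[OF this] xf
      have "((\<lambda>y. inverse ((f - y) ^ Suc b)) has_real_derivative
          - (- (real (Suc b) * (f - x) ^ b) * inverse (((f - x) ^ Suc b) ^ Suc (Suc 0)))) (at x)" by simp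
      from DERIV_cdivide[OF this, of "k * real (Suc b)"]
      have D: "((\<lambda>y. inverse ((f - y) ^ Suc b) / (k * real (Suc b))) has_real_derivative
          - (- (real (Suc b) * (f - x) ^ b) * inverse (((f - x) ^ Suc b) ^ Suc (Suc 0))) / (k * real (Suc b))) (at x)" .
      define r where "r = f - x"
      have r: "r > 0" using xf by (simp add: r_def)
      have "- (- (real (Suc b) * r ^ b) * inverse ((r ^ Suc b) ^ Suc (Suc 0))) / (k * real (Suc b)) = 1 / (k * r ^ a)"
        using r k unfolding b by (simp add: divide_simps del: of_nat_Suc)
      then show ?thesis using D unfolding r_def by (simp add: b del: of_nat_Suc power_Suc)
    qed
    then have "((\<lambda>y. Q y - ?g y) has_real_derivative 1 / q x - 1 / (k * (f - x) ^ a)) (at x)"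
      by (intro DERIV_diff Q_deriv) (use x xf in auto)
    moreover have "1 / q x \<le> 1 / (k * (f - x) ^ a)"
      using lo[of x] qpos[of x] x xf k by (intro divide_left_mono mult_pos_pos) auto
    ultimately show "\<exists>D. ((\<lambda>y. Q y - ?g y) has_real_derivative D) (at x) \<and> D \<le> 0"
      by (intro exI conjI) auto
  qed
  moreover have "0 \<le> ?g A" using Af k by (intro divide_nonneg_nonneg) auto
  ultimately show ?thesis by (simp add: Q_A)
qed

lemma Q_at_top: "filterlim Q at_top (at_left f)"
proof (rule filterlim_at_top_mono)
  have "filterlim (\<lambda>y. f - y) (at_right 0) (at_left f)"
    unfolding filterlim_at by (auto simp: eventually_at_filter intro!: tendsto_eq_intros)
  then have "filterlim (\<lambda>y. ln (f - y)) at_bot (at_left f)"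
    by (rule filterlim_compose[OF ln_at_0])
  then have "filterlim (\<lambda>y. - ln (f - y)) at_top (at_left f)"
    by (rule filterlim_compose[OF filterlim_uminus_at_top_at_bot])
  then have "filterlim (\<lambda>y. ln (f - A) + - ln (f - y)) at_top (at_left f)"
    by (intro filterlim_tendsto_add_at_top[OF tendsto_const])
  then have "filterlim (\<lambda>y. (1 / L) * (ln (f - A) + - ln (f - y))) at_top (at_left f)"
    by (intro filterlim_tendsto_pos_mult_at_top[OF tendsto_const]) (auto simp: L)
  then show "filterlim (\<lambda>y. (ln (f - A) - ln (f - y)) / L) at_top (at_left f)" by simp
  show "\<forall>\<^sub>F y in at_left f. (ln (f - A) - ln (f - y)) / L \<le> Q y"
    by (rule eventually_at_leftI[OF _ Af]) (auto intro!: Q_ge)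
qed

text \<open>The slack as a function of the position. From
  \<open>y' = q y / (q y + w ^ Suc a)\<close> and \<open>w' = y' - 1\<close> one gets dw/dy = -
  w^(a+1) / q y, hence w^(-a) = 1 + a Q, with initial slack 1 at \<open>A\<close>.\<close>

definition W :: "real \<Rightarrow> real" where
  "W y = (1 + a * Q y) powr (- 1 / a)"

text \<open>Provides a point left of \<open>A\<close> from which on the base of the power in
  \<open>W\<close> is positive, so that \<open>W\<close> can be differentiated at \<open>A\<close>
  from both sides.\<close>

lemma ex_left: "\<exists>A'<A. A - 1 \<le> A' \<and> (\<forall>y. A' < y \<longrightarrow> y < f \<longrightarrow> 0 < 1 + a * Q y)"
proof -
  have "isCont (\<lambda>y. 1 + a * Q y) A"
    by (intro continuous_intros DERIV_isCont[OF Q_deriv]) (use Af in auto)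
  then have "((\<lambda>y. 1 + a * Q y) \<longlongrightarrow> 1) (at A)" unfolding isCont_def by (simp add: Q_A)
  then have "\<forall>\<^sub>F y in at A. 0 < 1 + a * Q y" by (rule order_tendstoD) simp
  then obtain d where d: "d > 0" "\<And>y. y \<noteq> A \<Longrightarrow> dist y A < d \<Longrightarrow> 0 < 1 + a * Q y"
    by (auto simp: eventually_at)
  have "0 < 1 + a * Q y" if "A - min d 1 < y" "y < f" for y
  proof (cases "y < A")
    case True
    then show ?thesis using d(2)[of y] that by (auto simp: dist_real_def)
  next
    case False
    then have "(ln (f - A) - ln (f - y)) / L \<le> Q y" using Q_ge that by simp
    moreover have "0 \<le> (ln (f - A) - ln (f - y)) / L" using L False that by simp
    ultimately have "0 \<le> Q y" by linarith
    then have "0 \<le> a * Q y" by simp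
    then show ?thesis by linarith
  qed
  then show ?thesis using d(1) by (intro exI[of _ "A - min d 1"]) auto
qed

definition A' :: real where
  "A' = (SOME A'. A' < A \<and> A - 1 \<le> A' \<and> (\<forall>y. A' < y \<longrightarrow> y < f \<longrightarrow> 0 < 1 + a * Q y))"

lemma A': "A' < A" "A - 1 \<le> A'" "\<And>y. A' < y \<Longrightarrow> y < f \<Longrightarrow> 0 < 1 + a * Q y"
  using someI_ex[OF ex_left, folded A'_def] by blast+

lemma W_A: "W A = 1"
  by (simp add: W_def Q_A)

lemma W_pos: "A' < y \<Longrightarrow> y < f \<Longrightarrow> 0 < W y"
  using A'(3)[of y] by (simp add: W_def)

lemma W_power: "A' < y \<Longrightarrow> y < f \<Longrightarrow> W y ^ a = 1 / (1 + a * Q y)"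
proof -
  assume y: "A' < y" "y < f"
  then have p: "0 < 1 + a * Q y" by (rule A'(3))
  have "W y ^ a = W y powr a" using W_pos[OF y] by (simp add: powr_realpow)
  also have "\<dots> = (1 + a * Q y) powr (- 1)" using a2 by (simp add: W_def powr_powr)
  also have "\<dots> = 1 / (1 + a * Q y)" using p by (simp add: powr_minus divide_inverse)
  finally show ?thesis .
qed

lemma W_deriv:
  assumes "A' < y" "y < f" shows "(W has_real_derivative - (W y ^ Suc a) / q y) (at y)"
proof -
  have p: "0 < 1 + a * Q y" using A'(3) assms by blast
  have y: "A - 1 < y" using assms A'(2) by simp
  have "((\<lambda>y. 1 + a * Q y) has_real_derivative a * (1 / q y)) (at y)"
    by (auto intro!: derivative_eq_intros Q_deriv y assms)
  from DERIV_chain2[OF has_real_derivative_powr[OF p, of "- 1 / a"] this]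
  have "(W has_real_derivative (- 1 / a) * (1 + a * Q y) powr (- 1 / a - 1) * (a * (1 / q y))) (at y)"
    unfolding W_def .
  moreover have "(1 + a * Q y) powr (- 1 / a - 1) = W y ^ Suc a"
  proof -
    have "(1 + a * Q y) powr (- 1 / a - 1) = W y * (1 / (1 + a * Q y))"
      using p by (simp add: powr_diff W_def)
    then show ?thesis using W_power[OF assms] by simp
  qed
  ultimately show ?thesis using a2 by simp
qed

lemma W_tendsto: "(W \<longlongrightarrow> 0) (at_left f)"
  unfolding W_def
proof (rule tendsto_neg_powr)
  have "filterlim (\<lambda>y. a * Q y) at_top (at_left f)"
    using a2 by (intro filterlim_tendsto_pos_mult_at_top[OF tendsto_const _ Q_at_top]) auto
  then show "filterlim (\<lambda>y. 1 + a * Q y) at_top (at_left f)"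
    by (intro filterlim_tendsto_add_at_top[OF tendsto_const])
qed (use a2 in simp)

text \<open>This is the vanishing of the arrival speed: at position \<open>y\<close> the remaining
  time is \<open>f - y + W y\<close>, so the mean speed over the rest of the way is at most this
  ratio. Its power with exponent \<open>a\<close> is \<open>(f - y) ^ a * (1 + a * Q y)\<close>,
  which \<open>Q_le\<close> bounds by a quantity tending to 0.\<close>

lemma ratio_tendsto: "((\<lambda>y. (f - y) / W y) \<longlongrightarrow> 0) (at_left f)"
proof -
  define C where "C = a / (k * real (a - 1))"
  have ev: "\<forall>\<^sub>F y in at_left f. y \<in> {A<..<f}" by (rule eventually_at_leftI[OF _ Af])
  have "((\<lambda>y. ((f - y) / W y) ^ a) \<longlongrightarrow> 0) (at_left f)"
  proof (rule tendsto_sandwich)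
    show "\<forall>\<^sub>F y in at_left f. 0 \<le> ((f - y) / W y) ^ a"
      using ev by eventually_elim (use A'(1) W_pos in \<open>auto intro!: divide_nonneg_nonneg less_imp_le\<close>)
    show "\<forall>\<^sub>F y in at_left f. ((f - y) / W y) ^ a \<le> (f - y) ^ a + C * (f - y)"
      using ev
    proof eventually_elim
      case (elim y)
      have y: "A' < y" "y < f" "A \<le> y" using elim A'(1) by auto
      have p: "0 < (f - y) ^ (a - 1)" using y by simp
      have "((f - y) / W y) ^ a = (f - y) ^ a * (1 + a * Q y)"
        by (simp add: power_divide W_power[OF y(1,2)])
      also have "\<dots> = (f - y) ^ a + a * (f - y) * ((f - y) ^ (a - 1) * Q y)"
        using a2 by (simp add: algebra_simps power_eq_if[of _ a])
      also have "\<dots> \<le> (f - y) ^ a + a * (f - y) * (1 / (k * real (a - 1)))"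
      proof -
        have "(f - y) ^ (a - 1) * Q y \<le> (f - y) ^ (a - 1) * (inverse ((f - y) ^ (a - 1)) / (k * real (a - 1)))"
          using Q_le[OF y(3,2)] p by (intro mult_left_mono) auto
        also have "\<dots> = 1 / (k * real (a - 1))"
          using p by (metis divide_inverse mult.assoc mult_1_left right_inverse less_irrefl)
        finally show ?thesis using y by (intro add_left_mono mult_left_mono) auto
      qed
      finally show ?case by (simp add: C_def mult.commute)
    qed
    have "((\<lambda>y. (f - y) ^ a + C * (f - y)) \<longlongrightarrow> (f - f) ^ a + C * (f - f)) (at_left f)"
      by (intro tendsto_intros)
    then show "((\<lambda>y. (f - y) ^ a + C * (f - y)) \<longlongrightarrow> 0) (at_left f)" using a2 by (simp add: zero_power)
  qed simp
  then have "((\<lambda>y. (((f - y) / W y) ^ a) powr (1 / a)) \<longlongrightarrow> 0) (at_left f)"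
  proof (rule tendsto_zero_powrI[OF _ tendsto_const])
    show "\<forall>\<^sub>F y in at_left f. 0 \<le> ((f - y) / W y) ^ a"
      using ev by eventually_elim (use A'(1) W_pos in \<open>auto intro!: divide_nonneg_nonneg less_imp_le\<close>)
  qed (use a2 in simp)
  moreover have "\<forall>\<^sub>F y in at_left f. (((f - y) / W y) ^ a) powr (1 / a) = (f - y) / W y"
    using ev
  proof eventually_elim
    case (elim y)
    then have p: "0 < f - y" "0 < W y" using A'(1) W_pos by auto
    then have "0 < (f - y) / W y" by simp
    then have "(((f - y) / W y) ^ a) = ((f - y) / W y) powr a" by (simp add: powr_realpow)
    then show ?case using p a2 by (simp add: powr_powr)
  qed
  ultimately show ?thesis by (rule Lim_transform_eventually)
qed

end


text \<open>The smoothstep polynomial. Its derivative vanishes at 0 and 1, so that consecutive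
  phases join differentiably.\<close>

definition ramp :: "real \<Rightarrow> real" where
  "ramp u = u\<^sup>2 * (3 - 2 * u)"

lemma ramp_0 [simp]: "ramp 0 = 0" and ramp_1 [simp]: "ramp 1 = 1"
  by (simp_all add: ramp_def)

lemma ramp_deriv: "(ramp has_real_derivative 6 * u * (1 - u)) (at u within S)"
  unfolding ramp_def by (auto intro!: derivative_eq_intros simp: power2_eq_square algebra_simps)

text \<open>The right-hand side \<open>h\<close> is the velocity per unit of
  \<open>ramp u\<close>.\<close>

definition flows :: "(real \<Rightarrow> real \<Rightarrow> real) \<Rightarrow> (real \<Rightarrow> real) \<Rightarrow> bool" where
  "flows h y \<longleftrightarrow> (\<forall>u\<in>{0..1}. (y has_real_derivative 6 * u * (1 - u) * h (y u) u) (at u within {0..1}))"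

text \<open>All solutions must share the end point, which cannot be taken from a Lipschitz argument:
  the sweeping velocity jumps at the target once the slack is used up.\<close>

definition steers :: "(real \<Rightarrow> real \<Rightarrow> real) \<Rightarrow> real \<Rightarrow> real \<Rightarrow> bool" where
  "steers h y0 y1 \<longleftrightarrow> (\<exists>y. y 0 = y0 \<and> y 1 = y1 \<and> flows h y) \<and> (\<forall>y. y 0 = y0 \<longrightarrow> flows h y \<longrightarrow> y 1 = y1)"

lemma within_nondecreasing:
  fixes g :: "real \<Rightarrow> real"
  assumes "\<And>u. u \<in> {s..t} \<Longrightarrow> (g has_real_derivative D u) (at u within {s..t})"
    and "\<And>u. s < u \<Longrightarrow> u < t \<Longrightarrow> 0 \<le> D u" and "s \<le> t"
  shows "g s \<le> g t"
proof (cases "s = t")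
  case False
  then have "s < t" using assms(3) by simp
  then obtain u where u: "u \<in> {s<..<t}" "g t - g s = (t - s) * D u"
    using mvt_simple[of s t g "\<lambda>u h. h * D u"] assms(1)
    by (auto simp: has_field_derivative_def mult_commute_abs)
  then have "0 \<le> g t - g s" using assms(2)[of u] \<open>s < t\<close> by simp
  then show ?thesis by simp
qed simp

lemma neg_square_deriv:
  assumes "(e has_real_derivative E) (at u within S)"
  shows "((\<lambda>u. - (e u)\<^sup>2) has_real_derivative - (2 * e u * E)) (at u within S)"
  by (rule derivative_eq_intros assms refl)+ simp

lemma steers_const: "steers (\<lambda>_ _. c) y0 (y0 + c)"
proof -
  have "flows (\<lambda>_ _. c) (\<lambda>u. y0 + c * ramp u)"
    unfolding flows_def by (auto intro!: derivative_eq_intros ramp_deriv)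
  then have "\<exists>y. y 0 = y0 \<and> y 1 = y0 + c \<and> flows (\<lambda>_ _. c) y"
    by (intro exI[of _ "\<lambda>u. y0 + c * ramp u"]) simp
  moreover have "y 1 = y0 + c" if "y 0 = y0" "flows (\<lambda>_ _. c) y" for y
  proof -
    have "\<exists>e. \<forall>u\<in>{0..1}. y u - c * ramp u = e"
    proof (rule has_field_derivative_zero_constant)
      fix u :: real assume "u \<in> {0..1}"
      then have "(y has_real_derivative 6 * u * (1 - u) * c) (at u within {0..1})"
        using that(2) by (simp add: flows_def)
      then show "((\<lambda>u. y u - c * ramp u) has_real_derivative 0) (at u within {0..1})"
        by (auto intro!: derivative_eq_intros ramp_deriv)
    qed simp
    then obtain e where "\<And>u. u \<in> {0..1} \<Longrightarrow> y u - c * ramp u = e" by blast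
    from this[of 0] this[of 1] show ?thesis using that(1) by simp
  qed
  ultimately show ?thesis unfolding steers_def by blast
qed

section \<open>Every solution of the sweep ends at the target\<close>

context sweep
begin

definition h :: "real \<Rightarrow> real \<Rightarrow> real \<Rightarrow> real" where
  "h T y u = T * q y / (q y + max 0 (y - A + 1 - T * ramp u) ^ Suc a)"

lemma q_nonneg: "0 \<le> q y"
  using qpos[of y] q0 by (cases "y = f") (auto intro: less_imp_le)

lemma h_bounds: assumes "0 \<le> T" shows "0 \<le> h T y u" "h T y u \<le> T"
proof -
  have m: "0 \<le> max 0 (y - A + 1 - T * ramp u) ^ Suc a" by simp
  show "0 \<le> h T y u" unfolding h_def using assms q_nonneg[of y] m by (intro divide_nonneg_nonneg mult_nonneg_nonneg add_nonneg_nonneg)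
  have "q y / (q y + max 0 (y - A + 1 - T * ramp u) ^ Suc a) \<le> 1"
  proof (cases "q y + max 0 (y - A + 1 - T * ramp u) ^ Suc a = 0")
    case False
    then have "0 < q y + max 0 (y - A + 1 - T * ramp u) ^ Suc a" using q_nonneg[of y] m by linarith
    then show ?thesis using m by (simp add: divide_le_eq_1_pos)
  next
    case True
    then show ?thesis unfolding True by simp
  qed
  from mult_left_mono[OF this assms] show "h T y u \<le> T" by (simp add: h_def)
qed

text \<open>While \<open>z < f\<close>, the slack \<open>w = z - A + 1 - T ramp\<close> and \<open>W z\<close> start equal and their distance
  never increases, so they agree; in particular the slack is positive.\<close>

lemma slack_eq:
  assumes T: "0 \<le> T" and z0: "z 0 = A" and fl: "flows (h T) z" and u1: "u1 \<in> {0..1}"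
    and lt: "\<And>u. u \<in> {0..u1} \<Longrightarrow> A \<le> z u \<and> z u < f"
  shows "z u1 - A + 1 - T * ramp u1 = W (z u1)"
proof -
  let ?w = "\<lambda>u. z u - A + 1 - T * ramp u"
  let ?e = "\<lambda>u. ?w u - W (z u)"
  let ?E = "\<lambda>u. 6 * u * (1 - u) * T * (W (z u) ^ Suc a - max 0 (?w u) ^ Suc a) / (q (z u) + max 0 (?w u) ^ Suc a)"
  have De: "(?e has_real_derivative ?E u) (at u within {0..u1})" if u: "u \<in> {0..u1}" for u
  proof -
    have zu: "A' < z u" "z u < f" using lt[OF u] A'(1) by auto
    have q: "0 < q (z u)" using qpos zu by auto
    have m: "0 \<le> max 0 (?w u) ^ Suc a" by simp
    have "(z has_real_derivative 6 * u * (1 - u) * h T (z u) u) (at u within {0..1})"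
      using fl u u1 by (auto simp: flows_def)
    then have Dz: "(z has_real_derivative 6 * u * (1 - u) * h T (z u) u) (at u within {0..u1})"
      by (rule has_field_derivative_subset) (use u1 in auto)
    have "(?e has_real_derivative (6 * u * (1 - u) * h T (z u) u - T * (6 * u * (1 - u))) -
        (- (W (z u) ^ Suc a) / q (z u)) * (6 * u * (1 - u) * h T (z u) u)) (at u within {0..u1})"
      by (auto intro!: derivative_eq_intros Dz ramp_deriv DERIV_chain2[OF W_deriv[OF zu] Dz])
    moreover have "(6 * u * (1 - u) * h T (z u) u - T * (6 * u * (1 - u))) -
        (- (W (z u) ^ Suc a) / q (z u)) * (6 * u * (1 - u) * h T (z u) u) = ?E u"
    proof -
      define M where "M = max 0 (?w u) ^ Suc a"
      define V where "V = W (z u) ^ Suc a"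
      define g where "g = q (z u)"
      have g: "0 < g" "0 \<le> M" using q m by (auto simp: g_def M_def)
      then have "g + M \<noteq> 0" "g \<noteq> 0" by auto
      have "(6 * u * (1 - u) * (T * g / (g + M)) - T * (6 * u * (1 - u))) -
        (- V / g) * (6 * u * (1 - u) * (T * g / (g + M))) = 6 * u * (1 - u) * T * (V - M) / (g + M)"
      proof -
        define S where "S = T / (g + M)"
        have T: "T = S * (g + M)" using \<open>g + M \<noteq> 0\<close> by (simp add: S_def)
        have e1: "T * g / (g + M) = S * g" by (simp add: S_def)
        have e2: "6 * u * (1 - u) * T * (V - M) / (g + M) = 6 * u * (1 - u) * S * (V - M)" by (simp add: S_def)
        show ?thesis unfolding e1 e2 unfolding T using \<open>g \<noteq> 0\<close> by (simp add: field_simps)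
      qed
      then show ?thesis unfolding h_def M_def V_def g_def .
    qed
    ultimately show ?thesis by simp
  qed
  have "- (?e 0)\<^sup>2 \<le> - (?e u1)\<^sup>2"
  proof (rule within_nondecreasing[of 0 u1 "\<lambda>u. - (?e u)\<^sup>2" "\<lambda>u. - (2 * ?e u * ?E u)"])
    show "((\<lambda>u. - (?e u)\<^sup>2) has_real_derivative - (2 * ?e u * ?E u)) (at u within {0..u1})" if "u \<in> {0..u1}" for u
      by (rule neg_square_deriv[OF De[OF that]])
    fix u assume u: "0 < u" "u < u1"
    then have zu: "A' < z u" "z u < f" using lt[of u] A'(1) by auto
    have Wp: "0 < W (z u)" using W_pos zu by simp
    have den: "0 < q (z u) + max 0 (?w u) ^ Suc a" using qpos[of "z u"] zu by (auto intro!: add_pos_nonneg)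
    have c: "0 \<le> 6 * u * (1 - u) * T" using u u1 T by auto
    \<comment> \<open>The derivative of the difference has the sign of the difference of powers,
      which is opposite to that of \<open>?e u\<close>; so its square cannot grow.\<close>
    have "?e u * (W (z u) ^ Suc a - max 0 (?w u) ^ Suc a) \<le> 0"
    proof (cases "0 \<le> ?e u")
      case True
      then have "W (z u) ^ Suc a \<le> max 0 (?w u) ^ Suc a" using Wp by (intro power_mono) auto
      then show ?thesis using True by (intro mult_nonneg_nonpos) auto
    next
      case False
      then have "max 0 (?w u) ^ Suc a \<le> W (z u) ^ Suc a" using Wp by (intro power_mono) auto
      then show ?thesis using False by (intro mult_nonpos_nonneg) auto
    qed
    then have "6 * u * (1 - u) * T * (?e u * (W (z u) ^ Suc a - max 0 (?w u) ^ Suc a)) \<le> 0"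
      using c by (rule mult_nonneg_nonpos[rotated])
    then have "6 * u * (1 - u) * T * (?e u * (W (z u) ^ Suc a - max 0 (?w u) ^ Suc a)) / (q (z u) + max 0 (?w u) ^ Suc a) \<le> 0"
      using den by (intro divide_nonpos_pos)
    moreover have "- (2 * e * (c * D / M)) = - 2 * (c * (e * D) / M)" for e c D M :: real by simp
    ultimately show "0 \<le> - (2 * ?e u * ?E u)" by (simp only:)
  qed (use u1 in auto)
  then have "(?e u1)\<^sup>2 \<le> 0" using z0 W_A by simp
  then show ?thesis by simp
qed

text \<open>A solution is nondecreasing. If it stayed below \<open>f\<close>, its slack would be
  positive at the end, against the choice of \<open>T\<close>. It cannot go beyond \<open>f\<close>
  either: the slack is gone when \<open>f\<close> is first reached, so after the last time at
  \<open>f\<close> the velocity would be the full \<open>T\<close>, while at \<open>f\<close> itself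
  it is 0, and a differentiable function admits no such jump of its one-sided derivative.\<close>

lemma sweep_unique:
  assumes T: "f - A + 1 < T" and z0: "z 0 = A" and fl: "flows (h T) z"
  shows "z 1 = f"
proof -
  have T0: "0 \<le> T" using T Af by linarith
  have D: "(z has_real_derivative 6 * u * (1 - u) * h T (z u) u) (at u within {s..t})"
    if "u \<in> {s..t}" "0 \<le> s" "t \<le> 1" for u s t
  proof -
    have "(z has_real_derivative 6 * u * (1 - u) * h T (z u) u) (at u within {0..1})"
      using fl that by (auto simp: flows_def)
    then show ?thesis by (rule has_field_derivative_subset) (use that in auto)
  qed
  have mono: "z s \<le> z t" if "0 \<le> s" "s \<le> t" "t \<le> 1" for s t
    by (rule within_nondecreasing[of s t z, OF D]) (use that h_bounds(1)[OF T0] in \<open>auto intro!: mult_nonneg_nonneg\<close>)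
  have slack: "z t - T * ramp t \<le> z s - T * ramp s" if "0 \<le> s" "s \<le> t" "t \<le> 1" for s t
  proof -
    have "T * ramp s - z s \<le> T * ramp t - z t"
    proof (rule within_nondecreasing[of s t "\<lambda>u. T * ramp u - z u" "\<lambda>u. 6 * u * (1 - u) * (T - h T (z u) u)"])
      show "((\<lambda>u. T * ramp u - z u) has_real_derivative 6 * u * (1 - u) * (T - h T (z u) u)) (at u within {s..t})"
        if "u \<in> {s..t}" for u
        by (rule derivative_eq_intros ramp_deriv D refl)+ (use that \<open>0 \<le> s\<close> \<open>t \<le> 1\<close> in \<open>auto simp: algebra_simps\<close>)
    qed (use that h_bounds(2)[OF T0] in \<open>auto intro!: mult_nonneg_nonneg\<close>)
    then show ?thesis by simp
  qed
  have cont: "continuous_on {0..1} z"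
    using D[of _ 0 1] by (intro DERIV_continuous_on) auto
  have below: "z u - A + 1 - T * ramp u = W (z u)" if "u \<in> {0..1}" "z u < f" for u
  proof (rule slack_eq[OF T0 z0 fl that(1)])
    fix v assume "v \<in> {0..u}"
    then show "A \<le> z v \<and> z v < f" using mono[of 0 v] mono[of v u] z0 that by auto
  qed
  have ge: "f \<le> z 1"
  proof (rule ccontr)
    assume "\<not> ?thesis"
    then have lt: "z 1 < f" by simp
    have "A' < z 1" using mono[of 0 1] z0 A'(1) by simp
    then have "0 < z 1 - A + 1 - T" using below[of 1] W_pos lt by simp
    then show False using lt T by linarith
  qed
  moreover have "\<not> f < z 1"
  proof
    assume gt: "f < z 1"
    \<comment> \<open>The times spent at \<open>f\<close>; by compactness there is a first one
      \<open>v\<close> and a last one \<open>s\<close>.\<close>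
    define B where "B = {u \<in> {0..1}. z u = f}"
    have Bne: "B \<noteq> {}" using IVT'[of z 0 f 1] cont z0 Af ge by (auto simp: B_def)
    have "closed B"
    proof -
      have "closedin (top_of_set {0..1}) ({0..1} \<inter> z -` {f})" by (rule continuous_closedin_preimage[OF cont]) simp
      moreover have "{0..1} \<inter> z -` {f} = B" by (auto simp: B_def)
      ultimately show ?thesis using closedin_closed_trans by fastforce
    qed
    then have "compact B" using compact_Int_closed[of "{0..1}" B] by (simp add: Int_absorb1 B_def subset_iff Collect_conj_eq compact_Icc)
    then obtain v where v: "v \<in> B" "\<And>u. u \<in> B \<Longrightarrow> v \<le> u" using compact_attains_inf Bne by metis
    obtain s where s: "s \<in> B" "\<And>u. u \<in> B \<Longrightarrow> u \<le> s" using compact_attains_sup \<open>compact B\<close> Bne by metis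
    have v01: "0 < v" "v \<le> 1" "z v = f" using v(1) z0 Af by (auto simp: B_def less_le)
    have s01: "0 < s" "s < 1" "z s = f" using s(1) v(2)[OF s(1)] v01 gt by (auto simp: B_def less_le)
    \<comment> \<open>Before \<open>v\<close> the slack equals \<open>W (z u)\<close>, which tends
      to 0 as \<open>z u\<close> approaches \<open>f\<close>; and the slack never increases.\<close>
    have vw: "z v - A + 1 - T * ramp v \<le> 0"
    proof (rule ccontr)
      assume "\<not> ?thesis"
      then have pos: "0 < z v - A + 1 - T * ramp v" by simp
      have lt: "z u < f" if "0 \<le> u" "u < v" for u
      proof -
        have "z u \<le> f" using mono[of u v] that v01 by auto
        moreover have "z u \<noteq> f" using v(2)[of u] that v01 by (auto simp: B_def)
        ultimately show ?thesis by simp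
      qed
      have "(z \<longlongrightarrow> z v) (at v within {0..v})"
        using continuous_on_subset[OF cont, of "{0..v}"] v01 by (auto simp: continuous_on_def)
      then have "(z \<longlongrightarrow> f) (at_left v)" using v01 by (simp add: at_within_Icc_at_left)
      moreover have ev: "\<forall>\<^sub>F u in at_left v. u \<in> {0<..<v}" by (rule eventually_at_leftI[OF _ v01(1)])
      moreover have "\<forall>\<^sub>F u in at_left v. z u < f" using ev by eventually_elim (use lt in auto)
      ultimately have "filterlim z (at_left f) (at_left v)"
        unfolding filterlim_at by (auto elim: eventually_mono)
      then have "((\<lambda>u. W (z u)) \<longlongrightarrow> 0) (at_left v)" by (rule filterlim_compose[OF W_tendsto])
      then have "\<forall>\<^sub>F u in at_left v. W (z u) < z v - A + 1 - T * ramp v" using pos by (rule order_tendstoD)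
      from eventually_happens'[OF _ eventually_conj[OF this ev]] obtain u where
        u: "W (z u) < z v - A + 1 - T * ramp v" "0 < u" "u < v" by auto
      then show False using below[of u] lt[of u] slack[of u v] v01 by auto
    qed
    have above: "f < z u" if "s < u" "u \<le> 1" for u
    proof -
      have "f \<le> z u" using mono[of s u] that s01 by auto
      moreover have "z u \<noteq> f" using s(2)[of u] that s01 by (auto simp: B_def)
      ultimately show ?thesis by simp
    qed
    have "v \<le> s" using v(2) s(1) by blast
    have h1: "h T (z u) u = T" if "s < u" "u \<le> 1" for u
    proof -
      have "z u - A + 1 - T * ramp u \<le> 0" using slack[of v u] vw that \<open>v \<le> s\<close> v01 by auto
      moreover have "0 < q (z u)" using above[OF that] qpos by auto
      ultimately show ?thesis by (simp add: h_def max_absorb1)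
    qed
    have eq: "z u = f + T * (ramp u - ramp s)" if "s \<le> u" "u \<le> 1" for u
    proof -
      have "T * ramp s - z s \<ge> T * ramp u - z u"
        using within_nondecreasing[of s u "\<lambda>u. z u - T * ramp u" "\<lambda>u. 6 * u * (1 - u) * (h T (z u) u - T)"] that s01 h1
        by (force intro!: derivative_eq_intros ramp_deriv D simp: algebra_simps)
      then show ?thesis using slack[of s u] that s01 by (auto simp: algebra_simps)
    qed
    \<comment> \<open>To the right of \<open>s\<close> the solution is explicit and leaves with
      positive slope, while the equation at \<open>s\<close> gives slope 0 because
      \<open>q f = 0\<close>.\<close>
    have "((\<lambda>u. f + T * (ramp u - ramp s)) has_real_derivative T * (6 * s * (1 - s))) (at s within {s..1})"
      by (auto intro!: derivative_eq_intros ramp_deriv)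
    then have "(z has_real_derivative T * (6 * s * (1 - s))) (at s within {s..1})"
      by (rule has_field_derivative_transform_within[where d = 1]) (use eq s01 in auto)
    moreover have "(z has_real_derivative 0) (at s within {s..1})"
      using D[of s s 1] s01 q0 by (simp add: h_def)
    moreover have "at s within {s..1} \<noteq> bot" using s01 by (simp add: at_within_Icc_at_right)
    ultimately have "T * (6 * s * (1 - s)) = 0" by (rule has_field_derivative_unique)
    then show False using s01 T Af by auto
  qed
  ultimately show ?thesis by simp
qed


text \<open>The time at which position \<open>y\<close> is reached, obtained by solving slack =
  \<open>W y\<close> for the time; replacing \<open>W\<close> by 0 at \<open>f\<close> yields the
  arrival time \<open>f - A + 1\<close>. The trajectory \<open>Z\<close> below is its inverse, at
  rest after arrival.\<close>

definition \<Phi> :: "real \<Rightarrow> real" where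
  "\<Phi> y = y - A + 1 - (if y < f then W y else 0)"

lemma \<Phi>_A: "\<Phi> A = 0" and \<Phi>_f: "\<Phi> f = f - A + 1"
  using Af by (simp_all add: \<Phi>_def W_A)

lemma \<Phi>_deriv:
  assumes "A' < y" "y < f" shows "(\<Phi> has_real_derivative (q y + W y ^ Suc a) / q y) (at y)"
proof -
  have "((\<lambda>y. y - A + 1 - W y) has_real_derivative (q y + W y ^ Suc a) / q y) (at y)"
    using qpos[of y] assms
    by (auto intro!: derivative_eq_intros W_deriv simp: add_divide_distrib)
  then show ?thesis
    by (rule has_field_derivative_transform_within_open[where S = "{..<f}"]) (use assms in \<open>auto simp: \<Phi>_def\<close>)
qed

lemma \<Phi>_cont: "continuous_on {A..f} \<Phi>"
  unfolding continuous_on_def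
proof
  fix y assume y: "y \<in> {A..f}"
  show "(\<Phi> \<longlongrightarrow> \<Phi> y) (at y within {A..f})"
  proof (cases "y < f")
    case True
    then have "isCont \<Phi> y" using DERIV_isCont[OF \<Phi>_deriv] y A'(1) by auto
    then show ?thesis unfolding isCont_def by (rule tendsto_within_subset) simp
  next
    case False
    then have "y = f" using y by simp
    have "((\<lambda>y. y - A + 1 - W y) \<longlongrightarrow> f - A + 1 - 0) (at_left f)"
      by (intro tendsto_intros W_tendsto)
    moreover have "\<forall>\<^sub>F y in at_left f. y - A + 1 - W y = \<Phi> y"
      by (rule eventually_at_leftI[OF _ Af]) (auto simp: \<Phi>_def)
    ultimately have "(\<Phi> \<longlongrightarrow> f - A + 1 - 0) (at_left f)" by (rule Lim_transform_eventually)
    then show ?thesis using Af by (simp add: \<open>y = f\<close> \<Phi>_f at_within_Icc_at_left)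
  qed
qed

text \<open>The speed is at most 1, as \<open>W\<close> is decreasing. This makes the inverse
  Lipschitz, also at arrival.\<close>

lemma \<Phi>_expand:
  assumes "A \<le> x" "x \<le> y" "y \<le> f" shows "y - x \<le> \<Phi> y - \<Phi> x"
proof -
  let ?V = "\<lambda>y. if y < f then W y else 0"
  have W_dec: "W t \<le> W s" if "A \<le> s" "s \<le> t" "t < f" for s t
  proof (rule DERIV_nonpos_imp_nonincreasing[OF that(2)])
    fix r assume "s \<le> r" "r \<le> t"
    then have r: "A' < r" "r < f" using that A'(1) by auto
    show "\<exists>D. (W has_real_derivative D) (at r) \<and> D \<le> 0"
      using W_deriv[OF r] W_pos[OF r] q_nonneg[of r] by (intro exI conjI) (auto intro!: divide_nonneg_nonneg)
  qed
  have "?V y \<le> ?V x" using W_dec[of x y] W_pos[of x] A'(1) assms by (auto intro: less_imp_le)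
  then show ?thesis by (simp add: \<Phi>_def)
qed

definition Z :: "real \<Rightarrow> real" where
  "Z \<tau> = (if \<tau> < f - A + 1 then SOME y. A \<le> y \<and> y \<le> f \<and> \<Phi> y = \<tau> else f)"

lemma Z:
  assumes "0 \<le> \<tau>" "\<tau> < f - A + 1" shows "A \<le> Z \<tau>" "Z \<tau> < f" "\<Phi> (Z \<tau>) = \<tau>"
proof -
  have "\<exists>y. A \<le> y \<and> y \<le> f \<and> \<Phi> y = \<tau>"
    using IVT'[of \<Phi> A \<tau> f] \<Phi>_cont \<Phi>_A \<Phi>_f assms Af by auto
  from someI_ex[OF this] have "A \<le> Z \<tau> \<and> Z \<tau> \<le> f \<and> \<Phi> (Z \<tau>) = \<tau>" using assms by (simp add: Z_def)
  moreover from this have "Z \<tau> \<noteq> f" using \<Phi>_f assms by auto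
  ultimately show "A \<le> Z \<tau>" "Z \<tau> < f" "\<Phi> (Z \<tau>) = \<tau>" by auto
qed

lemma Z_f: "f - A + 1 \<le> \<tau> \<Longrightarrow> Z \<tau> = f"
  by (simp add: Z_def)

lemma Z_0: "Z 0 = A"
proof (rule ccontr)
  assume "Z 0 \<noteq> A"
  then have "A < Z 0" "Z 0 < f" "\<Phi> (Z 0) = 0" using Z[of 0] Af by auto
  then show False using \<Phi>_expand[of A "Z 0"] \<Phi>_A by simp
qed

lemma Z_Lipschitz:
  assumes "0 \<le> s" "s \<le> t" "t \<le> f - A + 1" shows "\<bar>Z t - Z s\<bar> \<le> t - s"
proof -
  have t: "A \<le> Z t" "Z t \<le> f" "\<Phi> (Z t) = t"
    using Z[of t] Z_f[of t] \<Phi>_f assms Af by (cases "t < f - A + 1"; auto)+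
  have s: "A \<le> Z s" "Z s \<le> f" "\<Phi> (Z s) = s"
    using Z[of s] Z_f[of s] \<Phi>_f assms Af by (cases "s < f - A + 1"; auto)+
  show ?thesis
  proof (cases "Z s \<le> Z t")
    case True
    then show ?thesis using \<Phi>_expand[of "Z s" "Z t"] s t by simp
  next
    case False
    then show ?thesis using \<Phi>_expand[of "Z t" "Z s"] s t assms by simp
  qed
qed

lemma Z_isCont: assumes "0 < \<tau>" "\<tau> < f - A + 1" shows "isCont Z \<tau>"
proof -
  define d where "d = min \<tau> (f - A + 1 - \<tau>)"
  have "d > 0" using assms by (simp add: d_def)
  have "\<bar>Z t - Z \<tau>\<bar> \<le> \<bar>t - \<tau>\<bar>" if "\<bar>t - \<tau>\<bar> < d" for t
    using Z_Lipschitz[of t \<tau>] Z_Lipschitz[of \<tau> t] that by (cases "t \<le> \<tau>") (auto simp: d_def)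
  note lip = this
  show ?thesis unfolding continuous_at_eps_delta
  proof (intro allI impI)
    fix e :: real assume "e > 0"
    then show "\<exists>d'>0. \<forall>t. dist t \<tau> < d' \<longrightarrow> dist (Z t) (Z \<tau>) < e"
      using \<open>d > 0\<close> by (intro exI[of _ "min d e"]) (auto simp: dist_real_def intro: order_le_less_trans[OF lip])
  qed
qed

lemma Z_deriv:
  assumes "0 < \<tau>" "\<tau> < f - A + 1"
  shows "(Z has_real_derivative q (Z \<tau>) / (q (Z \<tau>) + W (Z \<tau>) ^ Suc a)) (at \<tau>)"
proof -
  have z: "A' < Z \<tau>" "Z \<tau> < f" using Z[of \<tau>] assms A'(1) by auto
  have p: "0 < q (Z \<tau>)" "0 < W (Z \<tau>) ^ Suc a" using qpos[of "Z \<tau>"] W_pos z by auto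
  have "(Z has_real_derivative inverse ((q (Z \<tau>) + W (Z \<tau>) ^ Suc a) / q (Z \<tau>))) (at \<tau>)"
    by (rule DERIV_inverse_function[OF \<Phi>_deriv[OF z] _ assms _ Z_isCont[OF assms]]) (use p Z(3) in auto)
  then show ?thesis by simp
qed

text \<open>Just before arrival the difference quotient is (f - Z) / ((f - Z) + W Z), squeezed to 0
  by \<open>ratio_tendsto\<close>; afterwards \<open>Z\<close> is constant.\<close>

lemma Z_deriv_end: "(Z has_real_derivative 0) (at (f - A + 1))"
proof -
  let ?T = "f - A + 1"
  have T0: "0 < ?T" using Af by simp
  have ev: "\<forall>\<^sub>F \<tau> in at_left ?T. \<tau> \<in> {0<..<?T}" by (rule eventually_at_leftI[OF _ T0])
  have Zlt: "Z \<tau> < f" if "\<tau> \<in> {0<..<?T}" for \<tau> using Z(2)[of \<tau>] that by simp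
  have "(Z \<longlongrightarrow> f) (at_left ?T)"
  proof (rule tendsto_sandwich)
    show "\<forall>\<^sub>F \<tau> in at_left ?T. f - (?T - \<tau>) \<le> Z \<tau>"
      using ev
    proof eventually_elim
      case (elim \<tau>)
      then show ?case using Z_Lipschitz[of \<tau> ?T] Z_f[of ?T] by (simp add: abs_le_iff)
    qed
    show "\<forall>\<^sub>F \<tau> in at_left ?T. Z \<tau> \<le> f" using ev by eventually_elim (rule less_imp_le, rule Zlt)
    have "((\<lambda>\<tau>. f - (?T - \<tau>)) \<longlongrightarrow> f - (?T - ?T)) (at_left ?T)" by (intro tendsto_intros)
    then show "((\<lambda>\<tau>. f - (?T - \<tau>)) \<longlongrightarrow> f) (at_left ?T)" by simp
  qed simp
  moreover have "\<forall>\<^sub>F \<tau> in at_left ?T. Z \<tau> < f" using ev by eventually_elim (rule Zlt)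
  ultimately have "filterlim Z (at_left f) (at_left ?T)"
    unfolding filterlim_at by (auto elim: eventually_mono)
  from filterlim_compose[OF ratio_tendsto this]
  have r: "((\<lambda>\<tau>. (f - Z \<tau>) / W (Z \<tau>)) \<longlongrightarrow> 0) (at_left ?T)" .
  have "((\<lambda>\<tau>. (Z \<tau> - Z ?T) / (\<tau> - ?T)) \<longlongrightarrow> 0) (at_left ?T)"
  proof (rule tendsto_sandwich[OF _ _ tendsto_const r])
    have bounds: "0 \<le> (Z \<tau> - Z ?T) / (\<tau> - ?T) \<and> (Z \<tau> - Z ?T) / (\<tau> - ?T) \<le> (f - Z \<tau>) / W (Z \<tau>)"
      if "\<tau> \<in> {0<..<?T}" for \<tau>
    proof -
      have z: "A' < Z \<tau>" "Z \<tau> < f" "\<Phi> (Z \<tau>) = \<tau>" using Z[of \<tau>] that A'(1) by auto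
      have W: "0 < W (Z \<tau>)" using W_pos z by blast
      have "?T - \<tau> = (f - Z \<tau>) + W (Z \<tau>)" using z by (simp add: \<Phi>_def)
      then have "(Z \<tau> - Z ?T) / (\<tau> - ?T) = (f - Z \<tau>) / ((f - Z \<tau>) + W (Z \<tau>))"
        using Z_f[of ?T] by (metis minus_diff_eq minus_divide_divide order_refl)
      moreover have "(f - Z \<tau>) / ((f - Z \<tau>) + W (Z \<tau>)) \<le> (f - Z \<tau>) / W (Z \<tau>)"
        using z W by (intro divide_left_mono) auto
      ultimately show ?thesis using z W by simp
    qed
    show "\<forall>\<^sub>F \<tau> in at_left ?T. 0 \<le> (Z \<tau> - Z ?T) / (\<tau> - ?T)" using ev by eventually_elim (use bounds in blast)
    show "\<forall>\<^sub>F \<tau> in at_left ?T. (Z \<tau> - Z ?T) / (\<tau> - ?T) \<le> (f - Z \<tau>) / W (Z \<tau>)"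
      using ev by eventually_elim (use bounds in blast)
  qed
  moreover have "((\<lambda>\<tau>. (Z \<tau> - Z ?T) / (\<tau> - ?T)) \<longlongrightarrow> 0) (at_right ?T)"
  proof (rule Lim_transform_eventually[OF tendsto_const])
    show "\<forall>\<^sub>F \<tau> in at_right ?T. 0 = (Z \<tau> - Z ?T) / (\<tau> - ?T)"
      by (rule eventually_at_rightI[of _ "?T + 1"]) (auto simp: Z_f)
  qed
  ultimately show ?thesis unfolding has_field_derivative_iff by (rule filterlim_split_at)
qed

lemma sweep_exists:
  assumes T: "f - A + 1 < T"
  shows "flows (h T) (\<lambda>u. Z (T * ramp u))"
  unfolding flows_def
proof
  fix u :: real assume u: "u \<in> {0..1}"
  let ?\<tau> = "T * ramp u"
  have T0: "0 < T" using T Af by linarith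
  have r0: "0 < ramp v" if "0 < v" "v \<le> 1" for v using that by (simp add: ramp_def)
  have chain: "((\<lambda>u. Z (T * ramp u)) has_real_derivative D * (T * (6 * u * (1 - u)))) (at u within {0..1})"
    if "(Z has_real_derivative D) (at ?\<tau>)" for D
    by (rule DERIV_chain2[where f = Z and g = "\<lambda>u. T * ramp u", OF that]) (auto intro!: derivative_eq_intros ramp_deriv)
  show "((\<lambda>u. Z (T * ramp u)) has_real_derivative 6 * u * (1 - u) * h T (Z (T * ramp u)) u) (at u within {0..1})"
  proof (cases "u = 0")
    case True
    have "((\<lambda>v. Z (T * ramp v)) has_real_derivative 0) (at 0 within {0..1})"
      unfolding has_field_derivative_iff
    proof (rule tendsto_0_le[where K = 1])
      show "((\<lambda>v. T * (3 * v)) \<longlongrightarrow> 0) (at 0 within {0..1})" by (auto intro!: tendsto_eq_intros)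
      have "\<forall>\<^sub>F v in at 0 within {0..1}. \<bar>v\<bar> < min 1 ((f - A + 1) / (3 * T))"
      proof (rule order_tendstoD(2))
        show "((\<lambda>v::real. \<bar>v\<bar>) \<longlongrightarrow> 0) (at 0 within {0..1})" by (auto intro!: tendsto_eq_intros)
      qed (use T0 Af in simp)
      moreover have "\<forall>\<^sub>F v in at 0 within {0..1}. v \<in> {0..1} \<and> v \<noteq> (0::real)" by (simp add: eventually_at_filter)
      ultimately show "\<forall>\<^sub>F v in at 0 within {0..1}. norm ((Z (T * ramp v) - Z (T * ramp 0)) / (v - 0)) \<le> norm (T * (3 * v)) * 1"
      proof eventually_elim
        case (elim v)
        then have v: "0 < v" "v \<le> 1" "v < (f - A + 1) / (3 * T)" by auto
        have le: "ramp v \<le> 3 * v * v" using v by (simp add: ramp_def power2_eq_square algebra_simps)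
        also have "\<dots> \<le> 3 * v" using v by simp
        finally have "T * ramp v \<le> T * (3 * v)" using T0 by simp
        also have "\<dots> < f - A + 1" using v T0 by (simp add: field_simps)
        finally have "\<bar>Z (T * ramp v) - Z 0\<bar> \<le> T * ramp v"
          using Z_Lipschitz[of 0 "T * ramp v"] r0[OF v(1,2)] T0 by simp
        also have "\<dots> \<le> T * (3 * v) * v" using le T0 by (simp add: mult.assoc)
        finally have "\<bar>Z (T * ramp v) - Z 0\<bar> / v \<le> T * (3 * v)" using v by (simp add: divide_le_eq)
        then show ?case using v T0 by (simp add: abs_mult abs_of_pos)
      qed
    qed
    then show ?thesis using True by simp
  next
    case False
    then have pos: "0 < ?\<tau>" using r0[of u] u T0 by simp
    consider "?\<tau> < f - A + 1" | "?\<tau> = f - A + 1" | "f - A + 1 < ?\<tau>" by linarith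
    then show ?thesis
    proof cases
      case 1
      have z: "A' < Z ?\<tau>" "Z ?\<tau> < f" "\<Phi> (Z ?\<tau>) = ?\<tau>" using Z[of ?\<tau>] 1 pos A'(1) by auto
      have w: "Z ?\<tau> - A + 1 - T * ramp u = W (Z ?\<tau>)" using z by (simp add: \<Phi>_def)
      have "h T (Z ?\<tau>) u = T * (q (Z ?\<tau>) / (q (Z ?\<tau>) + W (Z ?\<tau>) ^ Suc a))"
        unfolding h_def w using W_pos[OF z(1,2)] by simp
      then show ?thesis using chain[OF Z_deriv[OF pos 1]] by (simp add: algebra_simps)
    next
      case 2
      have "(Z has_real_derivative 0) (at ?\<tau>)" using Z_deriv_end 2 by simp
      then show ?thesis using chain[of 0] Z_f[of ?\<tau>] 2 q0 by (simp add: h_def)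
    next
      case 3
      have "((\<lambda>_. f) has_real_derivative 0) (at ?\<tau>)" by simp
      then have "(Z has_real_derivative 0) (at ?\<tau>)"
        by (rule has_field_derivative_transform_within_open[where S = "{f - A + 1<..}"]) (use 3 in \<open>auto simp: Z_f\<close>)
      then show ?thesis using chain[of 0] Z_f[of ?\<tau>] 3 q0 by (simp add: h_def)
    qed
  qed
qed

theorem sweep_steers:
  assumes "f - A + 1 < T" shows "steers (h T) A f"
  unfolding steers_def
proof (intro conjI exI[of _ "\<lambda>u. Z (T * ramp u)"] allI impI)
  show "Z (T * ramp 0) = A" by (simp add: Z_0)
  show "Z (T * ramp 1) = f" using assms by (simp add: Z_f)
qed (fact sweep_exists[OF assms] sweep_unique[OF assms])+

end

lemma steers_sweep:
  assumes "sweep q A f L k a" "f - A + 1 < T"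
  shows "steers (\<lambda>y u. T * q y / (q y + max 0 (y - A + 1 - T * ramp u) ^ Suc a)) A f"
proof -
  interpret sweep q A f L k a by fact
  have "h T = (\<lambda>y u. T * q y / (q y + max 0 (y - A + 1 - T * ramp u) ^ Suc a))"
    by (intro ext) (rule h_def)
  then show ?thesis using sweep_steers[OF assms(2)] by simp
qed

section \<open>Concatenating phases\<close>

lemma sum_scalar_left:
  fixes D :: nat
  shows "i < D \<Longrightarrow> (\<Sum>l<D. (if i = l then d else 0) * M l) = d * (M i :: real)"
  by (simp add: if_distrib[of "\<lambda>x. x * _"] cong: if_cong)

lemma sum_scalar_right:
  fixes D :: nat
  shows "j < D \<Longrightarrow> (\<Sum>l<D. M l * (if l = j then d else 0)) = (M j :: real) * d"
  by (simp add: if_distrib[of "\<lambda>x. _ * x"] cong: if_cong)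

text \<open>The singular case agrees on both sides: division by zero gives 0, which is also the
  default of \<open>clamp_sol\<close>.\<close>

lemma clamp_sol_scalar:
  assumes "0 \<le> c"
  shows "clamp_sol c D (\<lambda>i j. if i = j then d else 0) b = map (\<lambda>i. clamp c (b i / d)) [0..<D]"
proof (cases "d = 0")
  case True
  show ?thesis
  \<comment> \<open>For \<open>D = 0\<close> every matrix counts as invertible, but then both lists
    are empty.\<close>
  proof (cases "D = 0")
    case False
    have "\<not> mat_invertible D (\<lambda>i j. if i = j then d else 0)"
      unfolding mat_invertible_def using True False by auto
    then show ?thesis using True assms
      by (simp add: clamp_sol_def clamp_def map_replicate_const)
  qed (simp add: clamp_sol_def)
next
  case False
  let ?M = "\<lambda>i j::nat. if i = j then d else 0"
  let ?A = "\<lambda>i j. if i < D \<and> j < D \<and> i = j then 1 / d else 0"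
  have inv: "(\<Sum>l<D. ?M i l * ?A l j) = (if i = j then 1 else 0) \<and> (\<Sum>l<D. ?A i l * ?M l j) = (if i = j then 1 else 0)"
    if "i < D" "j < D" for i j
    using that False by (simp only: sum_scalar_left sum_scalar_right) auto
  have "mat_inv D ?M = ?A"
    unfolding mat_inv_def
  proof (rule the_equality)
    show "(\<forall>i j. D \<le> i \<or> D \<le> j \<longrightarrow> ?A i j = 0) \<and> (\<forall>i<D. \<forall>j<D.
      (\<Sum>l<D. ?M i l * ?A l j) = (if i = j then 1 else 0) \<and> (\<Sum>l<D. ?A i l * ?M l j) = (if i = j then 1 else 0))"
      using inv by auto
  next
    fix X :: "nat \<Rightarrow> nat \<Rightarrow> real"
    assume X: "(\<forall>i j. D \<le> i \<or> D \<le> j \<longrightarrow> X i j = 0) \<and> (\<forall>i<D. \<forall>j<D.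
      (\<Sum>l<D. ?M i l * X l j) = (if i = j then 1 else 0) \<and> (\<Sum>l<D. X i l * ?M l j) = (if i = j then 1 else 0))"
    show "X = ?A"
    proof (intro ext)
      fix i j
      show "X i j = ?A i j"
      proof (cases "i < D \<and> j < D")
        case True
        then have "(\<Sum>l<D. ?M i l * X l j) = (if i = j then 1 else 0)" using X by blast
        then have "d * X i j = (if i = j then 1 else 0)" using True sum_scalar_left[of i D d "\<lambda>l. X l j"] by simp
        then show ?thesis using True False by (auto simp: field_simps split: if_splits)
      next
        case False
        then show ?thesis using X by auto
      qed
    qed
  qed
  moreover have "mat_invertible D ?M" unfolding mat_invertible_def by (rule exI[of _ ?A], intro allI impI, rule inv)
  moreover have "(\<Sum>j<D. ?A i j * b j) = b i / d" if "i < D" for i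
  proof -
    have "(\<Sum>j<D. ?A i j * b j) = (\<Sum>j<D. (if i = j then 1 / d else 0) * b j)"
      by (rule sum.cong) (use that in auto)
    then show ?thesis using sum_scalar_left[OF that, of "1 / d" b] by simp
  qed
  ultimately show ?thesis by (simp add: clamp_sol_def)
qed

text \<open>At a point outside a closed set the filter within that set is trivial, so a piece not
  containing \<open>s\<close> imposes nothing.\<close>

lemma has_field_derivative_within_Un:
  fixes g :: "real \<Rightarrow> real"
  assumes "closed S" "closed T" "s \<in> S \<Longrightarrow> (g has_real_derivative D) (at s within S)"
    "s \<in> T \<Longrightarrow> (g has_real_derivative D) (at s within T)"
  shows "(g has_real_derivative D) (at s within S \<union> T)"
proof -
  have bot: "at s within U = bot" if "closed U" "s \<notin> U" for U
    using that unfolding trivial_limit_within closed_limpt by blast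
  have "(g has_real_derivative D) (at s within U)" if "closed U" "s \<in> U \<Longrightarrow> (g has_real_derivative D) (at s within U)" for U
    using that bot[of U] by (cases "s \<in> U") (auto simp: has_field_derivative_iff)
  then have "(g has_real_derivative D) (at s within S)" "(g has_real_derivative D) (at s within T)" using assms by auto
  then show ?thesis unfolding has_field_derivative_iff unfolding at_within_union by (rule filterlim_sup)
qed

lemma has_field_derivative_glue:
  fixes g :: "real \<Rightarrow> real"
  assumes J: "0 < J"
    and d: "\<And>j s. j < J \<Longrightarrow> s \<in> {real j / J..real (Suc j) / J} \<Longrightarrow>
      (g has_real_derivative D s) (at s within {real j / J..real (Suc j) / J})"
    and s: "s \<in> {0..1}"
  shows "(g has_real_derivative D s) (at s within {0..1})"
proof -
  have "\<forall>s\<in>{0..real k / J}. (g has_real_derivative D s) (at s within {0..real k / J})" if "0 < k" "k \<le> J" for k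
    using that
  proof (induction k)
    case (Suc k)
    show ?case
    proof (cases "k = 0")
      case True
      then show ?thesis using d[of 0] Suc.prems by simp
    next
      case False
      have un: "{0..real (Suc k) / J} = {0..real k / J} \<union> {real k / J..real (Suc k) / J}"
      proof -
        have "0 \<le> real k / J" "real k / J \<le> real (Suc k) / J" by (simp_all add: divide_right_mono)
        then show ?thesis by (intro ivl_disj_un_two_touch(4)[symmetric])
      qed
      show ?thesis
      proof
        fix s assume "s \<in> {0..real (Suc k) / J}"
        show "(g has_real_derivative D s) (at s within {0..real (Suc k) / J})"
          unfolding un
        proof (rule has_field_derivative_within_Un)
          show "(g has_real_derivative D s) (at s within {0..real k / J})" if "s \<in> {0..real k / J}"
            using Suc.IH False Suc.prems that by auto
          show "(g has_real_derivative D s) (at s within {real k / J..real (Suc k) / J})"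
            if "s \<in> {real k / J..real (Suc k) / J}" using d[of k] Suc.prems that by auto
        qed auto
      qed
    qed
  qed simp
  from this[of J] show ?thesis using J s by simp
qed

text \<open>In phase \<open>j\<close>, with local time \<open>u = J * s - j\<close>, only component
  \<open>\<iota> j\<close> moves, from state \<open>v j\<close> to state \<open>v (Suc j)\<close>.
  Neighbouring phases both prescribe the field at their common time; the prescriptions agree because
  the profile \<open>6 * u * (1 - u)\<close> vanishes at both ends.\<close>

locale phases =
  fixes J D :: nat and \<iota> :: "nat \<Rightarrow> nat" and H :: "nat \<Rightarrow> real list \<Rightarrow> real \<Rightarrow> real"
    and V :: "real \<Rightarrow> real list \<Rightarrow> nat \<Rightarrow> real" and v :: "nat \<Rightarrow> real list"
  assumes J: "0 < J" and \<iota>: "\<And>j. j < J \<Longrightarrow> \<iota> j < D" and len: "\<And>j. j \<le> J \<Longrightarrow> length (v j) = D"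
    and V: "\<And>j (s :: real) z i. j < J \<Longrightarrow> s \<in> {real j / J..real (Suc j) / J} \<Longrightarrow> length z = D \<Longrightarrow> i < D \<Longrightarrow>
      V s z i = (if i = \<iota> j then J * (6 * (J * s - real j) * (1 - (J * s - real j)) * H j z (J * s - real j)) else 0)"
    and vs: "\<And>j i. j < J \<Longrightarrow> i < D \<Longrightarrow> i \<noteq> \<iota> j \<Longrightarrow> v (Suc j) ! i = v j ! i"
    and st: "\<And>j. j < J \<Longrightarrow> steers (\<lambda>y u. H j ((v j)[\<iota> j := y]) u) (v j ! \<iota> j) (v (Suc j) ! \<iota> j)"
begin

definition sol :: "(real \<Rightarrow> real list) \<Rightarrow> bool" where
  "sol z \<longleftrightarrow> (\<forall>s\<in>{0..1}. length (z s) = D) \<and> z 0 = v 0 \<and>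
     (\<forall>s\<in>{0..1}. \<forall>i<D. ((\<lambda>t. z t ! i) has_real_derivative V s (z s) i) (at s within {0..1}))"

lemma v_Suc: "j < J \<Longrightarrow> (v j)[\<iota> j := v (Suc j) ! \<iota> j] = v (Suc j)"
  using len[of j] len[of "Suc j"] vs[of j] \<iota>[of j] by (intro nth_equalityI) (auto simp: nth_list_update)

lemma phase_subset: "j < J \<Longrightarrow> {real j / J..real (Suc j) / J} \<subseteq> {0..1}"
  using J by (auto simp: divide_le_eq_1 intro: order_trans)

text \<open>Within a phase all components but one are constant, and the remaining one, in local
  time, is a solution of the scalar problem controlled by \<open>steers\<close>.\<close>

lemma sol_end:
  assumes z: "sol z" shows "z 1 = v J"
proof -
  have "j \<le> J \<Longrightarrow> z (real j / J) = v j" for j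
  proof (induction j)
    case 0
    then show ?case using z by (simp add: sol_def)
  next
    case (Suc j)
    then have j: "j < J" and zj: "z (real j / J) = v j" by auto
    let ?I = "{real j / J..real (Suc j) / J}"
    have I01: "s \<in> {0..1}" if "s \<in> ?I" for s using phase_subset[OF j] that by blast
    have lenz: "length (z s) = D" if "s \<in> ?I" for s using z I01[OF that] by (simp add: sol_def)
    have d: "((\<lambda>t. z t ! i) has_real_derivative V s (z s) i) (at s within ?I)" if "s \<in> ?I" "i < D" for s i
      by (rule has_field_derivative_subset[OF _ phase_subset[OF j]])
        (use z I01[OF that(1)] that(2) in \<open>simp add: sol_def\<close>)
    have jI: "real j / J \<in> ?I" using J by (simp add: divide_right_mono)
    have const: "z s ! i = v j ! i" if "s \<in> ?I" "i < D" "i \<noteq> \<iota> j" for s i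
    proof -
      have "\<exists>c. \<forall>s\<in>?I. z s ! i = c"
        by (rule has_field_derivative_zero_constant) (use d V[OF j] lenz that in force)+
      then show ?thesis using that jI zj by metis
    qed
    have upd: "z s = (v j)[\<iota> j := z s ! \<iota> j]" if "s \<in> ?I" for s
      using lenz[OF that] len[of j] j \<iota>[OF j] const[OF that] by (intro nth_equalityI) (auto simp: nth_list_update)
    define y where "y u = z ((real j + u) / J) ! \<iota> j" for u
    have in_I: "(real j + u) / J \<in> ?I" if "u \<in> {0..1}" for u
      using that by (auto simp: divide_right_mono)
    have "flows (\<lambda>y u. H j ((v j)[\<iota> j := y]) u) y"
      unfolding flows_def
    proof
      fix u :: real assume u: "u \<in> {0..1}"
      let ?s = "(real j + u) / J"
      have Js: "J * ?s - real j = u" using J by simp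
      have "((\<lambda>u. (real j + u) / J) has_real_derivative 1 / J) (at u within {0..1})"
        using J by (auto intro!: derivative_eq_intros)
      moreover have "(\<lambda>u. (real j + u) / J) ` {0..1} \<subseteq> ?I" using in_I by blast
      then have "((\<lambda>t. z t ! \<iota> j) has_real_derivative V ?s (z ?s) (\<iota> j)) (at ?s within (\<lambda>u. (real j + u) / J) ` {0..1})"
        using d[OF in_I[OF u] \<iota>[OF j]] by (rule has_field_derivative_subset[rotated])
      ultimately have "(y has_real_derivative V ?s (z ?s) (\<iota> j) * (1 / J)) (at u within {0..1})"
        unfolding y_def by (rule DERIV_image_chain[unfolded o_def, rotated])
      moreover have "V ?s (z ?s) (\<iota> j) * (1 / J) = 6 * u * (1 - u) * H j ((v j)[\<iota> j := y u]) u"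
        using V[OF j in_I[OF u] lenz[OF in_I[OF u]] \<iota>[OF j]] upd[OF in_I[OF u]] J
        unfolding y_def Js by simp
      ultimately show "(y has_real_derivative 6 * u * (1 - u) * H j ((v j)[\<iota> j := y u]) u) (at u within {0..1})" by simp
    qed
    moreover have "y 0 = v j ! \<iota> j" by (simp add: y_def zj)
    ultimately have "y 1 = v (Suc j) ! \<iota> j" using st[OF j] unfolding steers_def by blast
    then show ?case using upd[of "real (Suc j) / J"] v_Suc[OF j] J by (simp add: y_def add.commute divide_right_mono)
  qed
  from this[of J] show ?thesis using J by simp
qed

lemma ex_sol: "\<exists>z. sol z"
proof -
  have "\<forall>j\<in>{..<J}. \<exists>y. y 0 = v j ! \<iota> j \<and> y 1 = v (Suc j) ! \<iota> j \<and> flows (\<lambda>y u. H j ((v j)[\<iota> j := y]) u) y"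
    using st unfolding steers_def by blast
  from bchoice[OF this] obtain y where y: "\<forall>j\<in>{..<J}. y j 0 = v j ! \<iota> j \<and> y j 1 = v (Suc j) ! \<iota> j \<and>
      flows (\<lambda>y u. H j ((v j)[\<iota> j := y]) u) (y j)" ..
  define seg where "seg j s = (v j)[\<iota> j := y j (J * s - real j)]" for j :: nat and s :: real
  \<comment> \<open>At an inner boundary the later phase is chosen, and \<open>min\<close> keeps
    \<open>s = 1\<close> in the last one; \<open>zseg\<close> shows that the earlier phase gives the
    same value there.\<close>
  define p where "p s = min (nat \<lfloor>J * s\<rfloor>) (J - 1)" for s :: real
  define z where "z s = seg (p s) s" for s
  have zseg: "z s = seg j s" if j: "j < J" and s: "s \<in> {real j / J..real (Suc j) / J}" for j s
  proof -
    have b: "real j \<le> J * s" "J * s \<le> real (Suc j)" using s J by (auto simp: field_simps)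
    show ?thesis
    proof (cases "J * s < real (Suc j)")
      case True
      then have "\<lfloor>J * s\<rfloor> = int j" using b by (intro floor_unique) auto
      then show ?thesis using j by (simp add: z_def p_def)
    next
      case False
      then have e: "J * s = real (Suc j)" using b by simp
      then have fl: "nat \<lfloor>J * s\<rfloor> = Suc j" by (metis floor_of_nat nat_int)
      have sj: "seg j s = v (Suc j)" unfolding seg_def e using y j v_Suc[OF j] by simp
      show ?thesis
      proof (cases "Suc j < J")
        case True
        then have "p s = Suc j" by (simp add: p_def fl)
        then have "z s = (v (Suc j))[\<iota> (Suc j) := v (Suc j) ! \<iota> (Suc j)]"
          unfolding z_def seg_def e using y True by simp
        then show ?thesis using sj by simp
      next
        case False
        then have "p s = j" using j by (auto simp: p_def fl)
        then show ?thesis by (simp add: z_def)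
      qed
    qed
  qed
  have "sol z" unfolding sol_def
  proof (intro conjI ballI allI impI)
    show "length (z s) = D" for s using len[of "p s"] J by (simp add: z_def seg_def p_def)
    show "z 0 = v 0" using zseg[of 0 0] J y by (simp add: seg_def)
    fix s :: real and i assume s: "s \<in> {0..1}" and i: "i < D"
    show "((\<lambda>t. z t ! i) has_real_derivative V s (z s) i) (at s within {0..1})"
    proof (rule has_field_derivative_glue[OF J _ s])
      fix j s assume j: "j < J" and s: "s \<in> {real j / J..real (Suc j) / J}"
      let ?I = "{real j / J..real (Suc j) / J}"
      have u: "J * t - real j \<in> {0..1}" if "t \<in> ?I" for t :: real using that J by (auto simp: field_simps)
      have lz: "length (z s) = D" using len[of j] j zseg[OF j s] by (simp add: seg_def)
      have "((\<lambda>t. seg j t ! i) has_real_derivative V s (z s) i) (at s within ?I)"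
      proof (cases "i = \<iota> j")
        case False
        then have "(\<lambda>t. seg j t ! i) = (\<lambda>t. v j ! i)" by (simp add: seg_def)
        then show ?thesis using V[OF j s lz i] False by simp
      next
        case True
        have lin: "((\<lambda>t. J * t - real j) has_real_derivative J) (at s within ?I)"
          by (auto intro!: derivative_eq_intros)
        have sub: "(\<lambda>t. J * t - real j) ` ?I \<subseteq> {0..1}" using u by blast
        have fl: "flows (\<lambda>y u. H j ((v j)[\<iota> j := y]) u) (y j)" using y j by blast
        have "(y j has_real_derivative 6 * (J * s - real j) * (1 - (J * s - real j)) *
            H j ((v j)[\<iota> j := y j (J * s - real j)]) (J * s - real j)) (at (J * s - real j) within (\<lambda>t. J * t - real j) ` ?I)"
          by (rule has_field_derivative_subset[OF fl[unfolded flows_def, rule_format, OF u[OF s]] sub])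
        from DERIV_image_chain[unfolded o_def, OF this lin]
        have d1: "((\<lambda>t. y j (J * t - real j)) has_real_derivative 6 * (J * s - real j) * (1 - (J * s - real j)) *
            H j ((v j)[\<iota> j := y j (J * s - real j)]) (J * s - real j) * J) (at s within ?I)" .
        have sel: "seg j t ! i = y j (J * t - real j)" for t :: real using True i len[of j] j by (simp add: seg_def)
        have Veq: "V s (z s) i = 6 * (J * s - real j) * (1 - (J * s - real j)) *
            H j ((v j)[\<iota> j := y j (J * s - real j)]) (J * s - real j) * J"
          using V[OF j s lz i] True zseg[OF j s] by (simp add: seg_def)
        show ?thesis unfolding sel Veq by (rule d1)
      qed
      then show "((\<lambda>t. z t ! i) has_real_derivative V s (z s) i) (at s within ?I)"
        by (rule has_field_derivative_transform_within[where d = 1]) (use s zseg[OF j] in auto)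
    qed
  qed
  then show ?thesis by blast
qed

end

section \<open>The network\<close>

text \<open>The distance of \<open>t\<close> from the set of reals that are
  \<open>sign_compat\<close> with \<open>c\<close>.\<close>

definition violation :: "real \<Rightarrow> real \<Rightarrow> real" where
  "violation c t = (if 0 < c then max 0 (- t) else if c < 0 then max 0 t else \<bar>t\<bar>)"

lemma violation_nonneg: "0 \<le> violation c t"
  by (simp add: violation_def)

lemma violation_eq_0_iff: "violation c t = 0 \<longleftrightarrow> sign_compat c t"
  by (auto simp: violation_def sign_compat_def)

lemma violation_cong: "sgn c = sgn c' \<Longrightarrow> violation c = violation c'"
  by (auto simp: violation_def fun_eq_iff sgn_if split: if_splits)

lemma violation_le: "violation c t \<le> \<bar>t - c\<bar>"
  by (auto simp: violation_def)

lemma violation_0: "violation 0 t = \<bar>t\<bar>"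
  by (simp add: violation_def)

lemma continuous_on_violation: "continuous_on S g \<Longrightarrow> continuous_on S (\<lambda>y. violation c (g y))"
  unfolding violation_def
  by (cases "0 < c"; cases "c < 0") (auto intro!: continuous_on_max continuous_intros)

lemma poly_Lipschitz_at:
  fixes p :: "real poly"
  shows "\<exists>L\<ge>0. \<forall>y. A \<le> y \<longrightarrow> y \<le> f \<longrightarrow> \<bar>poly p y - poly p f\<bar> \<le> L * (f - y)"
proof -
  have "bounded (poly (pderiv p) ` {A..f})"
    by (intro compact_imp_bounded compact_continuous_image continuous_intros) auto
  then obtain L where L: "\<And>y. y \<in> {A..f} \<Longrightarrow> \<bar>poly (pderiv p) y\<bar> \<le> L"
    unfolding bounded_iff by fastforce
  have "\<bar>poly p y - poly p f\<bar> \<le> \<bar>L\<bar> * (f - y)" if "A \<le> y" "y \<le> f" for y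
  proof (cases "y = f")
    case False
    then have "y < f" using that by simp
    then obtain x where x: "y < x" "x < f" "poly p f - poly p y = (f - y) * poly (pderiv p) x"
      using poly_MVT by blast
    have "\<bar>poly p y - poly p f\<bar> = \<bar>poly (pderiv p) x\<bar> * (f - y)"
      using x that by (metis abs_minus_commute abs_mult abs_of_nonneg diff_ge_0_iff_ge mult.commute)
    also have "\<dots> \<le> \<bar>L\<bar> * (f - y)" using L[of x] x that by (intro mult_right_mono) auto
    finally show ?thesis .
  qed simp
  then show ?thesis by (intro exI[of _ "\<bar>L\<bar>"]) auto
qed

text \<open>Near \<open>f\<close> split off the root: \<open>g\<close> is (y - f)^r times a factor
  bounded away from 0, with \<open>r \<le> a\<close>. Away from \<open>f\<close> the positive
  continuous \<open>q\<close> has a positive minimum.\<close>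

lemma poly_vanishing_order:
  fixes g :: "real poly"
  assumes g: "g \<noteq> 0" "poly g f = 0" "degree g \<le> a" and Af: "A < f"
    and q: "continuous_on UNIV q" "\<And>y. y \<noteq> f \<Longrightarrow> 0 < q y" "\<And>y. \<bar>poly g y\<bar> \<le> q y"
  shows "\<exists>k>0. \<forall>y. A \<le> y \<longrightarrow> y \<le> f \<longrightarrow> k * (f - y) ^ a \<le> q y"
proof -
  obtain h where h: "g = [:- f, 1:] ^ order f g * h" "\<not> [:- f, 1:] dvd h" using order_decomp[OF g(1)] by blast
  define r where "r = order f g"
  have ra: "r \<le> a" using order_degree[OF g(1), of f] g(3) by (simp add: r_def)
  have "r \<noteq> 0" using g(1,2) by (simp add: r_def order_root)
  have hf: "poly h f \<noteq> 0" using h(2) by (simp add: poly_eq_0_iff_dvd)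
  define c1 where "c1 = \<bar>poly h f\<bar> / 2"
  have c1: "0 < c1" "c1 < \<bar>poly h f\<bar>" using hf by (auto simp: c1_def)
  have "((\<lambda>y. \<bar>poly h y\<bar>) \<longlongrightarrow> \<bar>poly h f\<bar>) (at f)"
    using poly_isCont[of f h] unfolding isCont_def by (intro tendsto_intros)
  then have "\<forall>\<^sub>F y in at f. c1 < \<bar>poly h y\<bar>" using c1(2) by (rule order_tendstoD)
  then obtain e where e: "e > 0" "\<And>y. y \<noteq> f \<Longrightarrow> dist y f < e \<Longrightarrow> c1 < \<bar>poly h y\<bar>"
    by (auto simp: eventually_at)
  \<comment> \<open>Less than 1, so that raising the exponent from \<open>r\<close> to
    \<open>a\<close> makes the power smaller.\<close>
  define e' where "e' = min (min e 1) (f - A) / 2"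
  have e': "0 < e'" "e' < e" "e' < 1" "e' < f - A" using e(1) Af by (auto simp: e'_def)
  have "compact {A..f - e'}" "{A..f - e'} \<noteq> {}" using e' by auto
  then obtain y0 where y0: "y0 \<in> {A..f - e'}" "\<And>y. y \<in> {A..f - e'} \<Longrightarrow> q y0 \<le> q y"
    using continuous_attains_inf[of "{A..f - e'}" q] continuous_on_subset[OF q(1)] by (metis subset_UNIV)
  have qy0: "0 < q y0" using q(2)[of y0] y0(1) e' by auto
  define M where "M = (f - A) ^ a"
  have M: "0 < M" using Af by (simp add: M_def)
  define k where "k = min c1 (q y0 / M)"
  have k: "0 < k" using c1 qy0 M by (simp add: k_def)
  have "k * (f - y) ^ a \<le> q y" if y: "A \<le> y" "y \<le> f" for y
  proof (cases "y \<le> f - e'")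
    case True
    have "(f - y) ^ a \<le> M" unfolding M_def using y by (intro power_mono) auto
    then have "k * (f - y) ^ a \<le> (q y0 / M) * M" using y qy0 M k by (intro mult_mono) (auto simp: k_def)
    also have "\<dots> = q y0" using M by simp
    also have "\<dots> \<le> q y" using y0(2)[of y] y True by auto
    finally show ?thesis .
  next
    case False
    show ?thesis
    proof (cases "y = f")
      case True
      then have "k * (f - y) ^ a = 0" using \<open>r \<noteq> 0\<close> ra by simp
      then show ?thesis using q(3)[of y] by linarith
    next
      case yf: False
      have "(f - y) ^ a \<le> (f - y) ^ r" using y False e' ra by (intro power_decreasing) auto
      then have "k * (f - y) ^ a \<le> c1 * (f - y) ^ r" using c1 k y by (intro mult_mono) (auto simp: k_def)
      also have "\<dots> \<le> \<bar>poly h y\<bar> * (f - y) ^ r"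
        using e(2)[OF yf] False y e' by (intro mult_right_mono) (auto simp: dist_real_def)
      also have "\<dots> = \<bar>poly g y\<bar>"
      proof -
        have "poly g y = (y - f) ^ r * poly h y" by (subst h(1)) (simp add: poly_power r_def)
        moreover have "\<bar>(y - f) ^ r\<bar> = (f - y) ^ r" using y by (simp add: power_abs)
        ultimately show ?thesis by (simp add: abs_mult)
      qed
      also have "\<dots> \<le> q y" by (rule q(3))
      finally show ?thesis .
    qed
  qed
  then show ?thesis using k by blast
qed

lemma degree_spec_le: "degree (spec cs x) \<le> length cs"
  by (rule degree_le) (simp add: coeff_spec)

text \<open>\<open>det\<close> mentions only positivity of the \<open>gs\<close>, since positivity
  is the test that a quotient of positive parts performs. In \<open>iso\<close>,
  \<open>F x ! i\<close> is a root of a polynomial from a derivative-closed family, as Thom's lemma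
  requires.\<close>

locale sann_net =
  fixes m n :: nat and F :: "real list \<Rightarrow> real list" and B :: real
    and gs :: "(real list \<Rightarrow> real) list" and \<C> :: "nat \<Rightarrow> (real list \<Rightarrow> real) list set" and a :: nat
  assumes lenF: "\<And>x. length x = m \<Longrightarrow> length (F x) = n"
    and B: "\<And>x i. length x = m \<Longrightarrow> i < n \<Longrightarrow> \<bar>F x ! i\<bar> < B" and B0: "0 < B"
    and gs: "set gs \<subseteq> Collect (poly_fun m)" "gs \<noteq> []"
    and fin: "\<And>i. i < n \<Longrightarrow> finite (\<C> i)"
    and pf: "\<And>i cs. i < n \<Longrightarrow> cs \<in> \<C> i \<Longrightarrow> set cs \<subseteq> Collect (poly_fun m)"
    and dv: "\<And>i cs. i < n \<Longrightarrow> cs \<in> \<C> i \<Longrightarrow> deriv_coeffs cs \<in> \<C> i"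
    and iso: "\<And>i x. i < n \<Longrightarrow> length x = m \<Longrightarrow> \<exists>cs\<in>\<C> i. spec cs x \<noteq> 0 \<and> poly (spec cs x) (F x ! i) = 0"
    and det: "\<And>u v i cs. length u = m \<Longrightarrow> length v = m \<Longrightarrow>
      (\<And>l. l < length gs \<Longrightarrow> 0 < (gs ! l) u \<longleftrightarrow> 0 < (gs ! l) v) \<Longrightarrow> i < n \<Longrightarrow> cs \<in> \<C> i \<Longrightarrow>
      sgn (poly (spec cs u) (F u ! i)) = sgn (poly (spec cs v) (F v ! i))"
    and a2: "2 \<le> a" and a: "\<And>i cs. i < n \<Longrightarrow> cs \<in> \<C> i \<Longrightarrow> length cs \<le> a"
begin

abbreviation "R \<equiv> length gs"

definition code :: "nat \<Rightarrow> real list \<Rightarrow> nat" where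
  "code r x = (\<Sum>l<r. of_bool (0 < (gs ! l) x) * 2 ^ l)"

lemma code_Suc: "code (Suc r) x = code r x + of_bool (0 < (gs ! r) x) * 2 ^ r"
  by (simp only: code_def sum.lessThan_Suc)

lemma code_less: "code r x < 2 ^ r"
proof -
  have "code r x \<le> (\<Sum>l<r. 2 ^ l)" unfolding code_def by (intro sum_mono) (simp add: of_bool_def)
  also have "\<dots> < 2 ^ r" by (induction r) auto
  finally show ?thesis .
qed

lemma code_inj:
  assumes "code R u = code R v" "l < R" shows "0 < (gs ! l) u \<longleftrightarrow> 0 < (gs ! l) v"
proof -
  have "code R x = horner_sum of_bool 2 (map (\<lambda>g. 0 < g x) gs)" for x
    unfolding code_def horner_sum_eq_sum by (intro sum.cong) auto
  then have "bit (code R x) l \<longleftrightarrow> 0 < (gs ! l) x" for x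
    using assms(2) by (simp add: bit_horner_sum_bit_iff)
  then show ?thesis using assms(1) by metis
qed

text \<open>A sample point for each code. Reading the sign conditions off at the sample makes them
  constants for fixed \<open>c\<close>, so that \<open>gap\<close> is an ISD function of
  \<open>x\<close> and \<open>y\<close>.\<close>

definition rep :: "nat \<Rightarrow> real list" where
  "rep c = (SOME x. length x = m \<and> code R x = c)"

lemma rep: "length x = m \<Longrightarrow> length (rep (code R x)) = m \<and> code R (rep (code R x)) = code R x"
  unfolding rep_def by (rule someI[of _ x]) simp

text \<open>The sum of the violations, at \<open>y\<close>, of the sign conditions that \<open>F x ! i\<close> satisfies for the
  points \<open>x\<close> with code \<open>c\<close>; by Thom's lemma it vanishes only at \<open>y = F x ! i\<close>.\<close>

definition gap :: "nat \<Rightarrow> nat \<Rightarrow> real list \<Rightarrow> real \<Rightarrow> real" where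
  "gap i c x y = (\<Sum>cs\<in>\<C> i. violation (poly (spec cs (rep c)) (F (rep c) ! i)) (poly (spec cs x) y))"

lemma gap_nonneg: "0 \<le> gap i c x y"
  unfolding gap_def by (intro sum_nonneg violation_nonneg)

lemma gap_code:
  assumes i: "i < n" and x: "length x = m"
  shows "gap i (code R x) x y = (\<Sum>cs\<in>\<C> i. violation (poly (spec cs x) (F x ! i)) (poly (spec cs x) y))"
  unfolding gap_def
proof (rule sum.cong[OF refl])
  fix cs assume "cs \<in> \<C> i"
  then have "sgn (poly (spec cs (rep (code R x))) (F (rep (code R x)) ! i)) = sgn (poly (spec cs x) (F x ! i))"
    using rep[OF x] x i by (intro det) (auto intro!: code_inj)
  from violation_cong[OF this] show "violation (poly (spec cs (rep (code R x))) (F (rep (code R x)) ! i)) (poly (spec cs x) y) =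
      violation (poly (spec cs x) (F x ! i)) (poly (spec cs x) y)" by simp
qed

text \<open>Positivity away from the value is Thom's lemma. The upper bound holds because each
  violation is at most the change of the polynomial from its value at \<open>F x ! i\<close>; the
  lower bound comes from the summand of a nonzero polynomial vanishing there, which is its absolute
  value.\<close>

lemma gap_sweep:
  assumes i: "i < n" and x: "length x = m"
  shows "\<exists>L k. sweep (gap i (code R x) x) (- B) (F x ! i) L k a"
proof -
  let ?f = "F x ! i"
  let ?q = "gap i (code R x) x"
  have q: "?q y = (\<Sum>cs\<in>\<C> i. violation (poly (spec cs x) ?f) (poly (spec cs x) y))" for y
    by (rule gap_code[OF i x])
  have cont: "continuous_on UNIV ?q"
    unfolding gap_def by (intro continuous_on_sum continuous_on_violation continuous_intros)
  have q0: "?q ?f = 0" unfolding q by (auto simp: violation_eq_0_iff sign_compat_def intro!: sum.neutral)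
  have le: "violation (poly (spec cs x) ?f) (poly (spec cs x) y) \<le> ?q y" if "cs \<in> \<C> i" for cs y
    unfolding q using fin[OF i] that by (intro member_le_sum violation_nonneg)
  obtain g where g: "g \<in> \<C> i" "spec g x \<noteq> 0" "poly (spec g x) ?f = 0" using iso[OF i x] by blast
  have pos: "0 < ?q y" if "y \<noteq> ?f" for y
  proof (rule ccontr)
    assume "\<not> 0 < ?q y"
    then have "?q y = 0" using gap_nonneg[of i _ x y] by (simp add: antisym)
    then have z: "violation (poly (spec cs x) ?f) (poly (spec cs x) y) = 0" if "cs \<in> \<C> i" for cs
      using le[OF that, of y] violation_nonneg by (simp add: antisym)
    have "y = ?f"
    proof (rule sign_compat_unique[where \<F> = "(\<lambda>cs. spec cs x) ` \<C> i"])
      show "pderiv p \<in> (\<lambda>cs. spec cs x) ` \<C> i" if "p \<in> (\<lambda>cs. spec cs x) ` \<C> i" for p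
        using that dv[OF i] by (auto simp flip: spec_deriv_coeffs)
      show "sign_compat (poly p ?f) (poly p y)" if "p \<in> (\<lambda>cs. spec cs x) ` \<C> i" for p
        using that z violation_eq_0_iff by auto
    qed (use g in auto)
    then show False using that by simp
  qed
  have Bf: "- B < ?f" using B[OF x i] by linarith
  have "\<exists>k>0. \<forall>y. - B - 1 \<le> y \<longrightarrow> y \<le> ?f \<longrightarrow> k * (?f - y) ^ a \<le> ?q y"
  proof (rule poly_vanishing_order[OF g(2,3) _ _ cont pos])
    show "degree (spec g x) \<le> a" using degree_spec_le[of g x] a[OF i g(1)] by linarith
    show "- B - 1 < ?f" using Bf by simp
    show "\<bar>poly (spec g x) y\<bar> \<le> ?q y" for y using le[OF g(1), of y] by (simp add: g(3) violation_0)
  qed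
  then obtain k where k: "k > 0" "\<And>y. - B - 1 \<le> y \<Longrightarrow> y \<le> ?f \<Longrightarrow> k * (?f - y) ^ a \<le> ?q y" by blast
  have "\<forall>cs\<in>\<C> i. \<exists>L\<ge>0. \<forall>y. - B - 1 \<le> y \<longrightarrow> y \<le> ?f \<longrightarrow> \<bar>poly (spec cs x) y - poly (spec cs x) ?f\<bar> \<le> L * (?f - y)"
    using poly_Lipschitz_at by blast
  from bchoice[OF this] obtain L where L: "\<forall>cs\<in>\<C> i. L cs \<ge> 0 \<and> (\<forall>y. - B - 1 \<le> y \<longrightarrow> y \<le> ?f \<longrightarrow>
      \<bar>poly (spec cs x) y - poly (spec cs x) ?f\<bar> \<le> L cs * (?f - y))" ..
  \<comment> \<open>The summand 1 keeps \<open>K\<close> positive even if all Lipschitz constants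
    are 0.\<close>
  define K where "K = 1 + (\<Sum>cs\<in>\<C> i. L cs)"
  have K: "0 < K" unfolding K_def using L by (intro add_pos_nonneg sum_nonneg) auto
  have up: "?q y \<le> K * (?f - y)" if y: "- B - 1 \<le> y" "y \<le> ?f" for y
  proof -
    have "?q y \<le> (\<Sum>cs\<in>\<C> i. L cs * (?f - y))"
      unfolding q
    proof (rule sum_mono)
      fix cs assume "cs \<in> \<C> i"
      then have "\<bar>poly (spec cs x) y - poly (spec cs x) ?f\<bar> \<le> L cs * (?f - y)" using L y by blast
      then show "violation (poly (spec cs x) ?f) (poly (spec cs x) y) \<le> L cs * (?f - y)"
        using violation_le order_trans by blast
    qed
    also have "\<dots> = (K - 1) * (?f - y)" by (simp add: K_def sum_distrib_right)
    also have "\<dots> \<le> K * (?f - y)" using y by (intro mult_right_mono) auto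
    finally show ?thesis .
  qed
  have "sweep ?q (- B) ?f K k a"
    by unfold_locales (fact cont q0 pos Bf K k a2 up)+
  then show ?thesis by blast
qed


text \<open>Phases: \<open>n\<close> of them lower the outputs to \<open>- B\<close>,
  \<open>R\<close> add the bits of the code into component \<open>n\<close>, and \<open>n\<close>
  sweep the outputs upwards.\<close>

definition J :: nat where "J = n + R + n"

text \<open>Larger than every arrival time \<open>F x ! i + B + 1\<close>, uniformly in
  \<open>x\<close>, since \<open>F x ! i < B\<close>.\<close>

definition T :: real where "T = 2 * B + 2"

definition \<iota> :: "nat \<Rightarrow> nat" where
  "\<iota> j = (if j < n then j else if j < n + R then n else j - (n + R))"

text \<open>Local time of phase \<open>j\<close>. In \<open>w = x @ z @ [s]\<close> the outputs
  start at index \<open>m\<close>, the code is at \<open>m + n\<close> and the time at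
  \<open>m + n + 1\<close>.\<close>

definition lt :: "nat \<Rightarrow> real list \<Rightarrow> real" where
  "lt j w = real J * w ! (m + n + 1) - real j"

definition pulse :: "nat \<Rightarrow> real list \<Rightarrow> real" where
  "pulse j w = 6 * real J * max 0 (lt j w * (1 - lt j w))"

text \<open>The hat functions equal 1 at their own integer and 0 at all others, so at an integer
  code the sum selects the \<open>gap\<close> for that code while staying ISD.\<close>

definition gapw :: "nat \<Rightarrow> real list \<Rightarrow> real" where
  "gapw i w = (\<Sum>c<2 ^ R. max 0 (1 - \<bar>w ! (m + n) - real c\<bar>) * gap i c w (w ! (m + i)))"

definition num :: "nat \<Rightarrow> real list \<Rightarrow> real" where
  "num j w = (if j < n then - B else if j < n + R then 2 ^ (j - n) * max ((gs ! (j - n)) w) 0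
     else T * gapw (j - (n + R)) w)"

definition den :: "nat \<Rightarrow> real list \<Rightarrow> real" where
  "den j w = (if j < n then 1 else if j < n + R then max ((gs ! (j - n)) w) 0
     else gapw (j - (n + R)) w + max 0 (w ! (m + (j - (n + R))) + B + 1 - T * ramp (lt j w)) ^ Suc a)"

definition dd :: "real list \<Rightarrow> real" where
  "dd w = (\<Sum>j<J. pulse j w * den j w)"

text \<open>One scalar \<open>dd\<close> serves as denominator for all phases. When only phase
  \<open>j\<close> has a nonzero pulse, the squared pulse here leaves one factor in the quotient,
  which is the velocity profile times \<open>num / den\<close>.\<close>

definition bb :: "nat \<Rightarrow> real list \<Rightarrow> real" where
  "bb i w = (\<Sum>j<J. if i = \<iota> j then (pulse j w)\<^sup>2 * num j w else 0)"

text \<open>A bound on the velocities, with pulses at most \<open>6 * J\<close> and quotients at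
  most \<open>B + 2 ^ R + T\<close>; during the phases the clamp therefore never acts.\<close>

definition cmax :: real where
  "cmax = 6 * real J * (B + 2 ^ R + T)"

lemma J_pos: "0 < J" and T_pos: "0 < T" and cmax_nonneg: "0 \<le> cmax"
  using gs(2) B0 by (auto simp: J_def T_def cmax_def)

section \<open>Membership in the class of ISD networks\<close>

abbreviation "N \<equiv> m + Suc n + 1"

lemma phase_cases:
  assumes "j < J"
  obtains "j < n" | "\<not> j < n" "j < n + R" | "\<not> j < n" "\<not> j < n + R" "j - (n + R) < n"
proof -
  have "j - (n + R) < n" if "\<not> j < n + R" using assms that unfolding J_def by arith
  then show thesis using that by fastforce
qed

lemma isd_abs: "isd_gen N' f \<Longrightarrow> isd_gen N' (\<lambda>w. \<bar>f w\<bar>)"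
proof -
  assume f: "isd_gen N' f"
  have "(\<lambda>w. \<bar>f w\<bar>) = (\<lambda>w. max (f w) (- f w))" by (auto simp: max_def)
  then show ?thesis using isd_max[OF f isd_uminus[OF f]] by simp
qed

lemma isd_violation: "isd_gen N' f \<Longrightarrow> isd_gen N' (\<lambda>w. violation c (f w))"
  unfolding violation_def
  by (cases "0 < c"; cases "c < 0") (auto intro!: isd_max isd_const isd_uminus isd_abs)

lemma isd_proj: "i < N' \<Longrightarrow> isd_gen N' (\<lambda>w. w ! i)"
  by (intro isd_poly pf_proj)

lemma isd_gap: "i < n \<Longrightarrow> isd_gen N (\<lambda>w. gap i c w (w ! (m + i)))"
proof -
  assume i: "i < n"
  have "poly_fun N (\<lambda>w. poly (spec cs w) (w ! (m + i)))" if "cs \<in> \<C> i" for cs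
  proof (rule poly_fun_poly_spec)
    show "set cs \<subseteq> Collect (poly_fun N)" using pf[OF i that] poly_fun_mono[of m _ N] by auto
    show "poly_fun N (\<lambda>w. w ! (m + i))" using i by (intro pf_proj) simp
  qed
  then show ?thesis unfolding gap_def by (intro isd_sum isd_violation isd_poly)
qed

lemma isd_gapw: "i < n \<Longrightarrow> isd_gen N (gapw i)"
  unfolding gapw_def[abs_def]
  by (intro isd_sum isd_mult isd_max isd_const isd_diff isd_abs isd_proj isd_gap) auto

lemma isd_lt: "isd_gen N (lt j)"
  unfolding lt_def[abs_def] by (intro isd_diff isd_mult isd_const isd_proj) simp

lemma isd_pulse: "isd_gen N (pulse j)"
  unfolding pulse_def[abs_def] by (intro isd_mult isd_max isd_diff isd_const isd_lt)

lemma isd_gs: "l < R \<Longrightarrow> isd_gen N (gs ! l)"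
  using gs(1) nth_mem poly_fun_mono[of m "gs ! l" N] by (intro isd_poly) auto

lemma isd_num:
  assumes "j < J" shows "isd_gen N (num j)"
proof -
  from assms show ?thesis
  proof (cases rule: phase_cases)
    case 1
    then have "num j = (\<lambda>w. - B)" by (auto simp: num_def)
    then show ?thesis by (simp add: isd_const)
  next
    case 2
    then have "num j = (\<lambda>w. 2 ^ (j - n) * max ((gs ! (j - n)) w) 0)" by (auto simp: num_def)
    moreover have "isd_gen N (\<lambda>w. 2 ^ (j - n) * max ((gs ! (j - n)) w) 0)"
      by (intro isd_mult isd_max isd_const isd_gs) (use 2 in simp)
    ultimately show ?thesis by simp
  next
    case 3
    then have "num j = (\<lambda>w. T * gapw (j - (n + R)) w)" by (auto simp: num_def)
    moreover have "isd_gen N (\<lambda>w. T * gapw (j - (n + R)) w)"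
      by (intro isd_mult isd_const isd_gapw) (use 3 in simp)
    ultimately show ?thesis by simp
  qed
qed

lemma isd_den:
  assumes "j < J" shows "isd_gen N (den j)"
proof -
  from assms show ?thesis
  proof (cases rule: phase_cases)
    case 1
    then have "den j = (\<lambda>w. 1)" by (auto simp: den_def)
    then show ?thesis by (simp add: isd_const)
  next
    case 2
    then have "den j = (\<lambda>w. max ((gs ! (j - n)) w) 0)" by (auto simp: den_def)
    moreover have "isd_gen N (\<lambda>w. max ((gs ! (j - n)) w) 0)"
      by (intro isd_max isd_const isd_gs) (use 2 in simp)
    ultimately show ?thesis by simp
  next
    case 3
    then have "den j = (\<lambda>w. gapw (j - (n + R)) w +
      max 0 (w ! (m + (j - (n + R))) + B + 1 - T * ((lt j w)\<^sup>2 * (3 - 2 * lt j w))) ^ Suc a)"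
      by (auto simp: den_def ramp_def)
    moreover have "isd_gen N (\<lambda>w. gapw (j - (n + R)) w +
      max 0 (w ! (m + (j - (n + R))) + B + 1 - T * ((lt j w)\<^sup>2 * (3 - 2 * lt j w))) ^ Suc a)"
      by (intro isd_add isd_power isd_max isd_diff isd_mult isd_const isd_proj isd_gapw isd_lt) (use 3 in simp_all)
    ultimately show ?thesis by simp
  qed
qed

lemma isd_dd: "isd_gen N dd"
  unfolding dd_def[abs_def] by (intro isd_sum isd_mult isd_pulse isd_den) simp

lemma isd_bb: "isd_gen N (bb i)"
proof -
  have "isd_gen N (\<lambda>w. if i = \<iota> j then (pulse j w)\<^sup>2 * num j w else 0)" if "j < J" for j
  proof (cases "i = \<iota> j")
    case True
    have "isd_gen N (\<lambda>w. (pulse j w)\<^sup>2 * num j w)" using that by (intro isd_mult isd_power isd_pulse isd_num)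
    then show ?thesis using True by simp
  qed (simp add: isd_const)
  then show ?thesis unfolding bb_def[abs_def] by (intro isd_sum) auto
qed

lemma ISDnet: "ISDnet m n 1 (\<lambda>i j w. if i = j then dd w else 0) bb"
proof -
  have "isd_gen (m + (n + 1) + 1) (\<lambda>w. if i = j then dd w else 0)" for i j :: nat
    using isd_dd isd_const by (cases "i = j") auto
  moreover have "isd_gen (m + (n + 1) + 1) (bb i)" for i using isd_bb by simp
  ultimately show ?thesis unfolding ISDnet_def ISD_def by blast
qed

section \<open>The velocity field within a phase\<close>

lemma pulse_other:
  fixes s :: real
  assumes j: "j < J" and s: "s \<in> {real j / J..real (Suc j) / J}" and l: "length x = m" "length z = Suc n" and ne: "l \<noteq> j"
  shows "pulse l (x @ z @ [s]) = 0"
proof -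
  have b: "real j \<le> J * s" "J * s \<le> real (Suc j)" using s J_pos by (auto simp: field_simps)
  have w: "(x @ z @ [s]) ! (m + n + 1) = s" using l by (simp add: nth_append)
  let ?u = "real J * s - real l"
  have "?u * (1 - ?u) \<le> 0"
  proof (cases "l < j")
    case True
    then have "real l + 1 \<le> real j" by simp
    then have "1 \<le> ?u" using b by linarith
    then show ?thesis by (intro mult_nonneg_nonpos) auto
  next
    case False
    then have "real j + 1 \<le> real l" using ne by simp
    then have "?u \<le> 0" using b by simp
    then show ?thesis by (intro mult_nonpos_nonneg) auto
  qed
  then show ?thesis unfolding pulse_def lt_def w by simp
qed

lemma pulse_self:
  fixes s :: real
  assumes j: "j < J" and s: "s \<in> {real j / J..real (Suc j) / J}" and l: "length x = m" "length z = Suc n"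
  shows "pulse j (x @ z @ [s]) = 6 * real J * ((J * s - real j) * (1 - (J * s - real j)))"
    "pulse j (x @ z @ [s]) \<in> {0..6 * real J}"
proof -
  have b: "real j \<le> J * s" "J * s \<le> real (Suc j)" using s J_pos by (auto simp: field_simps)
  have w: "(x @ z @ [s]) ! (m + n + 1) = s" using l by (simp add: nth_append)
  let ?u = "real J * s - real j"
  have u: "0 \<le> ?u" "?u \<le> 1" using b by auto
  have p: "0 \<le> ?u * (1 - ?u)" by (rule mult_nonneg_nonneg) (use u in simp_all)
  have p2: "?u * (1 - ?u) \<le> 1" by (rule mult_le_one) (use u in simp_all)
  show 1: "pulse j (x @ z @ [s]) = 6 * real J * (?u * (1 - ?u))" using p unfolding pulse_def lt_def w by simp
  have "6 * real J * (?u * (1 - ?u)) \<le> 6 * real J * 1" by (rule mult_left_mono[OF p2]) simp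
  moreover have "0 \<le> 6 * real J * (?u * (1 - ?u))" using p by (rule mult_nonneg_nonneg[rotated]) simp
  ultimately show "pulse j (x @ z @ [s]) \<in> {0..6 * real J}" unfolding 1 by simp
qed

lemma gapw_nonneg: "0 \<le> gapw i w"
  unfolding gapw_def by (intro sum_nonneg mult_nonneg_nonneg gap_nonneg) auto

lemma ratio_bound:
  assumes "j < J" shows "\<bar>num j w / den j w\<bar> \<le> B + 2 ^ R + T"
proof -
  consider "j < n" | "\<not> j < n" "j < n + R" | "\<not> j < n" "\<not> j < n + R" by blast
  then show ?thesis
  proof cases
    case 1
    then show ?thesis using B0 T_pos by (simp add: num_def den_def)
  next
    case 2
    have p: "(2::real) ^ (j - n) \<le> 2 ^ R" using 2 by (intro power_increasing) auto
    have "num j w / den j w = (if 0 < (gs ! (j - n)) w then 2 ^ (j - n) else 0)"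
      using 2 by (simp add: num_def den_def max_def)
    moreover have "\<bar>if 0 < (gs ! (j - n)) w then 2 ^ (j - n) else 0 :: real\<bar> \<le> 2 ^ R" using p by simp
    ultimately show ?thesis using B0 T_pos by linarith
  next
    case 3
    define q where "q = gapw (j - (n + R)) w"
    define M where "M = max 0 (w ! (m + (j - (n + R))) + B + 1 - T * ramp (lt j w)) ^ Suc a"
    have q: "0 \<le> q" "0 \<le> M" using gapw_nonneg by (auto simp: q_def M_def)
    have e: "num j w / den j w = T * (q / (q + M))" using 3 by (simp add: num_def den_def q_def M_def)
    have "0 \<le> q / (q + M)" "q / (q + M) \<le> 1" using q by (auto simp: divide_le_eq_1)
    then have "0 \<le> T * (q / (q + M))" "T * (q / (q + M)) \<le> T * 1" using T_pos
      by (auto intro!: mult_nonneg_nonneg mult_left_mono simp del: times_divide_eq_right mult_1_right)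
    moreover have "(0::real) \<le> 2 ^ R" by simp
    ultimately show ?thesis unfolding e using B0 by linarith
  qed
qed

lemma field_eq:
  fixes s :: real
  assumes j: "j < J" and s: "s \<in> {real j / J..real (Suc j) / J}" and l: "length x = m" "length z = Suc n"
  defines "w \<equiv> x @ z @ [s]"
  shows "clamp cmax (bb i w / dd w) = (if i = \<iota> j then J * (6 * (J * s - real j) * (1 - (J * s - real j)) * (num j w / den j w)) else 0)"
proof -
  note other = pulse_other[OF j s l, folded w_def]
  note self = pulse_self[OF j s l, folded w_def]
  have dd: "dd w = pulse j w * den j w"
  proof -
    have "dd w = (\<Sum>l<J. if l = j then pulse j w * den j w else 0)"
      unfolding dd_def using other by (intro sum.cong) auto
    then show ?thesis using j by simp
  qed
  have bb: "bb i w = (if i = \<iota> j then (pulse j w)\<^sup>2 * num j w else 0)"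
  proof -
    have "bb i w = (\<Sum>l<J. if l = j then (if i = \<iota> j then (pulse j w)\<^sup>2 * num j w else 0) else 0)"
      unfolding bb_def using other by (intro sum.cong) auto
    then show ?thesis using j by simp
  qed
  show ?thesis
  proof (cases "i = \<iota> j")
    case False
    then show ?thesis using cmax_nonneg by (simp add: bb clamp_def)
  next
    case True
    \<comment> \<open>Also true for a vanishing pulse or denominator, where both sides are 0 by the
      convention for division.\<close>
    have e: "bb i w / dd w = pulse j w * (num j w / den j w)"
      unfolding bb dd using True by (simp add: power2_eq_square)
    have "\<bar>pulse j w * (num j w / den j w)\<bar> \<le> 6 * real J * (B + 2 ^ R + T)"
      unfolding abs_mult using self(2) ratio_bound[OF j, of w] by (intro mult_mono) auto
    then have "clamp cmax (bb i w / dd w) = pulse j w * (num j w / den j w)"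
      unfolding e clamp_def cmax_def by linarith
    then show ?thesis using True unfolding self(1) by simp
  qed
qed

text \<open>The state when phase \<open>j\<close> begins. Output \<open>i\<close> leaves 0 in phase
  \<open>i\<close> and leaves \<open>- B\<close> in phase \<open>n + R + i\<close>; the code
  component holds the bits processed so far.\<close>

definition st :: "real list \<Rightarrow> nat \<Rightarrow> real list" where
  "st x j = map (\<lambda>i. if i < n then (if j \<le> i then 0 else if j \<le> n + R + i then - B else F x ! i)
     else real (code (min (j - n) R) x)) [0..<Suc n]"

lemma st_nth: "i < n \<Longrightarrow> st x j ! i = (if j \<le> i then 0 else if j \<le> n + R + i then - B else F x ! i)"
  "st x j ! n = real (code (min (j - n) R) x)"
  by (simp_all add: st_def nth_append del: upt_Suc)

lemma length_st: "length (st x j) = Suc n"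
  by (simp add: st_def)

lemma st_0: "st x 0 = replicate (Suc n) 0"
  by (intro nth_equalityI) (auto simp: length_st st_nth less_Suc_eq code_def simp del: replicate_Suc)

lemma take_st_J: "length x = m \<Longrightarrow> take n (st x J) = F x"
  using lenF[of x] by (intro nth_equalityI) (auto simp: length_st st_nth J_def)

lemma st_Suc_other: "i < Suc n \<Longrightarrow> i \<noteq> \<iota> j \<Longrightarrow> st x (Suc j) ! i = st x j ! i"
proof -
  assume i: "i < Suc n" "i \<noteq> \<iota> j"
  show ?thesis
  proof (cases "i = n")
    case True
    then have "j < n \<or> n + R \<le> j" using i(2) by (auto simp: \<iota>_def split: if_splits)
    then have "min (Suc j - n) R = min (j - n) R" by auto
    then show ?thesis using True by (simp add: st_nth)
  next
    case False
    then show ?thesis using i by (auto simp: st_nth \<iota>_def split: if_splits)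
  qed
qed

definition Hf :: "real list \<Rightarrow> nat \<Rightarrow> real list \<Rightarrow> real \<Rightarrow> real" where
  "Hf x j z u = num j (x @ z @ [(u + real j) / J]) / den j (x @ z @ [(u + real j) / J])"

lemma gapw_state:
  assumes x: "length x = m" and z: "length z = Suc n" and i: "i < n" and c: "z ! n = real (code R x)"
  shows "gapw i (x @ z @ [s]) = gap i (code R x) x (z ! i)"
proof -
  have w: "(x @ z @ [s]) ! (m + n) = z ! n" "(x @ z @ [s]) ! (m + i) = z ! i"
    using x z i by (simp_all add: nth_append)
  have g: "gap i c (x @ z @ [s]) y = gap i c x y" for c y
    unfolding gap_def using spec_append[OF pf[OF i] x] by (intro sum.cong) auto
  have "gapw i (x @ z @ [s]) = (\<Sum>d<2 ^ R. if d = code R x then gap i (code R x) x (z ! i) else 0)"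
    unfolding gapw_def w g c
  proof (intro sum.cong refl)
    fix d
    have "max 0 (1 - \<bar>real (code R x) - real d\<bar>) = (if d = code R x then 1 else 0)"
    proof (cases "d = code R x")
      case False
      then have "1 \<le> \<bar>int (code R x) - int d\<bar>" by linarith
      then have "1 \<le> \<bar>real (code R x) - real d\<bar>" by linarith
      then show ?thesis using False by simp
    qed simp
    then show "max 0 (1 - \<bar>real (code R x) - real d\<bar>) * gap i d x (z ! i) =
      (if d = code R x then gap i (code R x) x (z ! i) else 0)" by simp
  qed
  then show ?thesis using code_less[of R x] by simp
qed

text \<open>Lowering an output and adding a bit are motions with constant velocity, since
  \<open>x\<close> is fixed. In a sweeping phase the code is complete, so \<open>gapw\<close> is the
  gap function at \<open>x\<close> and \<open>steers_sweep\<close> applies.\<close>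

lemma st_steers:
  assumes x: "length x = m" and j: "j < J"
  shows "steers (\<lambda>y u. Hf x j ((st x j)[\<iota> j := y]) u) (st x j ! \<iota> j) (st x (Suc j) ! \<iota> j)"
proof -
  from j show ?thesis
  proof (cases rule: phase_cases)
    case 1
    then have "(\<lambda>y u. Hf x j ((st x j)[\<iota> j := y]) u) = (\<lambda>_ _. - B)" by (simp add: Hf_def num_def den_def)
    moreover have "st x j ! \<iota> j = 0" "st x (Suc j) ! \<iota> j = 0 + - B" using 1 by (simp_all add: \<iota>_def st_nth)
    ultimately show ?thesis using steers_const[of "- B" 0] by simp
  next
    case 2
    let ?l = "j - n"
    have g: "(gs ! ?l) (x @ y) = (gs ! ?l) x" for y
    proof (rule poly_fun_append[OF _ x])
      have "?l < R" using 2 by simp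
      then show "poly_fun m (gs ! ?l)" using gs(1) nth_mem by blast
    qed
    define c :: real where "c = of_bool (0 < (gs ! ?l) x) * 2 ^ ?l"
    have "(\<lambda>y u. Hf x j ((st x j)[\<iota> j := y]) u) = (\<lambda>_ _. c)"
      using 2 by (auto simp: Hf_def num_def den_def g c_def max_def)
    moreover have "min (j - n) R = ?l" "min (Suc j - n) R = Suc ?l" "\<iota> j = n" using 2 by (auto simp: \<iota>_def)
    then have "st x j ! \<iota> j = real (code ?l x)" "st x (Suc j) ! \<iota> j = real (code ?l x) + c"
      by (simp_all add: st_nth code_Suc c_def)
    ultimately show ?thesis using steers_const[of c "real (code ?l x)"] by simp
  next
    case 3
    define i where "i = j - (n + R)"
    have i: "i < n" "\<iota> j = i" "j = n + R + i" using 3 by (simp_all add: i_def \<iota>_def)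
    obtain L k where sw: "sweep (gap i (code R x) x) (- B) (F x ! i) L k a" using gap_sweep[OF i(1) x] by blast
    have lt: "F x ! i - (- B) + 1 < T" using B[OF x i(1)] by (simp add: T_def)
    have "Hf x j ((st x j)[\<iota> j := y]) u = T * gap i (code R x) x y /
        (gap i (code R x) x y + max 0 (y - (- B) + 1 - T * ramp u) ^ Suc a)" for y u
    proof -
      let ?z = "(st x j)[i := y]"
      let ?w = "x @ ?z @ [(u + real j) / J]"
      have lz: "length ?z = Suc n" by (simp add: length_st)
      have zi: "?z ! i = y" using i by (simp add: length_st)
      have zn: "?z ! n = real (code R x)" using i by (simp add: st_nth)
      have gw: "gapw i ?w = gap i (code R x) x y" using gapw_state[OF x lz i(1) zn] zi by simp
      have wi: "?w ! (m + i) = y" using x lz i zi by (simp add: nth_append)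
      have lt: "lt j ?w = u" using x lz J_pos by (simp add: lt_def nth_append)
      show ?thesis unfolding Hf_def i(2) using 3 gw wi lt by (simp add: num_def den_def flip: i_def)
    qed
    then have "(\<lambda>y u. Hf x j ((st x j)[\<iota> j := y]) u) = (\<lambda>y u. T * gap i (code R x) x y /
        (gap i (code R x) x y + max 0 (y - (- B) + 1 - T * ramp u) ^ Suc a))" by (intro ext)
    moreover have "st x j ! \<iota> j = - B" "st x (Suc j) ! \<iota> j = F x ! i"
      using i by (simp_all add: st_nth)
    ultimately show ?thesis using steers_sweep[OF sw lt] by simp
  qed
qed

lemma SANN_lim:
  assumes x: "length x = m"
  shows "SANN_lim_eq m n 1 (\<lambda>i j w. if i = j then dd w else 0) bb x cmax (F x)"
proof -
  let ?V = "\<lambda>s z i. clamp cmax (bb i (x @ z @ [s]) / dd (x @ z @ [s]))"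
  interpret phases J "Suc n" \<iota> "Hf x" ?V "st x"
  proof
    show "0 < J" by (rule J_pos)
    show "\<iota> j < Suc n" if "j < J" for j using that by (auto simp: \<iota>_def J_def)
    show "length (st x j) = Suc n" for j by (rule length_st)
    show "st x (Suc j) ! i = st x j ! i" if "i < Suc n" "i \<noteq> \<iota> j" for i j using st_Suc_other that by blast
    show "steers (\<lambda>y. Hf x j ((st x j)[\<iota> j := y])) (st x j ! \<iota> j) (st x (Suc j) ! \<iota> j)" if "j < J" for j
      by (rule st_steers[OF x that])
    show "clamp cmax (bb i (x @ z @ [s]) / dd (x @ z @ [s])) =
      (if i = \<iota> j then J * (6 * (J * s - real j) * (1 - (J * s - real j)) * Hf x j z (J * s - real j)) else 0)"
      if "j < J" "s \<in> {real j / J..real (Suc j) / J}" "length z = Suc n" for j z i and s :: real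
      using field_eq[OF that(1,2) x that(3)] J_pos by (simp add: Hf_def)
  qed
  have sol: "SANN_solution m n 1 (\<lambda>i j w. if i = j then dd w else 0) bb x cmax z \<longleftrightarrow> sol z" for z
    unfolding SANN_solution_def sol_def clamp_sol_scalar[OF cmax_nonneg] st_0 by (simp add: nth_append del: upt_Suc replicate_Suc)
  show ?thesis unfolding SANN_lim_eq_def sol
  proof (intro conjI allI impI)
    fix z assume "sol z"
    then show "take n (z 1) = F x" using sol_end take_st_J[OF x] by simp
  qed (rule ex_sol)
qed

end

section \<open>Obtaining the data of the network from \<open>F\<close>\<close>

lemma component_sgn_determined:
  assumes "semialg_fun m n F" "i < n" "set cs \<subseteq> Collect (poly_fun m)"
  shows "\<exists>G. finite G \<and> G \<subseteq> Collect (poly_fun m) \<and> (\<forall>u v. length u = m \<longrightarrow> length v = m \<longrightarrow>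
    (\<forall>g\<in>G. sgn (g u) = sgn (g v)) \<longrightarrow> sgn (poly (spec cs u) (F u ! i)) = sgn (poly (spec cs v) (F v ! i)))"
proof -
  let ?s = "\<lambda>u. sgn (poly (spec cs u) (F u ! i))"
  obtain G where G: "finite G" "G \<subseteq> Collect (poly_fun m)"
    "\<And>u v. length u = m \<Longrightarrow> length v = m \<Longrightarrow> \<forall>g\<in>G. sgn (g u) = sgn (g v) \<Longrightarrow> u \<in> {u. ?s u = 1} \<longleftrightarrow> v \<in> {u. ?s u = 1}"
    by (rule sign_determinedE[OF sign_determined_sgn_component[OF assms, of "\<lambda>s. s = 1"]]) (rule that)
  obtain G' where G': "finite G'" "G' \<subseteq> Collect (poly_fun m)"
    "\<And>u v. length u = m \<Longrightarrow> length v = m \<Longrightarrow> \<forall>g\<in>G'. sgn (g u) = sgn (g v) \<Longrightarrow> u \<in> {u. ?s u = - 1} \<longleftrightarrow> v \<in> {u. ?s u = - 1}"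
    by (rule sign_determinedE[OF sign_determined_sgn_component[OF assms, of "\<lambda>s. s = - 1"]]) (rule that)
  have eq: "?s u = ?s v" if l: "length u = m" "length v = m" and "\<forall>g\<in>G \<union> G'. sgn (g u) = sgn (g v)" for u v
  proof -
    have "\<forall>g\<in>G. sgn (g u) = sgn (g v)" "\<forall>g\<in>G'. sgn (g u) = sgn (g v)" using that by blast+
    then have "?s u = 1 \<longleftrightarrow> ?s v = 1" "?s u = - 1 \<longleftrightarrow> ?s v = - 1" using G(3)[OF l] G'(3)[OF l] by auto
    then show ?thesis by (auto simp: sgn_if split: if_splits)
  qed
  show ?thesis
  proof (intro exI conjI allI impI)
    show "finite (G \<union> G')" "G \<union> G' \<subseteq> Collect (poly_fun m)" using G G' by auto
  qed (rule eq)
qed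

lemma ex_sann_net:
  assumes F: "semialg_fun m n F" and b: "bounded_fun m n F"
  shows "\<exists>B gs \<C> a. sann_net m n F B gs \<C> a"
proof -
  obtain B0 where B0: "\<And>x i. length x = m \<Longrightarrow> i < n \<Longrightarrow> \<bar>F x ! i\<bar> \<le> B0" using b by (auto simp: bounded_fun_def)
  define B where "B = \<bar>B0\<bar> + 1"
  have "\<forall>i\<in>{..<n}. \<exists>\<C>. finite \<C> \<and> (\<forall>cs\<in>\<C>. set cs \<subseteq> Collect (poly_fun m)) \<and> (\<forall>cs\<in>\<C>. deriv_coeffs cs \<in> \<C>) \<and>
    (\<forall>x. length x = m \<longrightarrow> (\<exists>cs\<in>\<C>. spec cs x \<noteq> 0 \<and> poly (spec cs x) (F x ! i) = 0))"
    using ex_isolating_family[OF F] by simp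
  from bchoice[OF this] obtain \<C> where \<C>: "\<forall>i\<in>{..<n}. finite (\<C> i) \<and> (\<forall>cs\<in>\<C> i. set cs \<subseteq> Collect (poly_fun m)) \<and>
    (\<forall>cs\<in>\<C> i. deriv_coeffs cs \<in> \<C> i) \<and>
    (\<forall>x. length x = m \<longrightarrow> (\<exists>cs\<in>\<C> i. spec cs x \<noteq> 0 \<and> poly (spec cs x) (F x ! i) = 0))" ..
  have \<C>D: "finite (\<C> i)" "cs \<in> \<C> i \<Longrightarrow> set cs \<subseteq> Collect (poly_fun m)" "cs \<in> \<C> i \<Longrightarrow> deriv_coeffs cs \<in> \<C> i"
    "length x = m \<Longrightarrow> \<exists>cs\<in>\<C> i. spec cs x \<noteq> 0 \<and> poly (spec cs x) (F x ! i) = 0" if "i < n" for i cs x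
    using bspec[OF \<C>, of i] that by simp_all
  define P where "P = (SIGMA i:{..<n}. \<C> i)"
  have finP: "finite P" using \<C>D(1) by (auto simp: P_def)
  have "\<forall>p\<in>P. \<exists>G. finite G \<and> G \<subseteq> Collect (poly_fun m) \<and> (\<forall>u v. length u = m \<longrightarrow> length v = m \<longrightarrow>
    (\<forall>g\<in>G. sgn (g u) = sgn (g v)) \<longrightarrow> sgn (poly (spec (snd p) u) (F u ! fst p)) = sgn (poly (spec (snd p) v) (F v ! fst p)))"
  proof
    fix p assume "p \<in> P"
    then have "fst p < n" "set (snd p) \<subseteq> Collect (poly_fun m)" using \<C>D(2)[of "fst p" "snd p"] by (auto simp: P_def)
    then show "\<exists>G. finite G \<and> G \<subseteq> Collect (poly_fun m) \<and> (\<forall>u v. length u = m \<longrightarrow> length v = m \<longrightarrow>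
      (\<forall>g\<in>G. sgn (g u) = sgn (g v)) \<longrightarrow> sgn (poly (spec (snd p) u) (F u ! fst p)) = sgn (poly (spec (snd p) v) (F v ! fst p)))"
      by (rule component_sgn_determined[OF F])
  qed
  from bchoice[OF this] obtain G where G: "\<forall>p\<in>P. finite (G p) \<and> G p \<subseteq> Collect (poly_fun m) \<and> (\<forall>u v. length u = m \<longrightarrow> length v = m \<longrightarrow>
    (\<forall>g\<in>G p. sgn (g u) = sgn (g v)) \<longrightarrow> sgn (poly (spec (snd p) u) (F u ! fst p)) = sgn (poly (spec (snd p) v) (F v ! fst p)))" ..
  define U where "U = (\<Union>p\<in>P. G p)"
  \<comment> \<open>Adding the negated polynomials makes positivity tests recover full signs; the
    zero function ensures that there is at least one phase, even for \<open>n = 0\<close>.\<close>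
  define U' where "U' = insert (\<lambda>_. 0) (U \<union> (\<lambda>g x. - g x) ` U)"
  have U: "finite U" "U \<subseteq> Collect (poly_fun m)" using finP G unfolding U_def by blast+
  have "finite U'" using U by (simp add: U'_def)
  then obtain gs where gs: "set gs = U'" using finite_list by blast
  \<comment> \<open>The sum dominates the length of every list in every family, hence all degrees;
    the 2 is for \<open>2 \<le> a\<close>.\<close>
  define a where "a = 2 + (\<Sum>p\<in>P. length (snd p))"
  have "sann_net m n F B gs \<C> a"
  proof
    show "length (F x) = n" if "length x = m" for x using F that by (simp add: semialg_fun_def)
    show "\<bar>F x ! i\<bar> < B" if "length x = m" "i < n" for x i using B0[OF that] by (simp add: B_def)
    show "0 < B" by (simp add: B_def)
    show "set gs \<subseteq> Collect (poly_fun m)" unfolding gs U'_def using U(2) by (auto intro: pf_const poly_fun_uminus)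
    show "gs \<noteq> []" using gs by (auto simp: U'_def)
    show "2 \<le> a" by (simp add: a_def)
    show "length cs \<le> a" if "i < n" "cs \<in> \<C> i" for i cs
    proof -
      have "length (snd (i, cs)) \<le> (\<Sum>p\<in>P. length (snd p))"
        by (rule member_le_sum) (use that finP in \<open>auto simp: P_def\<close>)
      then show ?thesis by (simp add: a_def)
    qed
    show "sgn (poly (spec cs u) (F u ! i)) = sgn (poly (spec cs v) (F v ! i))"
      if l: "length u = m" "length v = m" and pos: "\<And>l. l < length gs \<Longrightarrow> 0 < (gs ! l) u \<longleftrightarrow> 0 < (gs ! l) v"
        and i: "i < n" "cs \<in> \<C> i" for u v i cs
    proof -
      have p: "0 < g u \<longleftrightarrow> 0 < g v" if "g \<in> U'" for g using pos that gs by (metis in_set_conv_nth)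
      have sg: "sgn (g u) = sgn (g v)" if "g \<in> U" for g
      proof -
        have "0 < g u \<longleftrightarrow> 0 < g v" using p that by (auto simp: U'_def)
        moreover have "0 < - g u \<longleftrightarrow> 0 < - g v" using p[of "\<lambda>x. - g x"] that by (auto simp: U'_def)
        ultimately show ?thesis by (auto simp: sgn_if)
      qed
      have iP: "(i, cs) \<in> P" using i by (simp add: P_def)
      then have "\<forall>g\<in>G (i, cs). sgn (g u) = sgn (g v)" by (intro ballI sg) (auto simp: U_def)
      with bspec[OF G iP, THEN conjunct2, THEN conjunct2, THEN spec, THEN spec, THEN mp, THEN mp, THEN mp] l
      have "sgn (poly (spec (snd (i, cs)) u) (F u ! fst (i, cs))) = sgn (poly (spec (snd (i, cs)) v) (F v ! fst (i, cs)))"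
        by blast
      then show ?thesis unfolding fst_conv snd_conv .
    qed
  qed (fact \<C>D)+
  then show ?thesis by blast
qed

theorem mainTheorem6:
  fixes m n :: nat and F :: "real list \<Rightarrow> real list"
  assumes "semialg_fun m n F" and "bounded_fun m n F"
  shows "\<exists>Mf bf (cmax::real). ISDnet m n 1 Mf bf \<and> cmax \<ge> 0 \<and>
           (\<forall>x. length x = m \<longrightarrow> SANN_lim_eq m n 1 Mf bf x cmax (F x))"
proof -
  obtain B gs \<C> a where "sann_net m n F B gs \<C> a" using ex_sann_net[OF assms] by blast
  then interpret sann_net m n F B gs \<C> a .
  show ?thesis using ISDnet cmax_nonneg SANN_lim by blast
qed

end
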